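(* Let $\alpha\in(0,2)$ and let $k:\mathbb R^d\times\mathbb R^d\to[0,\infty)$ be measurable with $k(x,y)=k(y,x)$ and $k(x,y)\le\Lambda_1|x-y|^{-d-\alpha}$ for almost all $(x,y)$ with $x\ne y$, for some $\Lambda_1>0$. Assume $k$ satisfies (B). Then there are constants $c_0,c_1>0$ with $$c_0\,\mathcal E_\alpha(f,f)\le\mathcal E(f,f)\le c_1\,\mathcal E_\alpha(f,f)\quad\text{for all }f\in C^1_c(\mathbb R^d).$$ Consequently $D(\mathcal E)=H^{\alpha/2}(\mathbb R^d)$.
   Context: For $x\in n^{-1}\mathbb Z^d$ let $\mathfrak Q_n(x)=\prod_{i=1}^d[x_i,x_i+1/n)$, $\mathfrak Q_n=\{\mathfrak Q_n(x):x\in n^{-1}\mathbb Z^d\}$. (B) There are $M_0\in\mathbb N,\Lambda_2>0$ such that for all $\varepsilon>0$, $n\in\mathbb N$ and $\mathcal O,\mathcal Q\in\mathfrak Q_n$ there are $\mathcal P_0=\mathcal O,\mathcal P_1,\dots,\mathcal P_l=\mathcal Q$ in $\mathfrak Q_n$, $l\le M_0$, with $\iint_{\mathcal P_j\times\mathcal P_{j+1}}k(x,y)1_{\{|x-y|\ge\varepsilon\}}dxdy\ge\Lambda_2\iint_{\mathcal O\times\mathcal Q}1_{\{|x-y|\ge\varepsilon\}}|x-y|^{-d-\alpha}dxdy$ for all $j\le l-1$; and for every $(\mathcal R,\mathcal S)\in\mathfrak Q_n^2$ at most $M_0$ pairs $(\mathcal O,\mathcal Q)$ have $\mathcal R=\mathcal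 P_k^{(\mathcal O,\mathcal Q)},\mathcal S=\mathcal P_{k+1}^{(\mathcal O,\mathcal Q)}$ for some $k$. $\mathcal E(f,g)=\frac12\iint_{x\ne y}(f(y)-f(x))(g(y)-g(x))k(x,y)\,dx\,dy$, with $D(\mathcal E)$ the closure of $C^1_c(\mathbb R^d)$ under $\mathcal E_1(f,f)=\mathcal E(f,f)+\|f\|^2_{L^2}$. $\mathcal E_\alpha(f,f)=\iint(f(y)-f(x))^2|x-y|^{-d-\alpha}dx\,dy$ and $H^{\alpha/2}(\mathbb R^d)=\{f\in L^2(\mathbb R^d):\mathcal E_\alpha(f,f)<\infty\}$ with norm $(\|f\|^2_{L^2}+\mathcal E_\alpha(f,f))^{1/2}$. *)

theory Defs
  imports "HOL-Analysis.Analysis"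
begin

definition grid :: "nat \<Rightarrow> 'a::euclidean_space set" where
  "grid n = {x. \<forall>b\<in>Basis. \<exists>z::int. x \<bullet> b = real_of_int z / real n}"

definition cube :: "nat \<Rightarrow> 'a::euclidean_space \<Rightarrow> 'a set" where
  "cube n x = {y. \<forall>b\<in>Basis. x \<bullet> b \<le> y \<bullet> b \<and> y \<bullet> b < x \<bullet> b + 1 / real n}"

definition cubes :: "nat \<Rightarrow> 'a::euclidean_space set set" where
  "cubes n = cube n ` grid n"

definition dint :: "'a::euclidean_space set \<Rightarrow> 'a set \<Rightarrow> ('a \<Rightarrow> 'a \<Rightarrow> real) \<Rightarrow> ennreal" where
  "dint P Q h = (\<integral>\<^sup>+ z. indicator (P \<times> Q) z * ennreal (h (fst z) (snd z)) \<partial>(lborel \<Otimes>\<^sub>M lborel))"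

definition condB :: "real \<Rightarrow> ('a::euclidean_space \<Rightarrow> 'a \<Rightarrow> real) \<Rightarrow> bool" where
  "condB \<alpha> k \<longleftrightarrow> (\<exists>M0::nat. \<exists>\<Lambda>2>0. \<forall>\<epsilon>>0. \<forall>n::nat. n \<ge> 1 \<longrightarrow>
     (\<exists>(path :: 'a set \<times> 'a set \<Rightarrow> nat \<Rightarrow> 'a set) (len :: 'a set \<times> 'a set \<Rightarrow> nat).
        (\<forall>Oc\<in>cubes n. \<forall>Qc\<in>cubes n.
            len (Oc, Qc) \<le> M0 \<and> path (Oc, Qc) 0 = Oc \<and> path (Oc, Qc) (len (Oc, Qc)) = Qc \<and>
            (\<forall>j\<le>len (Oc, Qc). path (Oc, Qc) j \<in> cubes n) \<and>
            (\<forall>j<len (Oc, Qc).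
               dint (path (Oc, Qc) j) (path (Oc, Qc) (Suc j))
                 (\<lambda>x y. k x y * indicator {r. r \<ge> \<epsilon>} (norm (x - y)))
               \<ge> ennreal \<Lambda>2 * dint Oc Qc
                 (\<lambda>x y. indicator {r. r \<ge> \<epsilon>} (norm (x - y)) *
                        norm (x - y) powr (- real DIM('a) - \<alpha>)))) \<and>
        (\<forall>R\<in>cubes n. \<forall>S\<in>cubes n.
            finite {(Oc, Qc). Oc \<in> cubes n \<and> Qc \<in> cubes n \<and>
                    (\<exists>j<len (Oc, Qc). path (Oc, Qc) j = R \<and> path (Oc, Qc) (Suc j) = S)} \<and>
            card {(Oc, Qc). Oc \<in> cubes n \<and> Qc \<in> cubes n \<and>
                    (\<exists>j<len (Oc, Qc). path (Oc, Qc) j = R \<and> path (Oc, Qc) (Suc j) = S)} \<le> M0)))"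

definition Eform :: "('a::euclidean_space \<Rightarrow> 'a \<Rightarrow> real) \<Rightarrow> ('a \<Rightarrow> real) \<Rightarrow> ennreal" where
  "Eform k f = ennreal (1/2) * (\<integral>\<^sup>+ z. indicator {z. fst z \<noteq> snd z} z *
       ennreal ((f (snd z) - f (fst z))\<^sup>2 * k (fst z) (snd z)) \<partial>(lborel \<Otimes>\<^sub>M lborel))"

definition Ealpha :: "real \<Rightarrow> ('a::euclidean_space \<Rightarrow> real) \<Rightarrow> ennreal" where
  "Ealpha \<alpha> f = (\<integral>\<^sup>+ z. ennreal ((f (snd z) - f (fst z))\<^sup>2 *
       norm (fst z - snd z) powr (- real DIM('a) - \<alpha>)) \<partial>(lborel \<Otimes>\<^sub>M lborel))"

definition C1c :: "('a::euclidean_space \<Rightarrow> real) \<Rightarrow> bool" where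
  "C1c f \<longleftrightarrow> (\<exists>f' :: 'a \<Rightarrow> ('a \<Rightarrow>\<^sub>L real).
       (\<forall>x. (f has_derivative blinfun_apply (f' x)) (at x)) \<and> continuous_on UNIV f') \<and>
     compact (closure {x. f x \<noteq> 0})"

definition DomE :: "('a::euclidean_space \<Rightarrow> 'a \<Rightarrow> real) \<Rightarrow> ('a \<Rightarrow> real) set" where
  "DomE k = {f. f \<in> borel_measurable lborel \<and> integrable lborel (\<lambda>x. (f x)\<^sup>2) \<and>
      (\<exists>g :: nat \<Rightarrow> 'a \<Rightarrow> real. (\<forall>m. C1c (g m)) \<and>
         ((\<lambda>m. Eform k (\<lambda>x. f x - g m x) + (\<integral>\<^sup>+ x. ennreal ((f x - g m x)\<^sup>2) \<partial>lborel))
            \<longlonglongrightarrow> 0))}"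

definition Hsob :: "real \<Rightarrow> ('a::euclidean_space \<Rightarrow> real) set" where
  "Hsob \<alpha> = {f. f \<in> borel_measurable lborel \<and> integrable lborel (\<lambda>x. (f x)\<^sup>2) \<and>
      Ealpha \<alpha> f < \<infinity>}"

end

theory Submission
  imports Defs
begin

text \<open>
  Replace \<open>f\<close> by a function constant on the cubes of side \<open>1/n\<close>. Telescoping along the paths of (B) and the
  Cauchy-Schwarz inequality bound the energy of the truncated kernel \<open>|x - y|\<^sup>-\<^sup>d\<^sup>-\<^sup>\<alpha> 1{|x - y| \<ge> \<epsilon>}\<close> by
  \<open>M\<^sub>0\<^sup>3 / \<Lambda>\<^sub>2\<close> times that of \<open>k 1{|x - y| \<ge> \<epsilon>}\<close>: one factor \<open>M\<^sub>0\<close> comes from Cauchy-Schwarz, the other two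
  because an edge lies on at most \<open>M\<^sub>0\<close> paths and at most \<open>M\<^sub>0\<close> times on each. Let \<open>n \<rightarrow> \<infinity>\<close>, then \<open>\<epsilon> \<rightarrow> 0\<close>.

  An \<open>\<E>\<^sub>1\<close>-limit of \<open>C\<^sup>1\<^sub>c\<close> functions lies in \<open>H\<^sup>\<alpha>\<^sup>/\<^sup>2\<close> by the lower bound and Fatou's lemma. Conversely,
  truncation and mollification approximate every element of \<open>H\<^sup>\<alpha>\<^sup>/\<^sup>2\<close>. Mollifying does not increase \<open>\<E>\<^sub>\<alpha>\<close>, and
  almost everywhere convergence without increase of the norm is already convergence in norm.
\<close>

section \<open>Integrability of the Levy kernel\<close>


text \<open>Condition (B) compares integrals over pairs of whole cubes, so the path argument is
  exact only for functions that are constant on cubes. Such functions jump across faces: however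
  close two points are, the increment may be of order 1/n, so the singularity of the full kernel
  cannot be absorbed near the diagonal. This is why \<epsilon> stays fixed while the mesh tends to
  0: the truncated kernels are dominated by a multiple of min(1, |z|^2) |z|^(-d-\<alpha>), which is
  integrable exactly because 0 < \<alpha> < 2. The constants of (B) are chosen before \<epsilon> and
  n, so they survive both limits. They give c0 = \<Lambda>2 / (2 (M0^3 + 1)), while c1 = \<Lambda>1
  / 2 comes from the pointwise bound on k.

  For the domain, the obstacle is that coercivity is known on C^1 functions of compact support only,
  whereas f minus an approximant is not of this kind. Coercivity is therefore applied to differences
  of two approximants, where a uniform bound is enough for Fatou's lemma.\<close>

definition riesz_kernel :: "real \<Rightarrow> 'a::euclidean_space \<Rightarrow> real" where
  "riesz_kernel \<alpha> z = norm z powr (- real DIM('a) - \<alpha>)"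

lemma riesz_kernel_nonneg [simp]: "0 \<le> riesz_kernel \<alpha> z"
  by (simp add: riesz_kernel_def)

lemma measurable_riesz_kernel [measurable]: "riesz_kernel \<alpha> \<in> borel_measurable borel"
  unfolding riesz_kernel_def by measurable

text \<open>Fatou's lemma in the form used for removing the truncation and for passing from
  approximants to an element of the domain: a bound along an almost everywhere convergent sequence
  is inherited by the limit.\<close>

lemma nn_integral_le_tendsto:
  fixes u :: "nat \<Rightarrow> 'a \<Rightarrow> ennreal"
  assumes [measurable]: "\<And>n. u n \<in> borel_measurable M"
    and lim: "AE x in M. (\<lambda>n. u n x) \<longlonglongrightarrow> v x"
    and bd: "eventually (\<lambda>n. (\<integral>\<^sup>+x. u n x \<partial>M) \<le> B) sequentially"
  shows "(\<integral>\<^sup>+x. v x \<partial>M) \<le> B"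
proof -
  have "(\<integral>\<^sup>+x. v x \<partial>M) = (\<integral>\<^sup>+x. liminf (\<lambda>n. u n x) \<partial>M)"
    using lim by (intro nn_integral_cong_AE) (auto elim!: eventually_mono simp: tendsto_iff_Liminf_eq_Limsup)
  also have "\<dots> \<le> liminf (\<lambda>n. \<integral>\<^sup>+x. u n x \<partial>M)"
    by (rule nn_integral_liminf) simp
  also have "\<dots> \<le> B"
    using bd by (intro Liminf_le) auto
  finally show ?thesis .
qed

section \<open>Translation invariance and integrals of functions of a difference\<close>

lemma nn_integral_translate:
  fixes h :: "'a::euclidean_space \<Rightarrow> ennreal"
  assumes [measurable]: "h \<in> borel_measurable borel"
  shows "(\<integral>\<^sup>+y. h (y - a) \<partial>lborel) = (\<integral>\<^sup>+y. h y \<partial>lborel)"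
proof -
  have "(\<integral>\<^sup>+y. h y \<partial>lborel) = (\<integral>\<^sup>+y. h y \<partial>distr lborel borel ((+) (-a)))"
    by (simp add: lborel_distr_plus)
  also have "\<dots> = (\<integral>\<^sup>+y. h (y - a) \<partial>lborel)"
    by (subst nn_integral_distr) auto
  finally show ?thesis by simp
qed

text \<open>By Tonelli the variable that \<open>g\<close> does not see is integrated first, and
  translation invariance makes that inner integral constant. Evenness turns \<open>x - y\<close>
  into \<open>y - x\<close> when the inner variable is the second one.\<close>

lemma nn_integral_product_difference:
  fixes g h :: "'a::euclidean_space \<Rightarrow> ennreal"
  assumes [measurable]: "g \<in> borel_measurable borel" "h \<in> borel_measurable borel"
    and even: "\<And>z. h (- z) = h z"
  shows "(\<integral>\<^sup>+z. g (fst z) * h (fst z - snd z) \<partial>(lborel \<Otimes>\<^sub>M lborel)) = (\<integral>\<^sup>+x. g x \<partial>lborel) * (\<integral>\<^sup>+x. h x \<partial>lborel)"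
    and "(\<integral>\<^sup>+z. g (snd z) * h (fst z - snd z) \<partial>(lborel \<Otimes>\<^sub>M lborel)) = (\<integral>\<^sup>+x. g x \<partial>lborel) * (\<integral>\<^sup>+x. h x \<partial>lborel)"
proof -
  have e: "h (x - y) = h (y - x)" for x y
    using even[of "x - y"] by simp
  have "(\<integral>\<^sup>+z. g (fst z) * h (fst z - snd z) \<partial>(lborel \<Otimes>\<^sub>M lborel)) = (\<integral>\<^sup>+x. \<integral>\<^sup>+y. g x * h (y - x) \<partial>lborel \<partial>lborel)"
    by (subst lborel.nn_integral_fst[symmetric]) (auto simp: e)
  also have "\<dots> = (\<integral>\<^sup>+x. g x \<partial>lborel) * (\<integral>\<^sup>+x. h x \<partial>lborel)"
    by (simp add: nn_integral_cmult nn_integral_translate nn_integral_multc)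
  finally show "(\<integral>\<^sup>+z. g (fst z) * h (fst z - snd z) \<partial>(lborel \<Otimes>\<^sub>M lborel)) = (\<integral>\<^sup>+x. g x \<partial>lborel) * (\<integral>\<^sup>+x. h x \<partial>lborel)" .
  have "(\<integral>\<^sup>+z. g (snd z) * h (fst z - snd z) \<partial>(lborel \<Otimes>\<^sub>M lborel)) = (\<integral>\<^sup>+y. \<integral>\<^sup>+x. g y * h (x - y) \<partial>lborel \<partial>lborel)"
    using lborel_pair.nn_integral_snd[of "\<lambda>z. g (snd z) * h (fst z - snd z)"]
    by simp
  also have "\<dots> = (\<integral>\<^sup>+x. g x \<partial>lborel) * (\<integral>\<^sup>+x. h x \<partial>lborel)"
    by (simp add: nn_integral_cmult nn_integral_translate nn_integral_multc)
  finally show "(\<integral>\<^sup>+z. g (snd z) * h (fst z - snd z) \<partial>(lborel \<Otimes>\<^sub>M lborel)) = (\<integral>\<^sup>+x. g x \<partial>lborel) * (\<integral>\<^sup>+x. h x \<partial>lborel)" .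
qed

text \<open>A dyadic decomposition of the space. For |z| \<ge> 1 the minimum is bounded by 1 and m
  is the floor of log2 |z|; for 0 < |z| < 1 it is bounded by |z|^2 and m is the floor of -log2 |z|.
  The disjuncts speak of balls, not annuli, since only upper bounds with known volumes are
  wanted.\<close>

lemma levy_bound_dyadic:
  fixes z :: "'a::euclidean_space"
  assumes "0 < \<alpha>"
  defines "d \<equiv> real DIM('a)"
  obtains m :: nat where
    "norm z \<le> 2 powr (real m + 1) \<and> min 1 ((norm z)\<^sup>2) * riesz_kernel \<alpha> z \<le> 2 powr (- real m * (d + \<alpha>))
     \<or> norm z \<le> 2 powr (- real m) \<and> min 1 ((norm z)\<^sup>2) * riesz_kernel \<alpha> z \<le> 2 powr (- 2 * real m + (real m + 1) * (d + \<alpha>))"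
proof -
  have d: "d > 0" by (simp add: d_def)
  consider "z = 0" | "norm z \<ge> 1" | "0 < norm z" "norm z < 1"
    by fastforce
  then show thesis
  proof cases
    \<comment> \<open>At the origin \<open>powr\<close> has base 0 and returns 0, so the kernel
      vanishes there.\<close>
    case 1 then show ?thesis by (intro that[of 0]) (simp add: riesz_kernel_def)
  next
    case 2
    define m where "m = nat \<lfloor>log 2 (norm z)\<rfloor>"
    have n0: "norm z > 0" using 2 by linarith
    have l: "log 2 (norm z) \<ge> 0" using 2 n0 by (subst zero_le_log_cancel_iff) linarith+
    have m: "real m \<le> log 2 (norm z)" "log 2 (norm z) \<le> real m + 1"
      unfolding m_def using l by linarith+
    have a: "2 powr real m \<le> norm z"
      using m(1) n0 by (subst (asm) le_log_iff) auto
    have b: "norm z \<le> 2 powr (real m + 1)"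
      using m(2) n0 by (subst (asm) log_le_iff) auto
    have "riesz_kernel \<alpha> z \<le> (2 powr real m) powr (- d - \<alpha>)"
      unfolding riesz_kernel_def d_def[symmetric] using a d assms by (intro powr_mono2') auto
    also have "\<dots> = 2 powr (- real m * (d + \<alpha>))"
      unfolding powr_powr by (rule arg_cong[where f="\<lambda>t. 2 powr t"]) (simp add: algebra_simps)
    finally have "riesz_kernel \<alpha> z \<le> 2 powr (- real m * (d + \<alpha>))" .
    moreover have "min 1 ((norm z)\<^sup>2) * riesz_kernel \<alpha> z \<le> 1 * riesz_kernel \<alpha> z"
      by (intro mult_right_mono) auto
    ultimately show ?thesis using b by (intro that[of m]) simp
  next
    case 3
    define m where "m = nat \<lfloor>- log 2 (norm z)\<rfloor>"
    have l: "- log 2 (norm z) \<ge> 0" using 3 by simp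
    have m: "log 2 (norm z) \<le> - real m" "- (real m + 1) \<le> log 2 (norm z)"
      unfolding m_def using l by linarith+
    have a: "2 powr (- (real m + 1)) \<le> norm z"
      using m(2) 3 by (subst (asm) le_log_iff) auto
    have b: "norm z \<le> 2 powr (- real m)"
      using m(1) 3 by (subst (asm) log_le_iff) auto
    have "riesz_kernel \<alpha> z \<le> (2 powr (- (real m + 1))) powr (- d - \<alpha>)"
      unfolding riesz_kernel_def d_def[symmetric] using a d assms by (intro powr_mono2') auto
    also have "\<dots> = 2 powr ((real m + 1) * (d + \<alpha>))"
      unfolding powr_powr by (rule arg_cong[where f="\<lambda>t. 2 powr t"]) (simp add: algebra_simps)
    finally have 1: "riesz_kernel \<alpha> z \<le> 2 powr ((real m + 1) * (d + \<alpha>))" .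
    have "(norm z)\<^sup>2 \<le> (2 powr (- real m))\<^sup>2"
      using b by (intro power_mono) auto
    also have "\<dots> = 2 powr (- 2 * real m)" by (simp add: powr_power algebra_simps)
    finally have "min 1 ((norm z)\<^sup>2) \<le> 2 powr (- 2 * real m)" by simp
    from mult_mono[OF this 1] have "min 1 ((norm z)\<^sup>2) * riesz_kernel \<alpha> z \<le> 2 powr (- 2 * real m + (real m + 1) * (d + \<alpha>))"
      by (subst powr_add) simp
    then show ?thesis using b by (intro that[of m]) simp
  qed
qed

text \<open>Multiplying the dyadic bounds by the volumes of their balls leaves two geometric series,
  with ratios 2^(-\<alpha>) for the part at infinity and 2^(\<alpha> - 2) for the part at the
  origin. The two ends of the range of \<alpha> make these ratios less than 1.\<close>

lemma nn_integral_levy_finite: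
  assumes "0 < \<alpha>" "\<alpha> < 2"
  shows "(\<integral>\<^sup>+z. ennreal (min 1 ((norm (z::'a::euclidean_space))\<^sup>2) * riesz_kernel \<alpha> z) \<partial>lborel) < \<infinity>"
proof -
  define d where "d = real DIM('a)"
  define V where "V = unit_ball_vol d"
  have V: "V \<ge> 0" unfolding V_def by (simp add: d_def)
  define c1 where "c1 m = 2 powr (- real m * (d + \<alpha>))" for m :: nat
  define c2 where "c2 m = 2 powr (- 2 * real m + (real m + 1) * (d + \<alpha>))" for m :: nat
  define u where "u m z = ennreal (c1 m) * indicator (cball 0 (2 powr (real m + 1))) z
     + ennreal (c2 m) * indicator (cball 0 (2 powr (- real m))) z" for m and z :: 'a
  have c: "c1 m \<ge> 0" "c2 m \<ge> 0" for m by (auto simp: c1_def c2_def)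
  have [measurable]: "u m \<in> borel_measurable borel" for m
    unfolding u_def by (intro borel_measurable_add borel_measurable_times_ennreal borel_measurable_indicator) auto
  have "(\<integral>\<^sup>+z. ennreal (min 1 ((norm (z::'a))\<^sup>2) * riesz_kernel \<alpha> z) \<partial>lborel) \<le> (\<integral>\<^sup>+z. (\<Sum>m. u m z) \<partial>lborel)"
  proof (rule nn_integral_mono)
    fix z :: 'a
    obtain m :: nat where m: "norm z \<le> 2 powr (real m + 1) \<and> min 1 ((norm z)\<^sup>2) * riesz_kernel \<alpha> z \<le> c1 m
     \<or> norm z \<le> 2 powr (- real m) \<and> min 1 ((norm z)\<^sup>2) * riesz_kernel \<alpha> z \<le> c2 m"
      using levy_bound_dyadic[OF assms(1), of z] unfolding c1_def c2_def d_def by metis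
    have "ennreal (min 1 ((norm z)\<^sup>2) * riesz_kernel \<alpha> z) \<le> u m z"
      using m
    proof
      assume "norm z \<le> 2 powr (real m + 1) \<and> min 1 ((norm z)\<^sup>2) * riesz_kernel \<alpha> z \<le> c1 m"
      then have "ennreal (min 1 ((norm z)\<^sup>2) * riesz_kernel \<alpha> z) \<le> ennreal (c1 m) * indicator (cball 0 (2 powr (real m + 1))) z"
        by (simp add: ennreal_leI)
      then show ?thesis unfolding u_def by (meson add_increasing2 zero_le)
    next
      assume "norm z \<le> 2 powr (- real m) \<and> min 1 ((norm z)\<^sup>2) * riesz_kernel \<alpha> z \<le> c2 m"
      then have "ennreal (min 1 ((norm z)\<^sup>2) * riesz_kernel \<alpha> z) \<le> ennreal (c2 m) * indicator (cball 0 (2 powr (- real m))) z"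
        by (simp add: ennreal_leI)
      then show ?thesis unfolding u_def by (meson add_increasing zero_le)
    qed
    also have "u m z \<le> (\<Sum>m. u m z)"
      using sum_le_suminf[of "\<lambda>m. u m z" "{m}"] by simp
    finally show "ennreal (min 1 ((norm z)\<^sup>2) * riesz_kernel \<alpha> z) \<le> (\<Sum>m. u m z)" .
  qed
  also have "\<dots> = (\<Sum>m. \<integral>\<^sup>+z. u m z \<partial>lborel)"
    by (rule nn_integral_suminf) simp
  also have "(\<lambda>m. \<integral>\<^sup>+z. u m z \<partial>lborel) = (\<lambda>m. ennreal (V * 2 powr d * (2 powr (- \<alpha>)) ^ m + V * 2 powr (d + \<alpha>) * (2 powr (\<alpha> - 2)) ^ m))"
  proof
    fix m :: nat
    have p: "((2::real) powr t) ^ DIM('a) = 2 powr (t * d)" for t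
      by (simp add: powr_power d_def mult.commute)
    have q: "((2::real) powr t) ^ m = 2 powr (t * real m)" for t
      by (simp add: powr_power mult.commute)
    have "(\<integral>\<^sup>+z. u m z \<partial>lborel) = ennreal (c1 m) * ennreal (V * 2 powr ((real m + 1) * d)) + ennreal (c2 m) * ennreal (V * 2 powr (- real m * d))"
    proof -
      have i: "(\<integral>\<^sup>+z. ennreal c * indicator (cball (0::'a) r) z \<partial>lborel) = ennreal c * ennreal (V * r ^ DIM('a))" if "r \<ge> 0" for c r
        using that by (subst nn_integral_cmult_indicator) (auto simp: emeasure_cball V_def d_def)
      show ?thesis
        unfolding u_def
        by (subst nn_integral_add)
           (auto simp: i p intro!: borel_measurable_times_ennreal borel_measurable_indicator)
    qed
    also have "\<dots> = ennreal (V * (c1 m * 2 powr ((real m + 1) * d)) + V * (c2 m * 2 powr (- real m * d)))"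
      using V c[of m] by (simp add: ennreal_mult[symmetric] ennreal_plus[symmetric] mult_ac del: ennreal_plus)
    also have "c1 m * 2 powr ((real m + 1) * d) = 2 powr d * (2 powr (- \<alpha>)) ^ m"
      unfolding c1_def q powr_add[symmetric] by (simp add: algebra_simps)
    also have "c2 m * 2 powr (- real m * d) = 2 powr (d + \<alpha>) * (2 powr (\<alpha> - 2)) ^ m"
      unfolding c2_def q powr_add[symmetric] by (simp add: algebra_simps)
    finally show "(\<integral>\<^sup>+z. u m z \<partial>lborel) = ennreal (V * 2 powr d * (2 powr (- \<alpha>)) ^ m + V * 2 powr (d + \<alpha>) * (2 powr (\<alpha> - 2)) ^ m)"
      by (simp add: mult_ac)
  qed
  also have "(\<Sum>m. ennreal (V * 2 powr d * (2 powr (- \<alpha>)) ^ m + V * 2 powr (d + \<alpha>) * (2 powr (\<alpha> - 2)) ^ m)) < \<infinity>"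
  proof -
    have "(2::real) powr (- \<alpha>) < 1" "(2::real) powr (\<alpha> - 2) < 1"
      using assms powr_less_cancel_iff[of 2 "-\<alpha>" 0] powr_less_cancel_iff[of 2 "\<alpha> - 2" 0] by auto
    then have "summable (\<lambda>m. V * 2 powr d * (2 powr (- \<alpha>)) ^ m + V * 2 powr (d + \<alpha>) * (2 powr (\<alpha> - 2)) ^ m)"
      by (intro summable_add summable_mult summable_geometric) auto
    then show ?thesis
      using V by (subst suminf_ennreal2) auto
  qed
  finally show ?thesis .
qed


section \<open>Discretisation on cubes\<close>

text \<open>The coordinatewise floor on the grid, that is, the lower corner of the half-open cube
  around \<open>x\<close>. Composing \<open>f\<close> with it gives the function constant on cubes
  that replaces \<open>f\<close>.\<close>

definition corner :: "nat \<Rightarrow> 'a::euclidean_space \<Rightarrow> 'a" where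
  "corner n x = (\<Sum>b\<in>Basis. (real_of_int \<lfloor>real n * (x \<bullet> b)\<rfloor> / real n) *\<^sub>R b)"

lemma corner_inner: "b \<in> Basis \<Longrightarrow> corner n x \<bullet> b = real_of_int \<lfloor>real n * (x \<bullet> b)\<rfloor> / real n"
  by (simp add: corner_def inner_sum_left inner_Basis if_distrib cong: if_cong)

lemma corner_in_grid: "corner n x \<in> grid n"
  by (auto simp: grid_def corner_inner)

lemma mem_cube_corner: "n \<ge> 1 \<Longrightarrow> x \<in> cube n (corner n x)"
  unfolding cube_def
proof (safe, goal_cases)
  case (1 b)
  then show ?case by (simp add: corner_inner divide_le_eq mult.commute)
next
  case (2 b)
  have "real n * (x \<bullet> b) < real_of_int \<lfloor>real n * (x \<bullet> b)\<rfloor> + 1" by linarith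
  then show ?case using 2 by (simp add: corner_inner field_simps)
qed

lemma corner_unique:
  assumes "n \<ge> 1" "c \<in> grid n" "x \<in> cube n c"
  shows "corner n x = c"
proof (rule euclidean_eqI)
  fix b :: 'a assume b: "b \<in> Basis"
  obtain z :: int where z: "c \<bullet> b = real_of_int z / real n"
    using assms b by (auto simp: grid_def)
  have "c \<bullet> b \<le> x \<bullet> b" "x \<bullet> b < c \<bullet> b + 1 / real n"
    using assms b by (auto simp: cube_def)
  then have "\<lfloor>real n * (x \<bullet> b)\<rfloor> = z"
    using assms(1) by (intro floor_unique) (auto simp: z field_simps)
  then show "corner n x \<bullet> b = c \<bullet> b" by (simp add: corner_inner b z)
qed

lemma cube_eq_cube_corner:
  assumes "n \<ge> 1" "C \<in> cubes n" "x \<in> C"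
  shows "C = cube n (corner n x)"
  using assms corner_unique unfolding cubes_def by auto

lemma cube_corner_in_cubes: "cube n (corner n x) \<in> cubes n"
  by (simp add: cubes_def corner_in_grid)

lemma measurable_corner [measurable]: "corner n \<in> borel_measurable borel"
  unfolding corner_def by measurable

text \<open>Countability permits the exchange of integrals over the space with sums over cubes or
  over pairs of cubes.\<close>

lemma countable_cubes: "countable (cubes n :: 'a::euclidean_space set set)"
proof -
  have "(grid n :: 'a set) \<subseteq> (\<lambda>g. \<Sum>b\<in>Basis. (real_of_int (g b) / real n) *\<^sub>R b) ` (Basis \<rightarrow>\<^sub>E (UNIV :: int set))"
  proof
    fix x :: 'a assume "x \<in> grid n"
    then obtain g where g: "\<And>b. b \<in> Basis \<Longrightarrow> x \<bullet> b = real_of_int (g b) / real n"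
      unfolding grid_def by (auto simp: Bex_def) metis
    have "x = (\<Sum>b\<in>Basis. (real_of_int (restrict g Basis b) / real n) *\<^sub>R b)"
      by (simp add: g[symmetric] euclidean_representation cong: sum.cong)
    then show "x \<in> (\<lambda>g. \<Sum>b\<in>Basis. (real_of_int (g b) / real n) *\<^sub>R b) ` (Basis \<rightarrow>\<^sub>E (UNIV :: int set))"
      by (intro image_eqI[where x="restrict g Basis"]) auto
  qed
  moreover have "countable ((Basis :: 'a set) \<rightarrow>\<^sub>E (UNIV :: int set))"
    by (intro countable_PiE) auto
  ultimately have "countable (grid n :: 'a set)"
    by (meson countable_image countable_subset)
  then show ?thesis unfolding cubes_def by simp
qed

lemma cube_borel: "cube n c \<in> sets borel"
proof -
  have "cube n c = (\<Inter>b\<in>Basis. {y. c \<bullet> b \<le> y \<bullet> b} \<inter> {y. y \<bullet> b < c \<bullet> b + 1 / real n})"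
    by (auto simp: cube_def)
  also have "\<dots> \<in> sets borel"
    by (intro sets.countable_INT'' sets.Int borel_closed borel_open sets.finite_INT closed_Collect_le open_Collect_less continuous_intros) auto
  finally show ?thesis .
qed

lemma cubes_borel: "C \<in> cubes n \<Longrightarrow> C \<in> sets borel"
  by (auto simp: cubes_def cube_borel)

lemma norm_corner_diff: "n \<ge> 1 \<Longrightarrow> norm (x - corner n (x::'a::euclidean_space)) \<le> real DIM('a) / real n"
proof -
  assume n: "n \<ge> 1"
  have "norm (x - corner n x) \<le> (\<Sum>b\<in>Basis. \<bar>(x - corner n x) \<bullet> b\<bar>)"
    by (rule norm_le_l1)
  also have "\<dots> \<le> (\<Sum>b\<in>(Basis::'a set). 1 / real n)"
  proof (rule sum_mono)
    fix b :: 'a assume "b \<in> Basis"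
    then show "\<bar>(x - corner n x) \<bullet> b\<bar> \<le> 1 / real n"
      using mem_cube_corner[OF n, of x] unfolding cube_def by (auto simp: inner_diff_left abs_if)
  qed
  finally show ?thesis by simp
qed

lemma corner_tendsto: "(\<lambda>n. corner n x) \<longlonglongrightarrow> (x::'a::euclidean_space)"
proof -
  have "(\<lambda>n. corner n x - x) \<longlonglongrightarrow> 0"
  proof (rule Lim_null_comparison)
    show "\<forall>\<^sub>F n in sequentially. norm (corner n x - x) \<le> real DIM('a) / real n"
      using norm_corner_diff[of _ x] by (auto simp: eventually_sequentially norm_minus_commute intro!: exI[of _ 1])
  qed (rule lim_const_over_n)
  then show ?thesis by (simp add: LIM_zero_cancel)
qed

text \<open>Products of two cubes partition the product space and the increment is constant on each
  of them. The sum over pairs is an integral against counting measure, so infinite values of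
  \<open>dint\<close> cause no difficulty. \<open>G\<close> reads off the value on a cube that is
  given as a set, without its corner.\<close>

lemma nn_integral_cubes_decomposition:
  fixes f :: "'a::euclidean_space \<Rightarrow> real" and h :: "'a \<Rightarrow> 'a \<Rightarrow> real"
  assumes n: "n \<ge> 1" and [measurable]: "f \<in> borel_measurable borel"
    and h [measurable]: "(\<lambda>z. h (fst z) (snd z)) \<in> borel_measurable (lborel \<Otimes>\<^sub>M lborel)"
    and nonneg: "\<And>x y. 0 \<le> h x y"
  defines "G \<equiv> \<lambda>C. f (corner n (SOME x. x \<in> C))"
  shows "(\<integral>\<^sup>+z. ennreal ((f (corner n (snd z)) - f (corner n (fst z)))\<^sup>2 * h (fst z) (snd z)) \<partial>(lborel \<Otimes>\<^sub>M lborel))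
     = (\<integral>\<^sup>+p. ennreal ((G (snd p) - G (fst p))\<^sup>2) * dint (fst p) (snd p) h \<partial>count_space (cubes n \<times> cubes n))"
proof -
  define I :: "('a set \<times> 'a set) set" where "I = cubes n \<times> cubes n"
  define v where "v z = ennreal ((f (corner n (snd z)) - f (corner n (fst z)))\<^sup>2 * h (fst z) (snd z))" for z
  \<comment> \<open>All points of a cube have the same corner, so the value does not depend on the
    point picked by \<open>SOME\<close>.\<close>
  have G: "f (corner n x) = G C" if "x \<in> C" "C \<in> cubes n" for x C
  proof -
    have "(SOME x. x \<in> C) \<in> C" using that(1) by (rule someI)
    then have "C = cube n (corner n (SOME x. x \<in> C))" "C = cube n (corner n x)"
      using cube_eq_cube_corner[OF n] that by blast+
    then have "x \<in> cube n (corner n (SOME x. x \<in> C))" using that by blast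
    from corner_unique[OF n corner_in_grid this] show ?thesis by (simp add: G_def)
  qed
  have [measurable]: "v \<in> borel_measurable (lborel \<Otimes>\<^sub>M lborel)"
    unfolding v_def by measurable
  have rect: "fst p \<times> snd p \<in> sets (lborel \<Otimes>\<^sub>M lborel)" if "p \<in> I" for p
    using that cubes_borel[of "fst p" n] cubes_borel[of "snd p" n] by (intro pair_measureI) (auto simp: I_def)
  \<comment> \<open>Exactly one pair of cubes contains \<open>z\<close>, so the counting integral
    has a single term.\<close>
  have point: "v z = (\<integral>\<^sup>+p. indicator (fst p \<times> snd p) z * v z \<partial>count_space I)" for z
  proof -
    define p0 where "p0 = (cube n (corner n (fst z)), cube n (corner n (snd z)))"
    have p0: "p0 \<in> I" by (simp add: p0_def I_def cube_corner_in_cubes)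
    have z: "z \<in> fst p \<times> snd p \<longleftrightarrow> p = p0" if "p \<in> I" for p
      using that n cube_eq_cube_corner[OF n, of "fst p" "fst z"] cube_eq_cube_corner[OF n, of "snd p" "snd z"]
      by (auto simp: p0_def I_def mem_Times_iff mem_cube_corner prod_eq_iff)
    have "(\<integral>\<^sup>+p. indicator (fst p \<times> snd p) z * v z \<partial>count_space I) = (\<integral>\<^sup>+p. indicator {p0} p * v z \<partial>count_space I)"
      using z by (intro nn_integral_cong) (auto simp: indicator_def)
    also have "\<dots> = v z"
      using p0 by (simp add: nn_integral_multc)
    finally show ?thesis ..
  qed
  have "(\<integral>\<^sup>+z. v z \<partial>(lborel \<Otimes>\<^sub>M lborel)) = (\<integral>\<^sup>+z. \<integral>\<^sup>+p. indicator (fst p \<times> snd p) z * v z \<partial>count_space I \<partial>(lborel \<Otimes>\<^sub>M lborel))"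
    by (subst point) simp
  also have "\<dots> = (\<integral>\<^sup>+p. \<integral>\<^sup>+z. indicator (fst p \<times> snd p) z * v z \<partial>(lborel \<Otimes>\<^sub>M lborel) \<partial>count_space I)"
    using rect by (intro nn_integral_count_space_nn_integral borel_measurable_times_ennreal borel_measurable_indicator)
      (auto simp: I_def countable_cubes)
  also have "\<dots> = (\<integral>\<^sup>+p. ennreal ((G (snd p) - G (fst p))\<^sup>2) * dint (fst p) (snd p) h \<partial>count_space I)"
  proof (rule nn_integral_cong)
    fix p assume "p \<in> space (count_space I)"
    then have p: "p \<in> I" by simp
    have "(\<integral>\<^sup>+z. indicator (fst p \<times> snd p) z * v z \<partial>(lborel \<Otimes>\<^sub>M lborel))
       = (\<integral>\<^sup>+z. ennreal ((G (snd p) - G (fst p))\<^sup>2) * (indicator (fst p \<times> snd p) z * ennreal (h (fst z) (snd z))) \<partial>(lborel \<Otimes>\<^sub>M lborel))"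
      using p G by (intro nn_integral_cong) (auto simp: v_def indicator_def I_def ennreal_mult nonneg)
    also have "\<dots> = ennreal ((G (snd p) - G (fst p))\<^sup>2) * dint (fst p) (snd p) h"
      unfolding dint_def using rect[OF p]
      by (intro nn_integral_cmult borel_measurable_times_ennreal borel_measurable_indicator) auto
    finally show "(\<integral>\<^sup>+z. indicator (fst p \<times> snd p) z * v z \<partial>(lborel \<Otimes>\<^sub>M lborel)) = ennreal ((G (snd p) - G (fst p))\<^sup>2) * dint (fst p) (snd p) h" .
  qed
  finally show ?thesis by (simp add: v_def I_def)
qed

section \<open>Summation along paths of cubes\<close>

lemma nn_integral_count_space_singleton:
  "q \<in> I \<Longrightarrow> (\<integral>\<^sup>+p. b p * indicator {q} p \<partial>count_space I) = b q" for b :: "'b \<Rightarrow> ennreal"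
  by simp

text \<open>Double counting. Each term is written as a counting integral over the edges
  \<open>q\<close>, and the two counting integrals are exchanged; what remains at \<open>q\<close>
  is the number of incidences (p, j). The paths of (B) may repeat an edge, so the incidences on one
  path are bounded crudely by its length.\<close>

lemma sum_over_paths_le:
  fixes b :: "'b \<Rightarrow> ennreal" and e :: "'c \<Rightarrow> nat \<Rightarrow> 'b"
  assumes "countable I" "countable J"
    and e: "\<And>p j. p \<in> I \<Longrightarrow> j < len p \<Longrightarrow> e p j \<in> J"
    and len: "\<And>p. p \<in> I \<Longrightarrow> len p \<le> M0"
    and mult: "\<And>q. q \<in> J \<Longrightarrow> finite {p\<in>I. \<exists>j<len p. e p j = q} \<and> card {p\<in>I. \<exists>j<len p. e p j = q} \<le> M0"
  shows "(\<integral>\<^sup>+p. (\<Sum>j<len p. b (e p j)) \<partial>count_space I) \<le> of_nat (M0 * M0) * (\<integral>\<^sup>+q. b q \<partial>count_space J)"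
proof -
  define E where "E q = {p\<in>I. \<exists>j<len p. e p j = q}" for q
  have "(\<integral>\<^sup>+p. (\<Sum>j<len p. b (e p j)) \<partial>count_space I) \<le> (\<integral>\<^sup>+p. \<integral>\<^sup>+q. b q * of_nat M0 * indicator (E q) p \<partial>count_space J \<partial>count_space I)"
  proof (rule nn_integral_mono)
    fix p assume "p \<in> space (count_space I)"
    then have p: "p \<in> I" by simp
    have "(\<Sum>j<len p. b (e p j)) = (\<Sum>j<len p. \<integral>\<^sup>+q. b q * indicator {e p j} q \<partial>count_space J)"
      using e[OF p] by (intro sum.cong refl) (subst nn_integral_count_space_singleton, auto)
    also have "\<dots> = (\<integral>\<^sup>+q. (\<Sum>j<len p. b q * indicator {e p j} q) \<partial>count_space J)"
      by (subst nn_integral_sum) auto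
    also have "\<dots> \<le> (\<integral>\<^sup>+q. b q * of_nat M0 * indicator (E q) p \<partial>count_space J)"
    proof (rule nn_integral_mono)
      fix q assume "q \<in> space (count_space J)"
      show "(\<Sum>j<len p. b q * indicator {e p j} q) \<le> b q * of_nat M0 * indicator (E q) p"
      proof (cases "p \<in> E q")
        case True
        have "(\<Sum>j<len p. b q * indicator {e p j} q) \<le> (\<Sum>j<len p. b q)"
          by (intro sum_mono) (auto simp: indicator_def)
        also have "\<dots> = b q * of_nat (len p)" by (simp add: mult.commute)
        also have "\<dots> \<le> b q * of_nat M0"
          using len[OF p] by (intro mult_left_mono) auto
        finally show ?thesis using True by simp
      next
        case False
        then have "(\<Sum>j<len p. b q * indicator {e p j} q) = 0"
          using p by (intro sum.neutral) (auto simp: E_def indicator_def)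
        then show ?thesis by simp
      qed
    qed
    finally show "(\<Sum>j<len p. b (e p j)) \<le> (\<integral>\<^sup>+q. b q * of_nat M0 * indicator (E q) p \<partial>count_space J)" .
  qed
  also have "\<dots> = (\<integral>\<^sup>+q. \<integral>\<^sup>+p. b q * of_nat M0 * indicator (E q) p \<partial>count_space I \<partial>count_space J)"
    by (rule nn_integral_count_space_nn_integral) (use assms in auto)
  also have "\<dots> \<le> (\<integral>\<^sup>+q. of_nat (M0 * M0) * b q \<partial>count_space J)"
  proof (rule nn_integral_mono)
    fix q assume "q \<in> space (count_space J)"
    then have q: "q \<in> J" by simp
    have Eq: "finite (E q)" "card (E q) \<le> M0" "E q \<subseteq> I" using mult[OF q] by (auto simp: E_def)
    have "(\<integral>\<^sup>+p. b q * of_nat M0 * indicator (E q) p \<partial>count_space I) = b q * of_nat M0 * of_nat (card (E q))"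
      using Eq by (subst nn_integral_cmult_indicator) auto
    also have "\<dots> \<le> b q * of_nat M0 * of_nat M0"
      using Eq(2) by (intro mult_left_mono) auto
    finally show "(\<integral>\<^sup>+p. b q * of_nat M0 * indicator (E q) p \<partial>count_space I) \<le> of_nat (M0 * M0) * b q"
      by (simp add: mult_ac)
  qed
  also have "\<dots> = of_nat (M0 * M0) * (\<integral>\<^sup>+q. b q \<partial>count_space J)"
    by (rule nn_integral_cmult) simp
  finally show ?thesis .
qed

text \<open>After Cauchy-Schwarz every squared increment along the path still carries the
  \<open>h2\<close>-weight of the pair of endpoints. (B) exchanges this weight, one edge at a time,
  for the \<open>h1\<close>-weight of the edge, and then the edges can be counted.\<close>

lemma discrete_energy_comparison:
  fixes f :: "'a::euclidean_space \<Rightarrow> real" and h1 h2 :: "'a \<Rightarrow> 'a \<Rightarrow> real"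
    and path :: "'a set \<times> 'a set \<Rightarrow> nat \<Rightarrow> 'a set"
  assumes n: "n \<ge> 1" and f: "f \<in> borel_measurable borel"
    and h1: "(\<lambda>z. h1 (fst z) (snd z)) \<in> borel_measurable (lborel \<Otimes>\<^sub>M lborel)" "\<And>x y. 0 \<le> h1 x y"
    and h2: "(\<lambda>z. h2 (fst z) (snd z)) \<in> borel_measurable (lborel \<Otimes>\<^sub>M lborel)" "\<And>x y. 0 \<le> h2 x y"
    and path: "\<And>p. p \<in> cubes n \<times> cubes n \<Longrightarrow> len p \<le> M0 \<and> path p 0 = fst p \<and> path p (len p) = snd p
            \<and> (\<forall>j\<le>len p. path p j \<in> cubes n)
            \<and> (\<forall>j<len p. ennreal \<Lambda>2 * dint (fst p) (snd p) h2 \<le> dint (path p j) (path p (Suc j)) h1)"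
    and mult: "\<And>q. q \<in> cubes n \<times> cubes n \<Longrightarrow>
        finite {p \<in> cubes n \<times> cubes n. \<exists>j<len p. (path p j, path p (Suc j)) = q} \<and>
        card {p \<in> cubes n \<times> cubes n. \<exists>j<len p. (path p j, path p (Suc j)) = q} \<le> M0"
  shows "ennreal \<Lambda>2 * (\<integral>\<^sup>+z. ennreal ((f (corner n (snd z)) - f (corner n (fst z)))\<^sup>2 * h2 (fst z) (snd z)) \<partial>(lborel \<Otimes>\<^sub>M lborel))
     \<le> of_nat (M0 ^ 3) * (\<integral>\<^sup>+z. ennreal ((f (corner n (snd z)) - f (corner n (fst z)))\<^sup>2 * h1 (fst z) (snd z)) \<partial>(lborel \<Otimes>\<^sub>M lborel))"
proof -
  define I :: "('a set \<times> 'a set) set" where "I = cubes n \<times> cubes n"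
  define G where "G C = f (corner n (SOME x. x \<in> C))" for C
  define D where "D p = ennreal ((G (snd p) - G (fst p))\<^sup>2)" for p
  define b where "b q = D q * dint (fst q) (snd q) h1" for q
  define e where "e p j = (path p j, path p (Suc j))" for p j
  have c: "countable I" by (simp add: I_def countable_cubes)
  have "ennreal \<Lambda>2 * (\<integral>\<^sup>+p. D p * dint (fst p) (snd p) h2 \<partial>count_space I)
     = (\<integral>\<^sup>+p. ennreal \<Lambda>2 * (D p * dint (fst p) (snd p) h2) \<partial>count_space I)"
    by (rule nn_integral_cmult[symmetric]) simp
  also have "\<dots> \<le> (\<integral>\<^sup>+p. of_nat M0 * (\<Sum>j<len p. b (e p j)) \<partial>count_space I)"
  proof (rule nn_integral_mono)
    fix p assume "p \<in> space (count_space I)"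
    then have p: "len p \<le> M0" "path p 0 = fst p" "path p (len p) = snd p"
      "\<And>j. j < len p \<Longrightarrow> ennreal \<Lambda>2 * dint (fst p) (snd p) h2 \<le> dint (path p j) (path p (Suc j)) h1"
      using path[of p] by (auto simp: I_def)
    \<comment> \<open>If \<open>len p = 0\<close>, the endpoints coincide and the empty sum gives
      the correct value 0.\<close>
    have "(G (snd p) - G (fst p))\<^sup>2 = (\<Sum>j<len p. G (path p (Suc j)) - G (path p j))\<^sup>2"
      using sum_lessThan_telescope[of "\<lambda>j. G (path p j)" "len p"] by (simp add: p)
    also have "\<dots> \<le> (\<Sum>j<len p. (G (path p (Suc j)) - G (path p j))\<^sup>2) * real (card {..<len p})"
      by (rule sum_squared_le_sum_of_squares)
    also have "\<dots> \<le> (\<Sum>j<len p. (G (path p (Suc j)) - G (path p j))\<^sup>2) * real M0"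
      using p(1) by (intro mult_left_mono sum_nonneg) auto
    finally have "D p \<le> ennreal ((\<Sum>j<len p. (G (path p (Suc j)) - G (path p j))\<^sup>2) * real M0)"
      unfolding D_def by (rule ennreal_leI)
    also have "\<dots> = of_nat M0 * (\<Sum>j<len p. D (e p j))"
      by (simp add: D_def e_def ennreal_mult' sum_nonneg mult.commute ennreal_of_nat_eq_real_of_nat)
    finally have "ennreal \<Lambda>2 * (D p * dint (fst p) (snd p) h2) \<le> of_nat M0 * (\<Sum>j<len p. D (e p j)) * (ennreal \<Lambda>2 * dint (fst p) (snd p) h2)"
      by (subst mult.left_commute) (rule mult_right_mono, auto)
    also have "\<dots> = of_nat M0 * (\<Sum>j<len p. D (e p j) * (ennreal \<Lambda>2 * dint (fst p) (snd p) h2))"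
      by (simp add: sum_distrib_right mult.assoc)
    also have "\<dots> \<le> of_nat M0 * (\<Sum>j<len p. b (e p j))"
      using p(4) by (intro mult_left_mono sum_mono) (auto simp: b_def e_def intro!: mult_left_mono)
    finally show "ennreal \<Lambda>2 * (D p * dint (fst p) (snd p) h2) \<le> of_nat M0 * (\<Sum>j<len p. b (e p j))" .
  qed
  also have "\<dots> = of_nat M0 * (\<integral>\<^sup>+p. (\<Sum>j<len p. b (e p j)) \<partial>count_space I)"
    by (rule nn_integral_cmult) simp
  also have "\<dots> \<le> of_nat M0 * (of_nat (M0 * M0) * (\<integral>\<^sup>+q. b q \<partial>count_space I))"
    using path mult by (intro mult_left_mono sum_over_paths_le c) (auto simp: I_def e_def)
  also have "\<dots> = of_nat (M0 ^ 3) * (\<integral>\<^sup>+q. b q \<partial>count_space I)"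
    by (simp add: power3_eq_cube mult_ac)
  finally show ?thesis
    unfolding nn_integral_cubes_decomposition[OF n f h1] nn_integral_cubes_decomposition[OF n f h2]
      D_def b_def G_def I_def .
qed


section \<open>Passage to the continuum\<close>

text \<open>Extracts the quantitative data behind the energy estimates. The derivative is bounded on
  a ball by compactness and vanishes outside it, so the mean value inequality on the whole space
  gives one global Lipschitz constant.\<close>

lemma C1c_E:
  fixes f :: "'a::euclidean_space \<Rightarrow> real"
  assumes "C1c f"
  obtains M R L where "\<And>x. \<bar>f x\<bar> \<le> M" "R > 0" "\<And>x. norm x > R \<Longrightarrow> f x = 0"
    "\<And>x y. \<bar>f x - f y\<bar> \<le> L * norm (x - y)" "M \<ge> 0" "L \<ge> 0"
proof -
  from assms obtain f' :: "'a \<Rightarrow> ('a \<Rightarrow>\<^sub>L real)" where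
    f': "\<And>x. (f has_derivative blinfun_apply (f' x)) (at x)" "continuous_on UNIV f'"
    and K: "compact (closure {x. f x \<noteq> 0})"
    unfolding C1c_def by blast
  have cont: "continuous_on UNIV f"
    using f'(1) by (meson continuous_at_imp_continuous_on has_derivative_continuous)
  obtain R where R: "R > 0" "\<And>x. x \<in> closure {x. f x \<noteq> 0} \<Longrightarrow> norm x \<le> R"
    using compact_imp_bounded[OF K] bounded_pos by blast
  have zero: "f x = 0" if "norm x > R" for x
    using R(2)[of x] closure_subset[of "{x. f x \<noteq> 0}"] that by force
  \<comment> \<open>Near such a point \<open>f\<close> is identically 0 on an open set, and
    derivatives are unique.\<close>
  have zero': "f' x = 0" if "norm x > R" for x
  proof -
    have "open {x::'a. norm x > R}" by (intro open_Collect_less continuous_intros)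
    then have "(f has_derivative (\<lambda>_. 0)) (at x)"
      using that zero by (intro has_derivative_transform_within_open[OF has_derivative_const[of 0]]) auto
    from has_derivative_unique[OF this f'(1)] show ?thesis
      by (intro blinfun_eqI) (simp add: fun_eq_iff)
  qed
  have "bounded (f ` cball 0 R)" "bounded (f' ` cball 0 R)"
    by (intro compact_imp_bounded compact_continuous_image continuous_on_subset[OF cont] continuous_on_subset[OF f'(2)], auto)+
  then obtain M L where M: "M > 0" "\<And>x. x \<in> cball 0 R \<Longrightarrow> norm (f x) \<le> M"
    and L: "L > 0" "\<And>x. x \<in> cball 0 R \<Longrightarrow> norm (f' x) \<le> L"
    unfolding bounded_pos by blast
  have M': "\<bar>f x\<bar> \<le> M" for x using M(2)[of x] M(1) zero[of x] by (cases "norm x \<le> R") auto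
  have L': "norm (f' x) \<le> L" for x using L(2)[of x] L(1) zero'[of x] by (cases "norm x \<le> R") auto
  have "norm (f x - f y) \<le> L * norm (x - y)" for x y
    using L' f'(1) by (intro differentiable_bound[where S=UNIV and f' = "\<lambda>x. blinfun_apply (f' x)"])
      (auto simp: norm_blinfun.rep_eq[symmetric])
  with M' M(1) L(1) R(1) zero that[of M R L] show thesis by (simp add: less_imp_le)
qed

lemma C1c_continuous: "C1c f \<Longrightarrow> continuous_on UNIV f"
  unfolding C1c_def by (meson continuous_at_imp_continuous_on has_derivative_continuous)

lemma C1c_measurable: "C1c f \<Longrightarrow> f \<in> borel_measurable borel"
  by (intro borel_measurable_continuous_onI C1c_continuous)

text \<open>Coercivity will be applied to the difference of two approximants.\<close>

lemma C1c_diff: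
  assumes "C1c f" "C1c g" shows "C1c (\<lambda>x. f x - g x)"
proof -
  from assms(1) obtain f' where f': "\<And>x. (f has_derivative blinfun_apply (f' x)) (at x)" "continuous_on UNIV f'" "compact (closure {x. f x \<noteq> 0})"
    unfolding C1c_def by blast
  from assms(2) obtain g' where g': "\<And>x. (g has_derivative blinfun_apply (g' x)) (at x)" "continuous_on UNIV g'" "compact (closure {x. g x \<noteq> 0})"
    unfolding C1c_def by blast
  have "closure {x. f x - g x \<noteq> 0} \<subseteq> closure {x. f x \<noteq> 0} \<union> closure {x. g x \<noteq> 0}"
    unfolding closure_Un[symmetric] by (rule closure_mono) auto
  then have "compact (closure {x. f x - g x \<noteq> 0})"
    using f'(3) g'(3) compact_Int_closed[of "closure {x. f x \<noteq> 0} \<union> closure {x. g x \<noteq> 0}" "closure {x. f x - g x \<noteq> 0}"]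
    by (simp add: compact_Un inf.absorb2)
  then show ?thesis
    unfolding C1c_def using f' g'
    by (intro conjI exI[of _ "\<lambda>x. f' x - g' x"]) (auto intro!: derivative_eq_intros continuous_intros simp: minus_blinfun.rep_eq)
qed

text \<open>This integrable kernel dominates every truncated kernel, and also the energy densities of bounded Lipschitz functions.\<close>

definition levy_kernel :: "real \<Rightarrow> 'a::euclidean_space \<Rightarrow> real" where
  "levy_kernel \<alpha> z = min 1 ((norm z)\<^sup>2) * riesz_kernel \<alpha> z"

lemma levy_kernel_nonneg [simp]: "0 \<le> levy_kernel \<alpha> z"
  by (simp add: levy_kernel_def)

lemma levy_kernel_minus [simp]: "levy_kernel \<alpha> (- z) = levy_kernel \<alpha> z"
  by (simp add: levy_kernel_def riesz_kernel_def)

lemma measurable_levy_kernel [measurable]: "levy_kernel \<alpha> \<in> borel_measurable borel"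
  unfolding levy_kernel_def by measurable

text \<open>The common shape of the majorants below. The energy density of a pair of points is
  controlled as soon as one of the two points carries weight, which the sum of the two values of
  \<open>g\<close> expresses; \<open>g\<close> will be a multiple of the indicator of a ball or of a
  square-integrable \<open>f\<close> squared.\<close>

lemma nn_integral_levy_localised_finite:
  fixes g :: "'a::euclidean_space \<Rightarrow> ennreal"
  assumes "0 < \<alpha>" "\<alpha> < 2" and [measurable]: "g \<in> borel_measurable borel"
    and "(\<integral>\<^sup>+x. g x \<partial>lborel) < \<infinity>"
  shows "(\<integral>\<^sup>+z. (g (fst z) + g (snd z)) * ennreal (levy_kernel \<alpha> (fst z - snd z)) \<partial>(lborel \<Otimes>\<^sub>M lborel)) < \<infinity>"
proof -
  have fin: "(\<integral>\<^sup>+x. ennreal (levy_kernel \<alpha> (x::'a)) \<partial>lborel) < \<infinity>"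
    unfolding levy_kernel_def by (rule nn_integral_levy_finite[OF assms(1,2)])
  show ?thesis
    unfolding distrib_right
    by (subst nn_integral_add)
       (use fin assms(4) in \<open>auto simp: nn_integral_product_difference[of g "\<lambda>z. ennreal (levy_kernel \<alpha> z)"] ennreal_mult_less_top\<close>)
qed

lemma square_diff_bounds:
  fixes a b :: real
  shows "(a - b)\<^sup>2 \<le> 2 * a\<^sup>2 + 2 * b\<^sup>2" "(a + b)\<^sup>2 \<le> 2 * a\<^sup>2 + 2 * b\<^sup>2"
  using zero_le_power2[of "a + b"] zero_le_power2[of "a - b"] by (auto simp: power2_sum power2_diff)

lemma Ealpha_eq: "Ealpha \<alpha> f = (\<integral>\<^sup>+z. ennreal ((f (snd z) - f (fst z))\<^sup>2 * riesz_kernel \<alpha> (fst z - snd z)) \<partial>(lborel \<Otimes>\<^sub>M lborel))"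
  by (simp add: Ealpha_def riesz_kernel_def)

lemma nn_integral_indicator_cball_finite:
  "(\<integral>\<^sup>+x. ennreal c * indicator (cball (0::'a::euclidean_space) r) x \<partial>lborel) < \<infinity>"
  using emeasure_lborel_cball_finite[of "0::'a" r] by (subst nn_integral_cmult_indicator) (auto simp: ennreal_mult_less_top)

text \<open>The squared increment is at most a constant times min(1, |x - y|^2): boundedness handles
  distant points and the Lipschitz condition cancels the singularity at near ones.\<close>

lemma Ealpha_C1c_finite:
  fixes f :: "'a::euclidean_space \<Rightarrow> real"
  assumes "0 < \<alpha>" "\<alpha> < 2" "C1c f"
  shows "Ealpha \<alpha> f < \<infinity>"
proof -
  obtain M R L where f: "\<And>x. \<bar>f x\<bar> \<le> M" "\<And>x. norm x > R \<Longrightarrow> f x = 0"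
    "\<And>x y. \<bar>f x - f y\<bar> \<le> L * norm (x - y)" "M \<ge> 0" "L \<ge> 0"
    using assms(3) by (rule C1c_E) blast
  \<comment> \<open>The first summand comes from the bound \<open>2 * M\<close> on increments, the
    second from the Lipschitz constant; their sum dominates both.\<close>
  define C where "C = 4 * M\<^sup>2 + L\<^sup>2"
  define g where "g x = ennreal C * indicator (cball (0::'a) R) x" for x
  have "Ealpha \<alpha> f \<le> (\<integral>\<^sup>+z. (g (fst z) + g (snd z)) * ennreal (levy_kernel \<alpha> (fst z - snd z)) \<partial>(lborel \<Otimes>\<^sub>M lborel))"
    unfolding Ealpha_eq
  proof (rule nn_integral_mono)
    fix z :: "'a \<times> 'a"
    obtain x y where z: "z = (x, y)" by (cases z)
    have "(f y - f x)\<^sup>2 \<le> C * min 1 ((norm (x - y))\<^sup>2)"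
    proof -
      have "\<bar>f y - f x\<bar> \<le> 2 * M" using f(1)[of x] f(1)[of y] by linarith
      from power_mono[OF this, of 2] have a: "(f y - f x)\<^sup>2 \<le> 4 * M\<^sup>2" by (simp add: power_mult_distrib)
      have "\<bar>f y - f x\<bar> \<le> L * norm (x - y)" using f(3)[of y x] by (simp add: norm_minus_commute)
      from power_mono[OF this, of 2] have b: "(f y - f x)\<^sup>2 \<le> L\<^sup>2 * (norm (x - y))\<^sup>2" by (simp add: power_mult_distrib)
      show ?thesis
      proof (cases "(norm (x - y))\<^sup>2 \<le> 1")
        case True
        have "L\<^sup>2 * (norm (x - y))\<^sup>2 \<le> C * (norm (x - y))\<^sup>2" by (intro mult_right_mono) (auto simp: C_def)
        then show ?thesis using b True by (simp add: min_def)
      next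
        case False
        have "4 * M\<^sup>2 \<le> C" by (simp add: C_def)
        then show ?thesis using a False by (simp add: min_def)
      qed
    qed
    from mult_right_mono[OF this riesz_kernel_nonneg[of \<alpha> "x - y"]]
    have *: "(f y - f x)\<^sup>2 * riesz_kernel \<alpha> (x - y) \<le> C * levy_kernel \<alpha> (x - y)"
      by (simp add: levy_kernel_def mult.assoc)
    show "ennreal ((f (snd z) - f (fst z))\<^sup>2 * riesz_kernel \<alpha> (fst z - snd z)) \<le> (g (fst z) + g (snd z)) * ennreal (levy_kernel \<alpha> (fst z - snd z))"
    proof (cases "norm x > R \<and> norm y > R")
      case True then show ?thesis using f(2) by (simp add: z)
    next
      case False
      \<comment> \<open>At least one of the two points lies in the ball, and there \<open>g\<close>
        equals \<open>C\<close>.\<close>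
      then have "ennreal C \<le> g x + g y"
        unfolding g_def by (auto simp: indicator_def intro: order_trans[OF _ add_increasing])
      from mult_right_mono[OF this, of "ennreal (levy_kernel \<alpha> (x - y))"]
      have "ennreal (C * levy_kernel \<alpha> (x - y)) \<le> (g x + g y) * ennreal (levy_kernel \<alpha> (x - y))"
        by (simp add: C_def ennreal_mult)
      then show ?thesis using ennreal_leI[OF *] by (simp add: z)
    qed
  qed
  also have "\<dots> < \<infinity>"
  proof (rule nn_integral_levy_localised_finite[OF assms(1,2)])
    show "g \<in> borel_measurable borel"
      unfolding g_def by (intro borel_measurable_times_ennreal borel_measurable_indicator) auto
    show "(\<integral>\<^sup>+x. g x \<partial>lborel) < \<infinity>"
      unfolding g_def by (rule nn_integral_indicator_cball_finite)
  qed
  finally show ?thesis .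
qed


text \<open>Dominated convergence. The Lipschitz condition does not pass to the discretised
  functions, whose increments are only known to be at most \<open>2 * M\<close>; all control near
  the diagonal must therefore come from \<open>h\<close>. Truncated kernels meet the assumed bound
  by the integrable kernel.\<close>

lemma discretised_energy_tendsto:
  fixes f :: "'a::euclidean_space \<Rightarrow> real" and h :: "'a \<Rightarrow> 'a \<Rightarrow> real"
  assumes "0 < \<alpha>" "\<alpha> < 2" "C1c f" "C \<ge> 0"
    and [measurable]: "(\<lambda>z. h (fst z) (snd z)) \<in> borel_measurable (lborel \<Otimes>\<^sub>M lborel)"
    and h: "\<And>x y. 0 \<le> h x y"
    and bound: "AE z in lborel \<Otimes>\<^sub>M lborel. h (fst z) (snd z) \<le> C * levy_kernel \<alpha> (fst z - snd z)"
  shows "(\<lambda>n. \<integral>\<^sup>+z. ennreal ((f (corner (Suc n) (snd z)) - f (corner (Suc n) (fst z)))\<^sup>2 * h (fst z) (snd z)) \<partial>(lborel \<Otimes>\<^sub>M lborel))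
     \<longlonglongrightarrow> (\<integral>\<^sup>+z. ennreal ((f (snd z) - f (fst z))\<^sup>2 * h (fst z) (snd z)) \<partial>(lborel \<Otimes>\<^sub>M lborel))"
proof -
  obtain M R L where f: "\<And>x. \<bar>f x\<bar> \<le> M" "\<And>x. norm x > R \<Longrightarrow> f x = 0" "M \<ge> 0"
    using assms(3) by (rule C1c_E) blast
  have [measurable]: "f \<in> borel_measurable borel" by (rule C1c_measurable) fact
  \<comment> \<open>Discretisation moves a point by at most the dimension divided by the positive
    index, so one enlarged ball supports all discretised functions.\<close>
  define R' where "R' = R + real DIM('a)"
  define g where "g x = ennreal (4 * M\<^sup>2 * C) * indicator (cball (0::'a) R') x" for x
  have [measurable]: "g \<in> borel_measurable borel"
    unfolding g_def by (intro borel_measurable_times_ennreal borel_measurable_indicator) auto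
  have gfin: "(\<integral>\<^sup>+x. g x \<partial>lborel) < \<infinity>"
    unfolding g_def by (rule nn_integral_indicator_cball_finite)
  have zero: "f (corner (Suc n) x) = 0" if "x \<notin> cball 0 R'" for x n
  proof (rule f(2))
    have "norm (x - corner (Suc n) x) \<le> real DIM('a) / real (Suc n)" by (rule norm_corner_diff) simp
    also have "\<dots> \<le> real DIM('a)" by (simp add: divide_le_eq mult_le_cancel_left1)
    finally have "norm x - norm (corner (Suc n) x) \<le> real DIM('a)"
      using norm_triangle_ineq2[of x "corner (Suc n) x"] by linarith
    then show "R < norm (corner (Suc n) x)" using that by (simp add: R'_def)
  qed
  show ?thesis
  proof (rule nn_integral_dominated_convergence[where w = "\<lambda>z. (g (fst z) + g (snd z)) * ennreal (levy_kernel \<alpha> (fst z - snd z))"])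
    fix n
    show "AE z in lborel \<Otimes>\<^sub>M lborel. ennreal ((f (corner (Suc n) (snd z)) - f (corner (Suc n) (fst z)))\<^sup>2 * h (fst z) (snd z))
      \<le> (g (fst z) + g (snd z)) * ennreal (levy_kernel \<alpha> (fst z - snd z))"
      using bound
    proof eventually_elim
      case (elim z)
      obtain x y where z: "z = (x, y)" by (cases z)
      let ?x = "corner (Suc n) x" and ?y = "corner (Suc n) y"
      show ?case
      proof (cases "x \<notin> cball 0 R' \<and> y \<notin> cball 0 R'")
        case True then show ?thesis using zero by (simp add: z)
      next
        case False
        then have "ennreal (4 * M\<^sup>2 * C) \<le> g x + g y"
          unfolding g_def by (auto simp: indicator_def intro: order_trans[OF _ add_increasing])
        from mult_right_mono[OF this, of "ennreal (levy_kernel \<alpha> (x - y))"]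
        have 1: "ennreal (4 * M\<^sup>2 * C * levy_kernel \<alpha> (x - y)) \<le> (g x + g y) * ennreal (levy_kernel \<alpha> (x - y))"
          using assms(4) by (simp add: ennreal_mult)
        have "\<bar>f ?y - f ?x\<bar> \<le> 2 * M" using f(1)[of ?x] f(1)[of ?y] by linarith
        from power_mono[OF this, of 2] have "(f ?y - f ?x)\<^sup>2 \<le> 4 * M\<^sup>2" by (simp add: power_mult_distrib)
        moreover have "h x y \<le> C * levy_kernel \<alpha> (x - y)" using elim by (simp add: z)
        ultimately have "(f ?y - f ?x)\<^sup>2 * h x y \<le> 4 * M\<^sup>2 * (C * levy_kernel \<alpha> (x - y))"
          using h by (intro mult_mono) auto
        from order_trans[OF ennreal_leI[OF this]] 1 show ?thesis by (simp add: z mult.assoc)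
      qed
    qed
  next
    show "AE z in lborel \<Otimes>\<^sub>M lborel. (\<lambda>n. ennreal ((f (corner (Suc n) (snd z)) - f (corner (Suc n) (fst z)))\<^sup>2 * h (fst z) (snd z)))
      \<longlonglongrightarrow> ennreal ((f (snd z) - f (fst z))\<^sup>2 * h (fst z) (snd z))"
    proof (rule AE_I2)
      fix z :: "'a \<times> 'a"
      have "(\<lambda>n. f (corner (Suc n) x)) \<longlonglongrightarrow> f x" for x
        by (rule continuous_on_tendsto_compose[OF C1c_continuous[OF assms(3)] LIMSEQ_Suc[OF corner_tendsto]]) simp_all
      then show "(\<lambda>n. ennreal ((f (corner (Suc n) (snd z)) - f (corner (Suc n) (fst z)))\<^sup>2 * h (fst z) (snd z)))
      \<longlonglongrightarrow> ennreal ((f (snd z) - f (fst z))\<^sup>2 * h (fst z) (snd z))"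
        by (intro tendsto_ennrealI tendsto_intros)
    qed
  next
    show "(\<integral>\<^sup>+z. (g (fst z) + g (snd z)) * ennreal (levy_kernel \<alpha> (fst z - snd z)) \<partial>(lborel \<Otimes>\<^sub>M lborel)) < \<infinity>"
      by (rule nn_integral_levy_localised_finite[OF assms(1,2) _ gfin]) measurable
  qed measurable
qed


text \<open>On the region kept by the truncation, the factor \<open>min 1 ((norm z)\<^sup>2)\<close>
  is bounded below by \<open>min 1 (\<epsilon>\<^sup>2)\<close>.\<close>

lemma truncated_riesz_le_levy:
  assumes "\<epsilon> > 0"
  shows "riesz_kernel \<alpha> z * indicator {r. \<epsilon> \<le> r} (norm z) \<le> 1 / min 1 (\<epsilon>\<^sup>2) * levy_kernel \<alpha> z"
proof (cases "\<epsilon> \<le> norm z")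
  case True
  then have "\<epsilon>\<^sup>2 \<le> (norm z)\<^sup>2" using assms by (intro power_mono) auto
  then have "min 1 (\<epsilon>\<^sup>2) \<le> min 1 ((norm z)\<^sup>2)" by auto
  then have "1 \<le> min 1 ((norm z)\<^sup>2) / min 1 (\<epsilon>\<^sup>2)" using assms by (simp add: le_divide_eq)
  from mult_right_mono[OF this riesz_kernel_nonneg[of \<alpha> z]] show ?thesis
    using True by (simp add: levy_kernel_def)
qed (use assms in simp)

text \<open>The discrete inequality has constants independent of the mesh and of \<epsilon>. At
  fixed \<epsilon> both sides converge as the mesh is refined. The right side is then enlarged to
  the full energy, which does not depend on \<epsilon>, so that letting \<epsilon> tend to 0
  concerns the left side alone.\<close>

lemma condB_coercive:
  fixes k :: "'a::euclidean_space \<Rightarrow> 'a \<Rightarrow> real"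
  assumes \<alpha>: "0 < \<alpha>" "\<alpha> < 2"
    and k [measurable]: "(\<lambda>z. k (fst z) (snd z)) \<in> borel_measurable (lborel \<Otimes>\<^sub>M lborel)"
    and k0: "\<And>x y. k x y \<ge> 0" and "\<Lambda>1 > 0"
    and up: "AE z in lborel \<Otimes>\<^sub>M lborel. fst z \<noteq> snd z \<longrightarrow>
           k (fst z) (snd z) \<le> \<Lambda>1 * riesz_kernel \<alpha> (fst z - snd z)"
    and "condB \<alpha> k"
  shows "\<exists>c0>0. \<forall>f. C1c f \<longrightarrow> ennreal c0 * Ealpha \<alpha> f \<le> Eform k f"
proof -
  obtain M0 :: nat and \<Lambda>2 where \<Lambda>2: "\<Lambda>2 > 0" and B: "\<forall>\<epsilon>>0. \<forall>n::nat. n \<ge> 1 \<longrightarrow>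
     (\<exists>(path :: 'a set \<times> 'a set \<Rightarrow> nat \<Rightarrow> 'a set) (len :: 'a set \<times> 'a set \<Rightarrow> nat).
        (\<forall>Oc\<in>cubes n. \<forall>Qc\<in>cubes n.
            len (Oc, Qc) \<le> M0 \<and> path (Oc, Qc) 0 = Oc \<and> path (Oc, Qc) (len (Oc, Qc)) = Qc \<and>
            (\<forall>j\<le>len (Oc, Qc). path (Oc, Qc) j \<in> cubes n) \<and>
            (\<forall>j<len (Oc, Qc).
               dint (path (Oc, Qc) j) (path (Oc, Qc) (Suc j))
                 (\<lambda>x y. k x y * indicator {r. r \<ge> \<epsilon>} (norm (x - y)))
               \<ge> ennreal \<Lambda>2 * dint Oc Qc
                 (\<lambda>x y. indicator {r. r \<ge> \<epsilon>} (norm (x - y)) *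
                        norm (x - y) powr (- real DIM('a) - \<alpha>)))) \<and>
        (\<forall>R\<in>cubes n. \<forall>S\<in>cubes n.
            finite {(Oc, Qc). Oc \<in> cubes n \<and> Qc \<in> cubes n \<and>
                    (\<exists>j<len (Oc, Qc). path (Oc, Qc) j = R \<and> path (Oc, Qc) (Suc j) = S)} \<and>
            card {(Oc, Qc). Oc \<in> cubes n \<and> Qc \<in> cubes n \<and>
                    (\<exists>j<len (Oc, Qc). path (Oc, Qc) j = R \<and> path (Oc, Qc) (Suc j) = S)} \<le> M0))"
    using \<open>condB \<alpha> k\<close> unfolding condB_def by (elim exE conjE) (rule that)
  define h1 where "h1 \<epsilon> x y = k x y * indicator {r. r \<ge> \<epsilon>} (norm (x - y))" for \<epsilon> :: real and x y :: 'a
  define h2 where "h2 \<epsilon> x y = indicator {r. r \<ge> \<epsilon>} (norm (x - y)) * riesz_kernel \<alpha> (x - y)" for \<epsilon> :: real and x y :: 'a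
  have [measurable]: "{r::real. r \<ge> \<epsilon>} \<in> sets borel" for \<epsilon> by simp
  have m1: "(\<lambda>z. h1 \<epsilon> (fst z) (snd z)) \<in> borel_measurable (lborel \<Otimes>\<^sub>M lborel)" for \<epsilon>
    unfolding h1_def by measurable
  have m2: "(\<lambda>z. h2 \<epsilon> (fst z) (snd z)) \<in> borel_measurable (lborel \<Otimes>\<^sub>M lborel)" for \<epsilon>
    unfolding h2_def by measurable
  have nn: "h1 \<epsilon> x y \<ge> 0" "h2 \<epsilon> x y \<ge> 0" for \<epsilon> x y using k0 by (auto simp: h1_def h2_def)
  have disc: "ennreal \<Lambda>2 * (\<integral>\<^sup>+z. ennreal ((f (corner n (snd z)) - f (corner n (fst z)))\<^sup>2 * h2 \<epsilon> (fst z) (snd z)) \<partial>(lborel \<Otimes>\<^sub>M lborel))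
     \<le> of_nat (M0 ^ 3) * (\<integral>\<^sup>+z. ennreal ((f (corner n (snd z)) - f (corner n (fst z)))\<^sup>2 * h1 \<epsilon> (fst z) (snd z)) \<partial>(lborel \<Otimes>\<^sub>M lborel))"
    if n: "n \<ge> 1" and \<epsilon>: "\<epsilon> > 0" and f: "C1c f" for n \<epsilon> f
  proof -
    obtain path :: "'a set \<times> 'a set \<Rightarrow> nat \<Rightarrow> 'a set" and len :: "'a set \<times> 'a set \<Rightarrow> nat" where
      p: "\<forall>Oc\<in>cubes n. \<forall>Qc\<in>cubes n.
            len (Oc, Qc) \<le> M0 \<and> path (Oc, Qc) 0 = Oc \<and> path (Oc, Qc) (len (Oc, Qc)) = Qc \<and>
            (\<forall>j\<le>len (Oc, Qc). path (Oc, Qc) j \<in> cubes n) \<and>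
            (\<forall>j<len (Oc, Qc). ennreal \<Lambda>2 * dint Oc Qc (h2 \<epsilon>) \<le> dint (path (Oc, Qc) j) (path (Oc, Qc) (Suc j)) (h1 \<epsilon>))"
      and q: "\<forall>R\<in>cubes n. \<forall>S\<in>cubes n.
            finite {(Oc, Qc). Oc \<in> cubes n \<and> Qc \<in> cubes n \<and>
                    (\<exists>j<len (Oc, Qc). path (Oc, Qc) j = R \<and> path (Oc, Qc) (Suc j) = S)} \<and>
            card {(Oc, Qc). Oc \<in> cubes n \<and> Qc \<in> cubes n \<and>
                    (\<exists>j<len (Oc, Qc). path (Oc, Qc) j = R \<and> path (Oc, Qc) (Suc j) = S)} \<le> M0"
      using B[rule_format, OF \<epsilon> n] 
      by (elim exE conjE, intro that, unfold h1_def[abs_def] h2_def[abs_def] riesz_kernel_def) assumption+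
    \<comment> \<open>Brings the counting clause of (B) into the form in which an edge is a single
      pair.\<close>
    have e: "{p \<in> cubes n \<times> cubes n. \<exists>j<len p. (path p j, path p (Suc j)) = (R, S)}
      = {(Oc, Qc). Oc \<in> cubes n \<and> Qc \<in> cubes n \<and> (\<exists>j<len (Oc, Qc). path (Oc, Qc) j = R \<and> path (Oc, Qc) (Suc j) = S)}" for R S
      by auto
    show ?thesis
    proof (rule discrete_energy_comparison[OF n C1c_measurable[OF f] m1 nn(1) m2 nn(2), where path=path and len=len], goal_cases)
      case (1 pq) then show ?case using p[rule_format, of "fst pq" "snd pq"] by auto
    next
      case (2 pq)
      then show ?case using q[rule_format, of "fst pq" "snd pq"]
        unfolding e[symmetric] prod.collapse mem_Times_iff by iprover
    qed
  qed
  have b1: "AE z in lborel \<Otimes>\<^sub>M lborel. h1 \<epsilon> (fst z) (snd z) \<le> (\<Lambda>1 / min 1 (\<epsilon>\<^sup>2)) * levy_kernel \<alpha> (fst z - snd z)" if "\<epsilon> > 0" for \<epsilon>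
    using up
  proof eventually_elim
    case (elim z)
    have "h1 \<epsilon> (fst z) (snd z) \<le> \<Lambda>1 * (riesz_kernel \<alpha> (fst z - snd z) * indicator {r. \<epsilon> \<le> r} (norm (fst z - snd z)))"
      using elim that by (cases "\<epsilon> \<le> norm (fst z - snd z)") (auto simp: h1_def)
    also have "\<dots> \<le> \<Lambda>1 * (1 / min 1 (\<epsilon>\<^sup>2) * levy_kernel \<alpha> (fst z - snd z))"
      using \<open>\<Lambda>1 > 0\<close> that by (intro mult_left_mono truncated_riesz_le_levy) auto
    finally show ?case by simp
  qed
  have b2: "AE z in lborel \<Otimes>\<^sub>M lborel. h2 \<epsilon> (fst z) (snd z) \<le> (1 / min 1 (\<epsilon>\<^sup>2)) * levy_kernel \<alpha> (fst z - snd z)" if "\<epsilon> > 0" for \<epsilon>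
    using truncated_riesz_le_levy[OF that] by (auto simp: h2_def mult.commute)
  have eps: "ennreal \<Lambda>2 * (\<integral>\<^sup>+z. ennreal ((f (snd z) - f (fst z))\<^sup>2 * h2 \<epsilon> (fst z) (snd z)) \<partial>(lborel \<Otimes>\<^sub>M lborel))
     \<le> of_nat (M0 ^ 3) * (2 * Eform k f)"
    if \<epsilon>: "\<epsilon> > 0" and f: "C1c f" for \<epsilon> f
  proof -
    have [measurable]: "f \<in> borel_measurable borel" by (rule C1c_measurable) fact
    have c: "0 \<le> \<Lambda>1 / min 1 (\<epsilon>\<^sup>2)" "0 \<le> 1 / min 1 (\<epsilon>\<^sup>2)" using \<epsilon> \<open>\<Lambda>1 > 0\<close> by auto
    have "ennreal \<Lambda>2 * (\<integral>\<^sup>+z. ennreal ((f (snd z) - f (fst z))\<^sup>2 * h2 \<epsilon> (fst z) (snd z)) \<partial>(lborel \<Otimes>\<^sub>M lborel))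
     \<le> of_nat (M0 ^ 3) * (\<integral>\<^sup>+z. ennreal ((f (snd z) - f (fst z))\<^sup>2 * h1 \<epsilon> (fst z) (snd z)) \<partial>(lborel \<Otimes>\<^sub>M lborel))"
    proof (rule LIMSEQ_le)
      show "(\<lambda>n. ennreal \<Lambda>2 * (\<integral>\<^sup>+z. ennreal ((f (corner (Suc n) (snd z)) - f (corner (Suc n) (fst z)))\<^sup>2 * h2 \<epsilon> (fst z) (snd z)) \<partial>(lborel \<Otimes>\<^sub>M lborel)))
        \<longlonglongrightarrow> ennreal \<Lambda>2 * (\<integral>\<^sup>+z. ennreal ((f (snd z) - f (fst z))\<^sup>2 * h2 \<epsilon> (fst z) (snd z)) \<partial>(lborel \<Otimes>\<^sub>M lborel))"
        by (rule ennreal_tendsto_cmult[OF ennreal_less_top discretised_energy_tendsto[OF \<alpha> f c(2) m2 nn(2) b2[OF \<epsilon>]]])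
      show "(\<lambda>n. of_nat (M0 ^ 3) * (\<integral>\<^sup>+z. ennreal ((f (corner (Suc n) (snd z)) - f (corner (Suc n) (fst z)))\<^sup>2 * h1 \<epsilon> (fst z) (snd z)) \<partial>(lborel \<Otimes>\<^sub>M lborel)))
        \<longlonglongrightarrow> of_nat (M0 ^ 3) * (\<integral>\<^sup>+z. ennreal ((f (snd z) - f (fst z))\<^sup>2 * h1 \<epsilon> (fst z) (snd z)) \<partial>(lborel \<Otimes>\<^sub>M lborel))"
        by (rule ennreal_tendsto_cmult[OF of_nat_less_top discretised_energy_tendsto[OF \<alpha> f c(1) m1 nn(1) b1[OF \<epsilon>]]])
    qed (intro exI allI impI disc[OF _ \<epsilon> f], simp)
    \<comment> \<open>Removing the truncation only increases the integral. Since \<epsilon> is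
      positive, no diagonal point survives the truncation, which matches the indicator in
      \<open>Eform\<close>.\<close>
    also have "(\<integral>\<^sup>+z. ennreal ((f (snd z) - f (fst z))\<^sup>2 * h1 \<epsilon> (fst z) (snd z)) \<partial>(lborel \<Otimes>\<^sub>M lborel))
       \<le> (\<integral>\<^sup>+ z. indicator {z. fst z \<noteq> snd z} z * ennreal ((f (snd z) - f (fst z))\<^sup>2 * k (fst z) (snd z)) \<partial>(lborel \<Otimes>\<^sub>M lborel))"
      using \<epsilon> k0 by (intro nn_integral_mono) (auto simp: h1_def indicator_def)
    also have "\<dots> = 2 * Eform k f"
    proof -
      have "2 * ennreal (1/2) = ennreal 2 * ennreal (1/2)" by simp
      also have "\<dots> = ennreal (2 * (1/2))" by (rule ennreal_mult[symmetric]) auto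
      also have "\<dots> = 1" by simp
      finally have "2 * ennreal (1/2) = 1" .
      then show ?thesis by (simp add: Eform_def mult.assoc[symmetric])
    qed
    finally show ?thesis by (simp add: mult_left_mono)
  qed
  have main: "ennreal \<Lambda>2 * Ealpha \<alpha> f \<le> of_nat (M0 ^ 3) * (2 * Eform k f)" if f: "C1c f" for f
  proof -
    have [measurable]: "f \<in> borel_measurable borel" by (rule C1c_measurable) fact
    note [measurable] = m2
    define u where "u m z = ennreal \<Lambda>2 * ennreal ((f (snd z) - f (fst z))\<^sup>2 * h2 (1 / real (Suc m)) (fst z) (snd z))" for m z
    have "(\<integral>\<^sup>+z. ennreal \<Lambda>2 * ennreal ((f (snd z) - f (fst z))\<^sup>2 * riesz_kernel \<alpha> (fst z - snd z)) \<partial>(lborel \<Otimes>\<^sub>M lborel))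
      \<le> of_nat (M0 ^ 3) * (2 * Eform k f)"
    proof (rule nn_integral_le_tendsto[where u=u])
      show "u m \<in> borel_measurable (lborel \<Otimes>\<^sub>M lborel)" for m unfolding u_def by measurable
      show "AE z in lborel \<Otimes>\<^sub>M lborel. (\<lambda>m. u m z) \<longlonglongrightarrow> ennreal \<Lambda>2 * ennreal ((f (snd z) - f (fst z))\<^sup>2 * riesz_kernel \<alpha> (fst z - snd z))"
      proof (rule AE_I2)
        fix z :: "'a \<times> 'a"
        have "\<forall>\<^sub>F m in sequentially. u m z = ennreal \<Lambda>2 * ennreal ((f (snd z) - f (fst z))\<^sup>2 * riesz_kernel \<alpha> (fst z - snd z))"
        \<comment> \<open>Off the diagonal the truncation is inactive once 1/(m+1) is smaller than
          the distance; on it every term is 0. In both cases the sequence is eventually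
          constant.\<close>
        proof (cases "fst z = snd z")
          case False
          have "(\<lambda>m. 1 / real (Suc m)) \<longlonglongrightarrow> 0" by (rule LIMSEQ_Suc[OF lim_1_over_n])
          then have "\<forall>\<^sub>F m in sequentially. 1 / real (Suc m) < norm (fst z - snd z)"
            by (rule order_tendstoD) (use False in simp)
          then show ?thesis by eventually_elim (simp add: u_def h2_def)
        qed (simp add: u_def)
        then show "(\<lambda>m. u m z) \<longlonglongrightarrow> ennreal \<Lambda>2 * ennreal ((f (snd z) - f (fst z))\<^sup>2 * riesz_kernel \<alpha> (fst z - snd z))"
          by (rule tendsto_eventually)
      qed
      show "\<forall>\<^sub>F m in sequentially. (\<integral>\<^sup>+z. u m z \<partial>(lborel \<Otimes>\<^sub>M lborel)) \<le> of_nat (M0 ^ 3) * (2 * Eform k f)"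
        unfolding u_def using eps[OF _ f] by (intro always_eventually allI) (subst nn_integral_cmult, auto)
    qed
    then show ?thesis unfolding Ealpha_eq by (subst (asm) nn_integral_cmult) auto
  qed
  \<comment> \<open>The factor 2 compensates for the 1/2 in \<open>Eform\<close>; adding 1 keeps the
    denominator positive when \<open>M0 = 0\<close>.\<close>
  define c where "c = 1 / (2 * (real M0 ^ 3 + 1))"
  have c: "c > 0" by (simp add: c_def add_nonneg_pos)
  have "ennreal (c * \<Lambda>2) * Ealpha \<alpha> f \<le> Eform k f" if "C1c f" for f
  proof -
    have "ennreal (c * \<Lambda>2) * Ealpha \<alpha> f = ennreal c * (ennreal \<Lambda>2 * Ealpha \<alpha> f)"
      using c \<Lambda>2 by (simp add: ennreal_mult mult.assoc)
    also have "\<dots> \<le> ennreal c * (of_nat (M0 ^ 3) * (2 * Eform k f))"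
      by (intro mult_left_mono main that) auto
    also have "\<dots> = ennreal (c * real (M0 ^ 3) * 2) * Eform k f"
      using c by (simp add: ennreal_mult' mult.assoc ennreal_of_nat_eq_real_of_nat del: of_nat_power)
    also have "\<dots> \<le> 1 * Eform k f"
      by (intro mult_right_mono) (auto simp: c_def divide_le_eq ennreal_le_1 add_nonneg_pos)
    finally show ?thesis by simp
  qed
  then show ?thesis using c \<Lambda>2 by (intro exI[of _ "c * \<Lambda>2"]) auto
qed


section \<open>Convergence in norm and translations\<close>

text \<open>Fatou's lemma is applied to \<open>2 u\<^sub>n\<^sup>2 + 2 v\<^sup>2 - (u\<^sub>n - v)\<^sup>2\<close>.\<close>

lemma square_diff_tendsto_0:
  fixes u :: "nat \<Rightarrow> 'a \<Rightarrow> real" and v w :: "'a \<Rightarrow> real"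
  assumes [measurable]: "\<And>n. u n \<in> borel_measurable M" "v \<in> borel_measurable M" "w \<in> borel_measurable M"
    and w: "\<And>x. 0 \<le> w x"
    and lim: "AE x in M. (\<lambda>n. u n x) \<longlonglongrightarrow> v x"
    and le: "\<And>n. (\<integral>\<^sup>+x. ennreal ((u n x)\<^sup>2 * w x) \<partial>M) \<le> (\<integral>\<^sup>+x. ennreal ((v x)\<^sup>2 * w x) \<partial>M)"
    and fin: "(\<integral>\<^sup>+x. ennreal ((v x)\<^sup>2 * w x) \<partial>M) < \<infinity>"
  shows "(\<lambda>n. \<integral>\<^sup>+x. ennreal ((u n x - v x)\<^sup>2 * w x) \<partial>M) \<longlonglongrightarrow> 0"
proof -
  define p where "p n x = (2 * (u n x)\<^sup>2 + 2 * (v x)\<^sup>2 - (u n x - v x)\<^sup>2) * w x" for n x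
  define D where "D n = (\<integral>\<^sup>+x. ennreal ((u n x - v x)\<^sup>2 * w x) \<partial>M)" for n
  define V where "V = (\<integral>\<^sup>+x. ennreal ((v x)\<^sup>2 * w x) \<partial>M)"
  define P where "P n = (\<integral>\<^sup>+x. ennreal (p n x) \<partial>M)" for n
  have [measurable]: "p n \<in> borel_measurable M" for n unfolding p_def by measurable
  have p0: "p n x \<ge> 0" for n x
    unfolding p_def using square_diff_bounds(1)[of "u n x" "v x"] w by (intro mult_nonneg_nonneg) auto
  \<comment> \<open>Adding the subtracted square back leaves twice the energy of \<open>u n\<close>
    plus twice that of \<open>v\<close>, and each energy is at most \<open>V\<close>.\<close>
  have sum: "P n + D n \<le> 4 * V" for n
  proof -
    have "P n + D n = (\<integral>\<^sup>+x. ennreal (p n x) + ennreal ((u n x - v x)\<^sup>2 * w x) \<partial>M)"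
      unfolding P_def D_def by (rule nn_integral_add[symmetric]) auto
    also have "\<dots> = (\<integral>\<^sup>+x. 2 * ennreal ((u n x)\<^sup>2 * w x) + 2 * ennreal ((v x)\<^sup>2 * w x) \<partial>M)"
    proof (rule nn_integral_cong)
      fix x
      have "ennreal (p n x) + ennreal ((u n x - v x)\<^sup>2 * w x) = ennreal (2 * ((u n x)\<^sup>2 * w x) + 2 * ((v x)\<^sup>2 * w x))"
        using p0[of n x] w[of x] by (subst ennreal_plus[symmetric]) (auto simp: p_def algebra_simps)
      then show "ennreal (p n x) + ennreal ((u n x - v x)\<^sup>2 * w x) = 2 * ennreal ((u n x)\<^sup>2 * w x) + 2 * ennreal ((v x)\<^sup>2 * w x)"
        using w[of x] by (simp add: ennreal_plus ennreal_mult')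
    qed
    also have "\<dots> = 2 * (\<integral>\<^sup>+x. ennreal ((u n x)\<^sup>2 * w x) \<partial>M) + 2 * V"
      by (subst nn_integral_add) (auto simp: nn_integral_cmult V_def)
    also have "\<dots> \<le> 2 * V + 2 * V"
      using le[of n] by (intro add_right_mono mult_left_mono) (auto simp: V_def)
    also have "\<dots> = 4 * V" by (simp flip: distrib_right)
    finally show ?thesis .
  qed
  have "(\<integral>\<^sup>+x. 4 * ennreal ((v x)\<^sup>2 * w x) \<partial>M) = (\<integral>\<^sup>+x. liminf (\<lambda>n. ennreal (p n x)) \<partial>M)"
  proof (intro nn_integral_cong_AE, use lim in eventually_elim)
    case (elim x)
    have "(\<lambda>n. p n x) \<longlonglongrightarrow> (2 * (v x)\<^sup>2 + 2 * (v x)\<^sup>2 - (v x - v x)\<^sup>2) * w x"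
      unfolding p_def by (intro tendsto_intros elim)
    then have "(\<lambda>n. ennreal (p n x)) \<longlonglongrightarrow> ennreal (4 * ((v x)\<^sup>2 * w x))"
      by (intro tendsto_ennrealI) (simp add: algebra_simps)
    then have "(\<lambda>n. ennreal (p n x)) \<longlonglongrightarrow> 4 * ennreal ((v x)\<^sup>2 * w x)"
      using w[of x] by (simp add: ennreal_mult')
    then show ?case by (simp add: tendsto_iff_Liminf_eq_Limsup)
  qed
  also have "\<dots> \<le> liminf P"
    unfolding P_def by (rule nn_integral_liminf) simp
  finally have liminf: "4 * V \<le> liminf P"
    by (simp add: nn_integral_cmult V_def)
  have V: "4 * V < \<infinity>" using fin by (simp add: V_def ennreal_mult_less_top)
  obtain c where c: "4 * V = ennreal c" "c \<ge> 0" using V by (cases "4 * V") auto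
  have "D \<longlonglongrightarrow> 0"
  proof (rule order_tendstoI)
    fix a :: ennreal assume "0 < a"
    then obtain e where e0: "0 < e" and e: "ennreal e < a"
    proof (cases a)
      case (real r)
      then show ?thesis using \<open>0 < a\<close> by (intro that[of "r / 2"]) (auto simp: ennreal_less_iff)
    qed (auto intro: that[of 1])
    have "\<forall>\<^sub>F n in sequentially. D n \<le> ennreal e"
    \<comment> \<open>The other case needs \<open>ennreal (c - e)\<close> strictly below
      \<open>ennreal c\<close>. This fails for \<open>c = 0\<close>, because \<open>ennreal\<close>
      sends negative numbers to 0.\<close>
    proof (cases "c = 0")
      case True
      then have "D n = 0" for n using sum[of n] c by simp
      then show ?thesis by simp
    next
      case False
      then have "ennreal (c - e) < liminf P"
        using liminf c e0 by (intro less_le_trans[OF _ liminf]) (auto simp: ennreal_less_iff intro!: ennreal_lessI)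
      then have "\<forall>\<^sub>F n in sequentially. ennreal (c - e) < P n" by (rule less_LiminfD)
      then show ?thesis
      proof eventually_elim
        case (elim n)
        have s: "P n + D n \<le> ennreal c" using sum[of n] c by simp
        then have "P n < top" "D n < top"
          by (meson add_increasing add_increasing2 ennreal_less_top le_less_trans order_refl zero_le)+
        then obtain q d where q: "P n = ennreal q" "q \<ge> 0" and d: "D n = ennreal d" "d \<ge> 0"
          by (metis ennreal_cases less_irrefl)
        have "q + d \<le> c" using s q d c by (simp flip: ennreal_plus)
        moreover have "c - e < q" using elim q by (cases "c - e \<ge> 0") (auto simp: ennreal_less_iff)
        ultimately show ?case using d e0 by (auto intro!: ennreal_leI)
      qed
    qed
    then show "\<forall>\<^sub>F n in sequentially. D n < a"
      by eventually_elim (use e in auto)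
  qed simp
  then show ?thesis unfolding D_def[abs_def] .
qed

section \<open>Cutoffs and continuity of translations in L^1\<close>

definition cutoff :: "real \<Rightarrow> 'a::real_normed_vector \<Rightarrow> real" where
  "cutoff R x = max 0 (min 1 (R + 1 - norm x))"

lemma cutoff_bounds: "0 \<le> cutoff R x" "cutoff R x \<le> 1"
  by (auto simp: cutoff_def)

lemma cutoff_eq_1: "norm x \<le> R \<Longrightarrow> cutoff R x = 1"
  by (simp add: cutoff_def)

lemma cutoff_eq_0: "norm x \<ge> R + 1 \<Longrightarrow> cutoff R x = 0"
  by (simp add: cutoff_def)

lemma cutoff_lipschitz: "\<bar>cutoff R x - cutoff R y\<bar> \<le> min 1 (norm (x - y))"
  using norm_triangle_ineq3[of x y] unfolding cutoff_def by (auto simp: max_def min_def abs_if split: if_splits)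

lemma continuous_cutoff: "continuous_on UNIV (cutoff R)"
  unfolding cutoff_def by (intro continuous_intros)

definition clamp_abs :: "real \<Rightarrow> real \<Rightarrow> real" where
  "clamp_abs M t = max (- M) (min M t)"

lemma clamp_abs_bound: "M \<ge> 0 \<Longrightarrow> \<bar>clamp_abs M t\<bar> \<le> M"
  by (auto simp: clamp_abs_def)

lemma clamp_abs_id: "\<bar>t\<bar> \<le> M \<Longrightarrow> clamp_abs M t = t"
  by (auto simp: clamp_abs_def)

lemma clamp_abs_le: "M \<ge> 0 \<Longrightarrow> \<bar>clamp_abs M t\<bar> \<le> \<bar>t\<bar>"
  by (auto simp: clamp_abs_def)

lemma clamp_abs_lipschitz: "\<bar>clamp_abs M s - clamp_abs M t\<bar> \<le> \<bar>s - t\<bar>"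
  by (auto simp: clamp_abs_def max_def min_def abs_if split: if_splits)

lemma continuous_clamp_abs: "continuous_on UNIV (clamp_abs M)"
  unfolding clamp_abs_def by (intro continuous_intros)

text \<open>A measurable function is an almost everywhere limit of continuous ones. Clamping and
  cutting these off gives a common bound and a common support and does not disturb the limit, since
  \<open>f\<close> already obeys both; dominated convergence then gives L^1 convergence.\<close>

lemma L1_approx_continuous:
  fixes f :: "'a::euclidean_space \<Rightarrow> real"
  assumes [measurable]: "f \<in> borel_measurable borel"
    and M: "\<And>x. \<bar>f x\<bar> \<le> M" and R: "\<And>x. norm x > R \<Longrightarrow> f x = 0" and "e > 0"
  obtains g where "continuous_on UNIV g" "\<And>x. norm x \<ge> R + 1 \<Longrightarrow> g x = 0"
    "(\<integral>\<^sup>+x. ennreal \<bar>f x - g x\<bar> \<partial>lborel) < ennreal e"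
proof -
  have "f \<in> borel_measurable lebesgue" by (simp add: measurable_completion)
  then have "f measurable_on UNIV" by (intro lebesgue_measurable_imp_measurable_on) auto
  then obtain N g where N: "negligible N" and g: "\<And>n. continuous_on UNIV (g n)"
    and lim: "\<And>x. x \<notin> N \<Longrightarrow> (\<lambda>n. g n x) \<longlonglongrightarrow> f x"
    unfolding measurable_on_def by auto
  have M0: "M \<ge> 0" using M[of undefined] by linarith
  define G where "G n x = clamp_abs M (g n x) * cutoff R x" for n x
  have G: "continuous_on UNIV (G n)" for n
    unfolding G_def
    by (intro continuous_on_mult continuous_cutoff continuous_on_compose2[OF continuous_clamp_abs g]) auto
  have G0: "G n x = 0" if "norm x \<ge> R + 1" for n x using that by (simp add: G_def cutoff_eq_0)
  have GM: "\<bar>G n x\<bar> \<le> M" for n x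
    unfolding G_def abs_mult using clamp_abs_bound[OF M0] cutoff_bounds[of R x] M0
    by (metis abs_of_nonneg abs_ge_zero mult.right_neutral mult_mono)
  have [measurable]: "G n \<in> borel_measurable borel" for n by (intro borel_measurable_continuous_onI G)
  have "(\<lambda>n. \<integral>\<^sup>+x. ennreal \<bar>f x - G n x\<bar> \<partial>lborel) \<longlonglongrightarrow> (\<integral>\<^sup>+x. 0 \<partial>(lborel :: 'a measure))"
  proof (rule nn_integral_dominated_convergence[where w="\<lambda>x. ennreal (2 * M) * indicator (cball 0 (R + 1)) x"])
    show "AE x in lborel. ennreal \<bar>f x - G n x\<bar> \<le> ennreal (2 * M) * indicator (cball 0 (R + 1)) x" for n
    proof (rule AE_I2)
      fix x :: 'a
      show "ennreal \<bar>f x - G n x\<bar> \<le> ennreal (2 * M) * indicator (cball 0 (R + 1)) x"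
        using M[of x] GM[of n x] R[of x] G0[of x n]
        by (cases "norm x \<le> R + 1") (auto intro!: ennreal_leI)
    qed
    have "N \<in> null_sets lebesgue" using N by (simp add: negligible_iff_null_sets)
    then have "AE x in lebesgue. x \<notin> N" by (rule AE_not_in)
    then have "AE x in lborel. x \<notin> N" by (simp add: AE_completion_iff)
    then show "AE x in lborel. (\<lambda>n. ennreal \<bar>f x - G n x\<bar>) \<longlonglongrightarrow> 0"
    proof eventually_elim
      case (elim x)
      have "(\<lambda>n. clamp_abs M (g n x)) \<longlonglongrightarrow> clamp_abs M (f x)"
        by (rule continuous_on_tendsto_compose[OF continuous_clamp_abs lim[OF elim]]) auto
      then have "(\<lambda>n. G n x) \<longlonglongrightarrow> clamp_abs M (f x) * cutoff R x"
        unfolding G_def by (intro tendsto_intros)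
      also have "clamp_abs M (f x) * cutoff R x = f x"
        using M[of x] R[of x] by (cases "norm x \<le> R") (auto simp: clamp_abs_id cutoff_eq_1)
      finally have "(\<lambda>n. \<bar>f x - G n x\<bar>) \<longlonglongrightarrow> \<bar>f x - f x\<bar>" by (intro tendsto_intros)
      from tendsto_ennrealI[OF this] show ?case by simp
    qed
  qed (auto intro!: borel_measurable_times_ennreal borel_measurable_indicator nn_integral_indicator_cball_finite[unfolded infinity_ennreal_def])
  then have "\<forall>\<^sub>F n in sequentially. (\<integral>\<^sup>+x. ennreal \<bar>f x - G n x\<bar> \<partial>lborel) < ennreal e"
    by (rule order_tendstoD) (use \<open>e > 0\<close> in simp)
  then obtain n where "(\<integral>\<^sup>+x. ennreal \<bar>f x - G n x\<bar> \<partial>lborel) < ennreal e"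
    by (auto simp: eventually_sequentially)
  then show thesis using that[of "G n"] G G0 by blast
qed

text \<open>A three-term estimate through a continuous \<open>g\<close>. The two terms comparing
  \<open>f\<close> with \<open>g\<close> have equal integrals by translation invariance, and the
  middle term is small by uniform continuity on a compact ball.\<close>

lemma L1_translation_continuous:
  fixes f :: "'a::euclidean_space \<Rightarrow> real"
  assumes [measurable]: "f \<in> borel_measurable borel"
    and M: "\<And>x. \<bar>f x\<bar> \<le> M" and R: "\<And>x. norm x > R \<Longrightarrow> f x = 0" and "e > 0"
  obtains d where "d > 0" "\<And>u. norm u \<le> d \<Longrightarrow> (\<integral>\<^sup>+x. ennreal \<bar>f (x + u) - f x\<bar> \<partial>lborel) \<le> ennreal e"
proof -
  have "e / 3 > 0" using \<open>e > 0\<close> by simp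
  then obtain g where g: "continuous_on UNIV g" "\<And>x. norm x \<ge> R + 1 \<Longrightarrow> g x = 0"
    and fg: "(\<integral>\<^sup>+x. ennreal \<bar>f x - g x\<bar> \<partial>lborel) < ennreal (e / 3)"
    using L1_approx_continuous[OF assms(1) M R] by blast
  have [measurable]: "g \<in> borel_measurable borel" by (intro borel_measurable_continuous_onI g)
  have "emeasure lborel (cball (0::'a) (R + 2)) < \<infinity>" by (rule emeasure_lborel_cball_finite)
  then obtain v where v: "emeasure lborel (cball (0::'a) (R + 2)) = ennreal v" "v \<ge> 0"
    by (metis ennreal_cases infinity_ennreal_def less_irrefl)
  \<comment> \<open>The uniform error is spread over a ball of volume \<open>v\<close> and must
    integrate to at most \<open>e / 3\<close>; adding 1 avoids division by 0 when the ball is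
    empty.\<close>
  define \<eta> where "\<eta> = e / (3 * (v + 1))"
  have \<eta>: "\<eta> > 0" "\<eta> * v \<le> e / 3" using \<open>e > 0\<close> v(2) by (auto simp: \<eta>_def field_simps)
  have "uniformly_continuous_on (cball 0 (R + 3)) g"
    by (intro compact_uniformly_continuous continuous_on_subset[OF g(1)]) auto
  then obtain d where d: "d > 0" "\<And>x y. x \<in> cball 0 (R + 3) \<Longrightarrow> y \<in> cball 0 (R + 3) \<Longrightarrow> dist y x < d \<Longrightarrow> dist (g y) (g x) < \<eta>"
    unfolding uniformly_continuous_on_def using \<eta> by metis
  have "(\<integral>\<^sup>+x. ennreal \<bar>f (x + u) - f x\<bar> \<partial>lborel) \<le> ennreal e" if u: "norm u \<le> min 1 (d / 2)" for u
  proof -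
    \<comment> \<open>\<open>g\<close> vanishes from radius R+1 on and the shift is at most 1, so
      the increment lives on radius R+2 and the shifted point stays within R+3, where uniform
      continuity was taken. The bound \<open>d / 2\<close> on the shift supplies the strict
      inequality.\<close>
    have gu: "ennreal \<bar>g (x + u) - g x\<bar> \<le> ennreal \<eta> * indicator (cball 0 (R + 2)) x" for x
    proof (cases "norm x \<le> R + 2")
      case True
      have "norm (x + u) \<le> R + 3" using True u norm_triangle_ineq[of x u] by linarith
      then have "x + u \<in> cball 0 (R + 3)" "x \<in> cball 0 (R + 3)" using True by auto
      then have "dist (g (x + u)) (g x) < \<eta>" using u d(1) by (intro d(2)) (auto simp: dist_norm)
      then show ?thesis using True by (auto simp: dist_norm intro!: ennreal_leI)
    next
      case False
      have "norm (x + u) \<ge> R + 1" using False u norm_diff_ineq[of x u] by linarith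
      then show ?thesis using False g(2) by simp
    qed
    have "(\<integral>\<^sup>+x. ennreal \<bar>f (x + u) - f x\<bar> \<partial>lborel)
       \<le> (\<integral>\<^sup>+x. ennreal \<bar>f (x + u) - g (x + u)\<bar> + ennreal \<bar>f x - g x\<bar> + ennreal \<eta> * indicator (cball 0 (R + 2)) x \<partial>lborel)"
    proof (rule nn_integral_mono)
      fix x
      have "ennreal \<bar>f (x + u) - f x\<bar> \<le> ennreal (\<bar>f (x + u) - g (x + u)\<bar> + \<bar>f x - g x\<bar> + \<bar>g (x + u) - g x\<bar>)"
        by (intro ennreal_leI) linarith
      also have "\<dots> = ennreal \<bar>f (x + u) - g (x + u)\<bar> + ennreal \<bar>f x - g x\<bar> + ennreal \<bar>g (x + u) - g x\<bar>"
        by (simp add: ennreal_plus)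
      also have "\<dots> \<le> ennreal \<bar>f (x + u) - g (x + u)\<bar> + ennreal \<bar>f x - g x\<bar> + ennreal \<eta> * indicator (cball 0 (R + 2)) x"
        by (intro add_left_mono gu)
      finally show "ennreal \<bar>f (x + u) - f x\<bar> \<le> \<dots>" .
    qed
    also have "\<dots> = (\<integral>\<^sup>+x. ennreal \<bar>f (x + u) - g (x + u)\<bar> \<partial>lborel) + (\<integral>\<^sup>+x. ennreal \<bar>f x - g x\<bar> \<partial>lborel)
        + (\<integral>\<^sup>+x. ennreal \<eta> * indicator (cball (0::'a) (R + 2)) x \<partial>lborel)"
      by (simp add: nn_integral_add borel_measurable_times_ennreal borel_measurable_indicator)
    also have "(\<integral>\<^sup>+x. ennreal \<bar>f (x + u) - g (x + u)\<bar> \<partial>lborel) = (\<integral>\<^sup>+x. ennreal \<bar>f x - g x\<bar> \<partial>lborel)"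
      using nn_integral_translate[of "\<lambda>x. ennreal \<bar>f x - g x\<bar>" "- u"] by simp
    also have "(\<integral>\<^sup>+x. ennreal \<eta> * indicator (cball (0::'a) (R + 2)) x \<partial>lborel) = ennreal (\<eta> * v)"
      using \<eta> v by (subst nn_integral_cmult_indicator) (auto simp: ennreal_mult)
    also have "(\<integral>\<^sup>+x. ennreal \<bar>f x - g x\<bar> \<partial>lborel) + (\<integral>\<^sup>+x. ennreal \<bar>f x - g x\<bar> \<partial>lborel) + ennreal (\<eta> * v)
      \<le> ennreal (e / 3) + ennreal (e / 3) + ennreal (e / 3)"
      using fg \<eta> by (intro add_mono) (auto intro: ennreal_leI)
    also have "\<dots> = ennreal e" using \<open>e > 0\<close> by (simp flip: ennreal_plus)
    finally show ?thesis .
  qed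
  then show thesis using d(1) by (intro that[of "min 1 (d / 2)"]) auto
qed


section \<open>Mollification\<close>

text \<open>The squared positive part is convex and its derivative 2 max(0, t) has Lipschitz
  constant 2. Hence its first-order Taylor remainder lies between 0 and s^2; the cases check this by
  hand.\<close>

lemma square_pos_part_expansion:
  fixes t s :: real
  shows "\<bar>(max 0 (t + s))\<^sup>2 - (max 0 t)\<^sup>2 - 2 * max 0 t * s\<bar> \<le> s\<^sup>2"
proof -
  have "(max 0 (t + s))\<^sup>2 - (max 0 t)\<^sup>2 - 2 * max 0 t * s \<ge> 0"
  proof (cases "t \<ge> 0")
    case True
    show ?thesis
    proof (cases "t + s \<ge> 0")
      case True then show ?thesis using \<open>t \<ge> 0\<close> by (simp add: power2_sum)
    next
      case False
      have "0 \<le> t * (- t - 2 * s)" using True False by (intro mult_nonneg_nonneg) auto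
      then show ?thesis using True False by (simp add: power2_eq_square algebra_simps)
    qed
  qed simp
  moreover have "(max 0 (t + s))\<^sup>2 - (max 0 t)\<^sup>2 - 2 * max 0 t * s \<le> s\<^sup>2"
  proof (cases "t \<ge> 0")
    case True
    then have "(max 0 (t + s))\<^sup>2 \<le> (t + s)\<^sup>2" by (auto simp: max_def)
    then show ?thesis using True by (simp add: power2_sum)
  next
    case False
    then have "(max 0 (t + s))\<^sup>2 \<le> s\<^sup>2" by (auto simp: max_def intro: power_mono)
    then show ?thesis using False by simp
  qed
  ultimately show ?thesis by linarith
qed

text \<open>A polynomial profile that is C^1 but not smooth. One continuous derivative suffices for
  \<open>C1c\<close>, and the Taylor remainder can be estimated by elementary algebra.\<close>

definition bump :: "real \<Rightarrow> 'a::euclidean_space \<Rightarrow> real" where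
  "bump r z = (max 0 (r\<^sup>2 - (norm z)\<^sup>2))\<^sup>2"

definition bump_grad :: "real \<Rightarrow> 'a::euclidean_space \<Rightarrow> 'a" where
  "bump_grad r z = (- 4 * max 0 (r\<^sup>2 - (norm z)\<^sup>2)) *\<^sub>R z"

lemma bump_nonneg [simp]: "0 \<le> bump r z"
  by (simp add: bump_def)

lemma bump_minus [simp]: "bump r (- z) = bump r z"
  by (simp add: bump_def)

lemma bump_eq_0: "0 < r \<Longrightarrow> r \<le> norm z \<Longrightarrow> bump r z = 0"
  unfolding bump_def using power_mono[of r "norm z" 2] by (simp add: max_def)

lemma bump_root_le_1:
  assumes "0 < r" "r \<le> 1" shows "max 0 (r\<^sup>2 - (norm z)\<^sup>2) \<le> (1::real)"
proof -
  have "r\<^sup>2 \<le> 1" using power_mono[of r 1 2] assms by simp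
  then have "r\<^sup>2 - (norm z)\<^sup>2 \<le> 1" using zero_le_power2[of "norm z"] by linarith
  then show ?thesis by simp
qed

lemma bump_le_1: "0 < r \<Longrightarrow> r \<le> 1 \<Longrightarrow> bump r z \<le> 1"
  unfolding bump_def using bump_root_le_1 by (intro power_le_one) auto

lemma continuous_bump: "continuous_on UNIV (bump r)"
  unfolding bump_def by (intro continuous_intros)

lemma continuous_bump_grad: "continuous_on UNIV (bump_grad r)"
  unfolding bump_grad_def by (intro continuous_intros)

lemma norm_bump_grad_le: 
  assumes "0 < r" "r \<le> 1" shows "norm (bump_grad r z) \<le> 4"
proof (cases "norm z \<le> r")
  case True
  have "max 0 (r\<^sup>2 - (norm z)\<^sup>2) \<le> 1" by (rule bump_root_le_1[OF assms])
  then have "max 0 (r\<^sup>2 - (norm z)\<^sup>2) * norm z \<le> 1 * 1" using True assms by (intro mult_mono) auto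
  then show ?thesis by (simp add: bump_grad_def)
next
  case False
  then have "r\<^sup>2 \<le> (norm z)\<^sup>2" using assms by (intro power_mono) auto
  then show ?thesis by (simp add: bump_grad_def)
qed

text \<open>The quadratic remainder makes it possible to differentiate the convolution directly, without a theorem on
  differentiation under the integral sign.\<close>

lemma bump_expansion:
  fixes z h :: "'a::euclidean_space"
  assumes r: "0 < r" "r \<le> 1" and h: "norm h \<le> 1"
  shows "\<bar>bump r (z + h) - bump r z - bump_grad r z \<bullet> h\<bar> \<le> 27 * (norm h)\<^sup>2"
proof (cases "norm z \<le> 2")
  case True
  define t where "t = r\<^sup>2 - (norm z)\<^sup>2"
  \<comment> \<open>The increment of r^2 - |z|^2. Here |s| \<le> 5 |h|, so the remainder s^2
    contributes 25 |h|^2; replacing s by its linear part costs 2 |h|^2 more, which explains the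
    27.\<close>
  define s where "s = - 2 * (z \<bullet> h) - (norm h)\<^sup>2"
  have ts: "r\<^sup>2 - (norm (z + h))\<^sup>2 = t + s"
    unfolding t_def s_def by (simp add: power2_norm_eq_inner inner_add_left inner_add_right inner_commute)
  have t1: "max 0 t \<le> 1"
    unfolding t_def by (rule bump_root_le_1[OF r])
  have "\<bar>z \<bullet> h\<bar> \<le> norm z * norm h" by (rule Cauchy_Schwarz_ineq2)
  also have "\<dots> \<le> 2 * norm h" using True by (intro mult_right_mono) auto
  finally have zh: "\<bar>z \<bullet> h\<bar> \<le> 2 * norm h" .
  have "(norm h)\<^sup>2 \<le> norm h" using h by (simp add: power2_eq_square mult_left_le)
  then have "\<bar>s\<bar> \<le> 5 * norm h" unfolding s_def using zh zero_le_power2[of "norm h"] by linarith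
  from power_mono[OF this, of 2] have s2: "s\<^sup>2 \<le> 25 * (norm h)\<^sup>2" by (simp add: power_mult_distrib)
  have e: "bump_grad r z \<bullet> h = 2 * max 0 t * s + 2 * max 0 t * (norm h)\<^sup>2"
    unfolding bump_grad_def t_def[symmetric] s_def by (simp add: algebra_simps)
  have "\<bar>2 * max 0 t * (norm h)\<^sup>2\<bar> \<le> 2 * (norm h)\<^sup>2"
    using t1 mult_right_mono[OF t1, of "(norm h)\<^sup>2"] by (simp add: abs_mult)
  then show ?thesis
    using square_pos_part_expansion[of t s] s2
    unfolding bump_def ts e t_def[symmetric] by linarith
next
  case False
  \<comment> \<open>Both points are at distance at least 1 from the origin, hence outside the
    support, as r \<le> 1.\<close>
  have "norm (z + h) \<ge> 1" using False h norm_diff_ineq[of z h] by linarith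
  then have "bump r (z + h) = 0" "bump r z = 0" using False r by (auto intro!: bump_eq_0)
  moreover have "r\<^sup>2 \<le> (norm z)\<^sup>2" using r False by (intro power_mono) auto
  then have "bump_grad r z = 0" by (simp add: bump_grad_def)
  ultimately show ?thesis by simp
qed

definition bump_mass :: "'a::euclidean_space itself \<Rightarrow> real \<Rightarrow> real" where
  "bump_mass T r = (\<integral>z. bump r (z :: 'a) \<partial>lborel)"

lemma integrable_bounded_support:
  fixes f :: "'a::euclidean_space \<Rightarrow> real"
  assumes "f \<in> borel_measurable borel" "\<And>x. \<bar>f x\<bar> \<le> M" "\<And>x. norm x > R \<Longrightarrow> f x = 0"
  shows "integrable lborel f"
proof (rule Bochner_Integration.integrable_bound)
  show "integrable lborel (\<lambda>x. M * indicator (cball (0::'a) R) x)"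
    using emeasure_lborel_cball_finite[of "0::'a" R] by simp
  show "AE x in lborel. norm (f x) \<le> norm (M * indicator (cball 0 R) x)"
  proof (rule AE_I2)
    fix x
    show "norm (f x) \<le> norm (M * indicator (cball 0 R) x)"
      using assms(2)[of x] assms(3)[of x] by (cases "norm x \<le> R") auto
  qed
qed (use assms(1) in simp)

lemma integrable_bump:
  assumes "0 < r" "r \<le> 1"
  shows "integrable lborel (bump r :: 'a::euclidean_space \<Rightarrow> real)"
  using assms
  by (intro integrable_bounded_support[where M=1 and R=r] borel_measurable_continuous_onI continuous_bump)
     (auto simp: bump_le_1 bump_eq_0)

lemma bump_mass_pos:
  assumes "0 < r" "r \<le> 1"
  shows "bump_mass TYPE('a::euclidean_space) r > 0"
proof -
  have "\<not> (AE z in lborel. bump r (z::'a) = 0)"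
  proof
    assume "AE z in lborel. bump r (z::'a) = 0"
    then have "AE z in lborel. z \<notin> ball (0::'a) r"
    proof eventually_elim
      case (elim z)
      show ?case
      proof
        assume "z \<in> ball 0 r"
        then have "(norm z)\<^sup>2 < r\<^sup>2" using assms by (intro power_strict_mono) auto
        then show False using elim by (simp add: bump_def)
      qed
    qed
    then have "emeasure lborel (ball (0::'a) r) = 0"
      by (subst (asm) AE_iff_measurable[where N="ball 0 r"]) auto
    moreover have "unit_ball_vol (real DIM('a)) > 0" by simp
    ultimately show False using assms emeasure_ball[of r "0::'a"] zero_less_power[OF assms(1), of "DIM('a)"]
      by (simp add: ennreal_eq_0_iff mult_le_0_iff not_le)
  qed
  then have "bump_mass TYPE('a) r \<noteq> 0"
    unfolding bump_mass_def
    using integral_nonneg_eq_0_iff_AE[OF integrable_bump[OF assms, where 'a='a]] by auto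
  moreover have "bump_mass TYPE('a) r \<ge> 0" unfolding bump_mass_def by simp
  ultimately show ?thesis by simp
qed

section \<open>Averages of translates\<close>

definition mollify :: "real \<Rightarrow> ('a::euclidean_space \<Rightarrow> real) \<Rightarrow> 'a \<Rightarrow> real" where
  "mollify r f x = (\<integral>u. f (x + u) * bump r u \<partial>lborel) / bump_mass TYPE('a) r"

text \<open>The definition presents an average of translates, suited to the energy and L^1
  estimates. Here \<open>x\<close> occurs in the C^1 factor alone, as differentiation requires. The
  two agree because the bump is even.\<close>

lemma mollify_convolution:
  fixes f :: "'a::euclidean_space \<Rightarrow> real"
  assumes [measurable]: "f \<in> borel_measurable borel"
  shows "mollify r f x = (\<integral>y. f y * bump r (x - y) \<partial>lborel) / bump_mass TYPE('a) r"
proof -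
  have [measurable]: "bump r \<in> borel_measurable (borel :: 'a measure)"
    by (intro borel_measurable_continuous_onI continuous_bump)
  have "(\<integral>y. f y * bump r (x - y) \<partial>lborel) = (\<integral>y. f y * bump r (y - x) \<partial>lborel)"
    using bump_minus[of r] by (metis minus_diff_eq)
  also have "\<dots> = (\<integral>y. f y * bump r (y - x) \<partial>distr lborel borel ((+) x))"
    by (simp add: lborel_distr_plus)
  also have "\<dots> = (\<integral>u. f (x + u) * bump r u \<partial>lborel)"
    by (subst integral_distr) auto
  finally show ?thesis by (simp add: mollify_def)
qed

lemma integrable_mult_bounded:
  fixes f :: "'a::euclidean_space \<Rightarrow> real" and g :: "'a \<Rightarrow> 'b::{banach, second_countable_topology}"
  assumes "integrable lborel f" "g \<in> borel_measurable borel" "\<And>x. norm (g x) \<le> C"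
  shows "integrable lborel (\<lambda>x. f x *\<^sub>R g x)"
proof (rule Bochner_Integration.integrable_bound)
  show "integrable lborel (\<lambda>x. C * \<bar>f x\<bar>)" using assms(1) by auto
  show "AE x in lborel. norm (f x *\<^sub>R g x) \<le> norm (C * \<bar>f x\<bar>)"
  proof (rule AE_I2)
    fix x
    have "\<bar>f x\<bar> * norm (g x) \<le> \<bar>f x\<bar> * C" by (intro mult_left_mono assms) auto
    then show "norm (f x *\<^sub>R g x) \<le> norm (C * \<bar>f x\<bar>)" by (simp add: mult.commute)
  qed
  show "(\<lambda>x. f x *\<^sub>R g x) \<in> borel_measurable lborel"
    using assms(1,2) by simp
qed

text \<open>The gradient is the convolution with \<open>bump_grad\<close>: integrating the remainder
  of \<open>bump_expansion\<close> against |f| leaves at most 27 |h|^2 times the L^1 norm of f. It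
  is continuous by dominated convergence, and the support grows by at most 1.\<close>

lemma C1c_mollify:
  fixes f :: "'a::euclidean_space \<Rightarrow> real"
  assumes f: "f \<in> borel_measurable borel" "\<And>x. \<bar>f x\<bar> \<le> M" "\<And>x. norm x > R \<Longrightarrow> f x = 0"
    and r: "0 < r" "r \<le> 1"
  shows "C1c (mollify r f)"
proof -
  define g where "g x = (\<integral>y. f y * bump r (x - y) \<partial>lborel)" for x
  define V where "V x = (\<integral>y. f y *\<^sub>R bump_grad r (x - y) \<partial>lborel)" for x
  define c where "c = inverse (bump_mass TYPE('a) r)"
  have mol: "mollify r f = (\<lambda>x. c * g x)"
    by (simp add: fun_eq_iff mollify_convolution[OF f(1)] g_def c_def divide_inverse mult.commute)
  have [measurable]: "bump r \<in> borel_measurable (borel :: 'a measure)" "bump_grad r \<in> borel_measurable (borel :: 'a measure)"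
    by (intro borel_measurable_continuous_onI continuous_bump continuous_bump_grad)+
  have fi: "integrable lborel f" by (rule integrable_bounded_support[OF f])
  have bi: "integrable lborel (\<lambda>y. f y * bump r (x - y))" for x
    using integrable_mult_bounded[OF fi, of "\<lambda>y. bump r (x - y)" 1] by (simp add: bump_le_1 r)
  have gi: "integrable lborel (\<lambda>y. f y *\<^sub>R bump_grad r (x - y))" for x
    using norm_bump_grad_le[OF r] by (intro integrable_mult_bounded[OF fi]) auto
  have deriv: "(g has_derivative (\<lambda>h. h \<bullet> V x)) (at x)" for x
    unfolding has_derivative_at
  proof
    show "bounded_linear (\<lambda>h. h \<bullet> V x)" by (rule bounded_linear_inner_left)
    define A where "A = (\<integral>y. \<bar>f y\<bar> \<partial>lborel)"
    show "(\<lambda>h. norm (g (x + h) - g x - h \<bullet> V x) / norm h) \<midarrow>0\<rightarrow> 0"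
    proof (rule Lim_null_comparison)
      have "(\<lambda>h::'a. 27 * A * norm h) \<midarrow>0\<rightarrow> 27 * A * norm (0::'a)" by (rule tendsto_mult[OF tendsto_const tendsto_norm[OF tendsto_ident_at]])
      then show "(\<lambda>h::'a. 27 * A * norm h) \<midarrow>0\<rightarrow> 0" by simp
      show "\<forall>\<^sub>F h in at 0. norm (norm (g (x + h) - g x - h \<bullet> V x) / norm h) \<le> 27 * A * norm h"
        unfolding eventually_at
      \<comment> \<open>Radius 1 is the range of increments for which \<open>bump_expansion\<close>
        is available.\<close>
      proof (intro exI[of _ 1] conjI ballI impI)
        fix h :: 'a assume "h \<noteq> 0 \<and> dist h 0 < 1"
        then have h: "h \<noteq> 0" "norm h \<le> 1" by auto
        have "h \<bullet> V x = (\<integral>y. h \<bullet> (f y *\<^sub>R bump_grad r (x - y)) \<partial>lborel)"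
          unfolding V_def by (rule integral_inner_right[symmetric]) (rule gi)
        moreover have "integrable lborel (\<lambda>y. f y * (h \<bullet> bump_grad r (x - y)))"
          using integrable_inner_right[of h, OF gi] by simp
        ultimately have "g (x + h) - g x - h \<bullet> V x
          = (\<integral>y. f y * bump r (x + h - y) - f y * bump r (x - y) - h \<bullet> (f y *\<^sub>R bump_grad r (x - y)) \<partial>lborel)"
          unfolding g_def using bi by simp
        also have "\<bar>\<dots>\<bar> \<le> (\<integral>y. 27 * (norm h)\<^sup>2 * \<bar>f y\<bar> \<partial>lborel)"
        proof (rule integral_abs_bound_integral)
          show "integrable lborel (\<lambda>y. f y * bump r (x + h - y) - f y * bump r (x - y) - h \<bullet> (f y *\<^sub>R bump_grad r (x - y)))"
            by (intro Bochner_Integration.integrable_diff bi integrable_inner_right gi)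
          show "integrable lborel (\<lambda>y. 27 * (norm h)\<^sup>2 * \<bar>f y\<bar>)" using fi by auto
          fix y
          have "\<bar>f y * bump r (x + h - y) - f y * bump r (x - y) - h \<bullet> (f y *\<^sub>R bump_grad r (x - y))\<bar>
            = \<bar>f y\<bar> * \<bar>bump r ((x - y) + h) - bump r (x - y) - bump_grad r (x - y) \<bullet> h\<bar>"
            by (simp add: abs_mult[symmetric] right_diff_distrib inner_commute algebra_simps)
          also have "\<dots> \<le> \<bar>f y\<bar> * (27 * (norm h)\<^sup>2)"
            by (intro mult_left_mono bump_expansion r h) auto
          finally show "\<bar>f y * bump r (x + h - y) - f y * bump r (x - y) - h \<bullet> (f y *\<^sub>R bump_grad r (x - y))\<bar>
            \<le> 27 * (norm h)\<^sup>2 * \<bar>f y\<bar>" by (simp add: mult_ac)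
        qed
        also have "\<dots> = 27 * A * norm h * norm h" by (simp add: A_def power2_eq_square mult_ac)
        finally show "norm (norm (g (x + h) - g x - h \<bullet> V x) / norm h) \<le> 27 * A * norm h"
          using h by (simp add: divide_le_eq)
      qed simp
    qed
  qed
  have contV: "continuous_on UNIV V"
  proof (rule continuous_at_imp_continuous_on, rule ballI, subst continuous_at_sequentially, intro allI impI)
    fix x :: 'a and X assume X: "X \<longlonglongrightarrow> x"
    show "(V \<circ> X) \<longlonglongrightarrow> V x"
      unfolding V_def comp_def
    proof (rule integral_dominated_convergence[where w="\<lambda>y. 4 * \<bar>f y\<bar>"])
      show "AE y in lborel. (\<lambda>i. f y *\<^sub>R bump_grad r (X i - y)) \<longlonglongrightarrow> f y *\<^sub>R bump_grad r (x - y)"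
        by (intro AE_I2 tendsto_intros continuous_on_tendsto_compose[OF continuous_bump_grad] X) auto
      show "AE y in lborel. norm (f y *\<^sub>R bump_grad r (X i - y)) \<le> 4 * \<bar>f y\<bar>" for i
      proof (rule AE_I2)
        fix y
        have "\<bar>f y\<bar> * norm (bump_grad r (X i - y)) \<le> \<bar>f y\<bar> * 4"
          by (intro mult_left_mono norm_bump_grad_le r) auto
        then show "norm (f y *\<^sub>R bump_grad r (X i - y)) \<le> 4 * \<bar>f y\<bar>" by simp
      qed
      show "integrable lborel (\<lambda>y. 4 * \<bar>f y\<bar>)" using fi by auto
    qed (use f(1) in measurable)
  qed
  have supp: "mollify r f x = 0" if "norm x > R + 1" for x
  proof -
    have "f y * bump r (x - y) = 0" for y
    proof (cases "norm y \<le> R")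
      case True
      then have "norm (x - y) \<ge> r" using that r norm_triangle_ineq2[of x y] by linarith
      then show ?thesis by (simp add: bump_eq_0[OF r(1)])
    qed (use f(3) in auto)
    then have "g x = 0" unfolding g_def by (intro integral_eq_zero_AE AE_I2)
    then show ?thesis by (simp add: mol)
  qed
  show ?thesis
    unfolding C1c_def
  \<comment> \<open>\<open>C1c\<close> asks for the derivative as a bounded linear functional, so
    the gradient is turned into one through the inner product.\<close>
  proof (intro conjI exI[of _ "\<lambda>x. c *\<^sub>R blinfun_inner_left (V x)"] allI)
    show "(mollify r f has_derivative blinfun_apply (c *\<^sub>R blinfun_inner_left (V x))) (at x)" for x
      unfolding mol using has_derivative_mult_right[OF deriv, of c x] by (simp add: scaleR_blinfun.rep_eq)
    show "continuous_on UNIV (\<lambda>x. c *\<^sub>R blinfun_inner_left (V x))"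
      by (intro continuous_intros bounded_linear.continuous_on[OF bounded_linear_blinfun_inner_left] contV)
    have "{x. mollify r f x \<noteq> 0} \<subseteq> cball 0 (R + 1)"
      using supp by (auto simp: not_less[symmetric])
    then have "bounded {x. mollify r f x \<noteq> 0}" by (rule bounded_subset[OF bounded_cball])
    then show "compact (closure {x. mollify r f x \<noteq> 0})" by (simp add: compact_closure)
  qed
qed


text \<open>The exceptional set of \<open>P\<close> may fail to be Borel, so it is enclosed in a
  Borel null set before almost everywhere statements are combined on the product.\<close>

lemma AE_lborel_pair:
  fixes P :: "'a::euclidean_space \<Rightarrow> bool"
  assumes "AE x in lborel. P x"
  shows "AE z in lborel \<Otimes>\<^sub>M lborel. P (fst z) \<and> P (snd z)"
proof -
  obtain N where N: "{x. \<not> P x} \<subseteq> N" "emeasure lborel N = 0" "N \<in> sets lborel"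
    using assms by (auto elim!: AE_E)
  have [measurable]: "N \<in> sets borel" using N by simp
  have "AE x in lborel. x \<notin> N" using N by (intro AE_not_in) auto
  then have "AE x in lborel. AE y in lborel. fst (x, y) \<notin> N \<and> snd (x, y) \<notin> N"
    by eventually_elim (use \<open>AE x in lborel. x \<notin> N\<close> in auto)
  then have "AE z in lborel \<Otimes>\<^sub>M lborel. fst z \<notin> N \<and> snd z \<notin> N"
  proof (intro lborel_pair.AE_pair_measure)
    show "{z \<in> space (lborel \<Otimes>\<^sub>M lborel). fst z \<notin> N \<and> snd z \<notin> N} \<in> sets (lborel \<Otimes>\<^sub>M lborel)"
      by measurable
  qed
  then show ?thesis by eventually_elim (use N(1) in blast)
qed

text \<open>Jensen's inequality for the probability density \<open>p\<close>, once for the square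
  and once for the absolute value. Boundedness of \<open>w\<close> makes the Bochner integrals
  meaningful.\<close>

lemma square_integral_le:
  fixes w p :: "'a \<Rightarrow> real"
  assumes [measurable]: "w \<in> borel_measurable M" and p: "integrable M p" "\<And>u. 0 \<le> p u" "(\<integral>u. p u \<partial>M) = 1"
    and w: "\<And>u. \<bar>w u\<bar> \<le> B"
  shows "ennreal ((\<integral>u. w u * p u \<partial>M)\<^sup>2) \<le> (\<integral>\<^sup>+u. ennreal ((w u)\<^sup>2 * p u) \<partial>M)"
    and "ennreal \<bar>\<integral>u. w u * p u \<partial>M\<bar> \<le> (\<integral>\<^sup>+u. ennreal (\<bar>w u\<bar> * p u) \<partial>M)"
proof -
  have [measurable]: "p \<in> borel_measurable M" using p(1) by simp
  have B: "B \<ge> 0" using w[of undefined] by linarith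
  have i1: "integrable M (\<lambda>u. w u * p u)"
  proof (rule Bochner_Integration.integrable_bound)
    show "integrable M (\<lambda>u. B * p u)" using p(1) by simp
    show "AE u in M. norm (w u * p u) \<le> norm (B * p u)"
      using w p(2) B by (auto simp: abs_mult intro!: mult_right_mono)
  qed measurable
  have i2: "integrable M (\<lambda>u. (w u)\<^sup>2 * p u)"
  proof (rule Bochner_Integration.integrable_bound)
    show "integrable M (\<lambda>u. B\<^sup>2 * p u)" using p(1) by simp
    show "AE u in M. norm ((w u)\<^sup>2 * p u) \<le> norm (B\<^sup>2 * p u)"
    proof (rule AE_I2)
      fix u
      have "(w u)\<^sup>2 \<le> B\<^sup>2" using power_mono[OF w[of u], of 2] by simp
      then show "norm ((w u)\<^sup>2 * p u) \<le> norm (B\<^sup>2 * p u)"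
        using p(2)[of u] by (simp add: abs_mult mult_right_mono)
    qed
  qed measurable
  define m where "m = (\<integral>u. w u * p u \<partial>M)"
  \<comment> \<open>The variance of \<open>w\<close> under \<open>p\<close> is nonnegative.\<close>
  have "0 \<le> (\<integral>u. (w u - m)\<^sup>2 * p u \<partial>M)" using p(2) by (intro integral_nonneg_AE) auto
  also have "(\<lambda>u. (w u - m)\<^sup>2 * p u) = (\<lambda>u. (w u)\<^sup>2 * p u - 2 * m * (w u * p u) + m\<^sup>2 * p u)"
    by (simp add: fun_eq_iff power2_diff algebra_simps)
  also have "(\<integral>u. (w u)\<^sup>2 * p u - 2 * m * (w u * p u) + m\<^sup>2 * p u \<partial>M) = (\<integral>u. (w u)\<^sup>2 * p u \<partial>M) - 2 * m * m + m\<^sup>2"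
    using i1 i2 p by (simp add: m_def)
  finally have "m\<^sup>2 \<le> (\<integral>u. (w u)\<^sup>2 * p u \<partial>M)" by (simp add: power2_eq_square)
  then have "ennreal (m\<^sup>2) \<le> ennreal (\<integral>u. (w u)\<^sup>2 * p u \<partial>M)" by (rule ennreal_leI)
  also have "\<dots> = (\<integral>\<^sup>+u. ennreal ((w u)\<^sup>2 * p u) \<partial>M)"
    using p(2) by (intro nn_integral_eq_integral[symmetric] i2) auto
  finally show "ennreal ((\<integral>u. w u * p u \<partial>M)\<^sup>2) \<le> (\<integral>\<^sup>+u. ennreal ((w u)\<^sup>2 * p u) \<partial>M)" by (simp add: m_def)
  have "\<bar>m\<bar> \<le> (\<integral>u. \<bar>w u * p u\<bar> \<partial>M)" unfolding m_def by (rule integral_abs_bound)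
  then have "ennreal \<bar>m\<bar> \<le> ennreal (\<integral>u. \<bar>w u\<bar> * p u \<partial>M)" using p(2) by (intro ennreal_leI) (simp add: abs_mult)
  also have "\<dots> = (\<integral>\<^sup>+u. ennreal (\<bar>w u\<bar> * p u) \<partial>M)"
    using p(2) integrable_abs[OF i1] by (intro nn_integral_eq_integral[symmetric]) (auto simp: abs_mult)
  finally show "ennreal \<bar>\<integral>u. w u * p u \<partial>M\<bar> \<le> (\<integral>\<^sup>+u. ennreal (\<bar>w u\<bar> * p u) \<partial>M)" by (simp add: m_def)
qed

definition mollifier :: "real \<Rightarrow> 'a::euclidean_space \<Rightarrow> real" where
  "mollifier r u = bump r u / bump_mass TYPE('a) r"

lemma
  assumes "0 < r" "r \<le> 1"
  shows integrable_mollifier: "integrable lborel (mollifier r :: 'a::euclidean_space \<Rightarrow> real)"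
    and mollifier_nonneg: "0 \<le> mollifier r (u::'a)"
    and integral_mollifier: "(\<integral>u. mollifier r (u::'a) \<partial>lborel) = 1"
    and mollifier_eq_0: "r \<le> norm (u::'a) \<Longrightarrow> mollifier r u = 0"
  using integrable_bump[OF assms, where 'a='a] bump_mass_pos[OF assms, where 'a='a] bump_eq_0[OF assms(1), of u]
  by (auto simp: mollifier_def[abs_def] bump_mass_def)

lemma measurable_mollifier [measurable]: "mollifier r \<in> borel_measurable borel"
  unfolding mollifier_def[abs_def]
  by (intro borel_measurable_divide borel_measurable_const borel_measurable_continuous_onI continuous_bump)

lemma nn_integral_mollifier:
  assumes "0 < r" "r \<le> 1"
  shows "(\<integral>\<^sup>+u. ennreal (mollifier r (u::'a::euclidean_space)) \<partial>lborel) = 1"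
  using nn_integral_eq_integral[OF integrable_mollifier[OF assms, where 'a='a]] mollifier_nonneg[OF assms, where 'a='a]
  by (simp add: integral_mollifier[OF assms])

lemma mollify_eq: "mollify r f x = (\<integral>u. f (x + u) * mollifier r u \<partial>lborel)"
  by (simp add: mollify_def mollifier_def)

lemma integrable_mult_mollifier:
  fixes f :: "'a::euclidean_space \<Rightarrow> real"
  assumes "f \<in> borel_measurable borel" "\<And>x. \<bar>f x\<bar> \<le> M" "0 < r" "r \<le> 1"
  shows "integrable lborel (\<lambda>u. f (x + u) * mollifier r u)"
  using integrable_mult_bounded[OF integrable_mollifier[OF assms(3,4)], of "\<lambda>u. f (x + u)" M] assms(1,2)
  by (simp add: mult.commute)

context
  fixes f :: "'a::euclidean_space \<Rightarrow> real" and M r :: real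
  assumes f [measurable]: "f \<in> borel_measurable borel" and M: "\<And>x. \<bar>f x\<bar> \<le> M" and r: "0 < r" "r \<le> 1"
begin

lemma mollify_bound: "\<bar>mollify r f x\<bar> \<le> M"
proof -
  have "\<bar>mollify r f x\<bar> \<le> (\<integral>u. M * mollifier r (u::'a) \<partial>lborel)"
    unfolding mollify_eq
  proof (rule integral_abs_bound_integral)
    show "\<bar>f (x + u) * mollifier r u\<bar> \<le> M * mollifier r u" for u
      using M[of "x + u"] mollifier_nonneg[OF r, of u] by (simp add: abs_mult mult_right_mono)
  qed (use integrable_mult_mollifier[OF f M r] integrable_mollifier[OF r] in auto)
  then show ?thesis by (simp add: integral_mollifier[OF r])
qed

text \<open>The increment of an average of translates is the average of their increments, to which
  Jensen's inequality applies.\<close>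

lemma mollify_diff_square_le:
  "ennreal ((mollify r f y - mollify r f x)\<^sup>2) \<le> (\<integral>\<^sup>+u. ennreal ((f (y + u) - f (x + u))\<^sup>2 * mollifier r u) \<partial>lborel)"
proof -
  have "mollify r f y - mollify r f x = (\<integral>u. (f (y + u) - f (x + u)) * mollifier r u \<partial>lborel)"
    unfolding mollify_eq left_diff_distrib
    by (rule Bochner_Integration.integral_diff[symmetric]) (intro integrable_mult_mollifier[OF f M r])+
  moreover have "\<bar>f (y + u) - f (x + u)\<bar> \<le> 2 * M" for u
    using M[of "y + u"] M[of "x + u"] by linarith
  ultimately show ?thesis
    using square_integral_le(1)[where w="\<lambda>u. f (y + u) - f (x + u)" and M=lborel and p="mollifier r" and B="2 * M",
        OF _ integrable_mollifier[OF r] mollifier_nonneg[OF r] integral_mollifier[OF r]] by simp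
qed

lemma mollify_diff_abs_le:
  "ennreal \<bar>mollify r f x - f x\<bar> \<le> (\<integral>\<^sup>+u. ennreal (\<bar>f (x + u) - f x\<bar> * mollifier r u) \<partial>lborel)"
proof -
  have "mollify r f x - f x = (\<integral>u. (f (x + u) - f x) * mollifier r u \<partial>lborel)"
    unfolding mollify_eq left_diff_distrib
    by (subst Bochner_Integration.integral_diff)
       (simp_all add: integrable_mult_mollifier[OF f M r] integrable_mollifier[OF r] integral_mollifier[OF r])
  moreover have "\<bar>f (x + u) - f x\<bar> \<le> 2 * M" for u
    using M[of "x + u"] M[of "x"] by linarith
  ultimately show ?thesis
    using square_integral_le(2)[where w="\<lambda>u. f (x + u) - f x" and M=lborel and p="mollifier r" and B="2 * M",
        OF _ integrable_mollifier[OF r] mollifier_nonneg[OF r] integral_mollifier[OF r]] by simp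
qed

text \<open>Shifting both points by the same vector preserves their difference and hence the kernel,
  so every translate of \<open>f\<close> has the energy of \<open>f\<close>. Jensen's inequality and
  Tonelli then average this energy with total weight 1.\<close>

lemma Ealpha_mollify_le: "Ealpha \<alpha> (mollify r f) \<le> Ealpha \<alpha> f"
proof -
  define H where "H z = ennreal ((f (snd z) - f (fst z))\<^sup>2 * riesz_kernel \<alpha> (fst z - snd z))" for z :: "'a \<times> 'a"
  have [measurable]: "H \<in> borel_measurable borel"
    unfolding H_def borel_prod[symmetric] by measurable
  have E: "Ealpha \<alpha> f = (\<integral>\<^sup>+z. H z \<partial>lborel)" by (simp add: Ealpha_eq H_def lborel_prod)
  have "Ealpha \<alpha> (mollify r f) \<le> (\<integral>\<^sup>+z. \<integral>\<^sup>+u. ennreal (mollifier r u) * H (z + (u, u)) \<partial>lborel \<partial>lborel)"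
    unfolding Ealpha_eq lborel_prod
  proof (rule nn_integral_mono)
    fix z :: "'a \<times> 'a"
    obtain x y where z: "z = (x, y)" by (cases z)
    have "ennreal ((mollify r f y - mollify r f x)\<^sup>2 * riesz_kernel \<alpha> (x - y))
      = ennreal ((mollify r f y - mollify r f x)\<^sup>2) * ennreal (riesz_kernel \<alpha> (x - y))" by (simp add: ennreal_mult)
    also have "\<dots> \<le> (\<integral>\<^sup>+u. ennreal ((f (y + u) - f (x + u))\<^sup>2 * mollifier r u) \<partial>lborel) * ennreal (riesz_kernel \<alpha> (x - y))"
      by (intro mult_right_mono mollify_diff_square_le) auto
    also have "\<dots> = (\<integral>\<^sup>+u. ennreal ((f (y + u) - f (x + u))\<^sup>2 * mollifier r u) * ennreal (riesz_kernel \<alpha> (x - y)) \<partial>lborel)"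
      by (rule nn_integral_multc[symmetric]) measurable
    also have "\<dots> = (\<integral>\<^sup>+u. ennreal (mollifier r u) * H (z + (u, u)) \<partial>lborel)"
      by (intro nn_integral_cong) (simp add: H_def z ennreal_mult mollifier_nonneg[OF r] mult_ac)
    finally show "ennreal ((mollify r f (snd z) - mollify r f (fst z))\<^sup>2 * riesz_kernel \<alpha> (fst z - snd z))
      \<le> (\<integral>\<^sup>+u. ennreal (mollifier r u) * H (z + (u, u)) \<partial>lborel)" by (simp add: z)
  qed
  also have "\<dots> = (\<integral>\<^sup>+u. \<integral>\<^sup>+z. ennreal (mollifier r u) * H (z + (u, u)) \<partial>lborel \<partial>lborel)"
    by (rule lborel_pair.Fubini'[symmetric]) measurable
  also have "\<dots> = (\<integral>\<^sup>+u. ennreal (mollifier r (u::'a)) * Ealpha \<alpha> f \<partial>lborel)"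
  proof (rule nn_integral_cong)
    fix u :: 'a
    have "(\<integral>\<^sup>+z. ennreal (mollifier r u) * H (z + (u, u)) \<partial>lborel) = ennreal (mollifier r u) * (\<integral>\<^sup>+z. H (z + (u, u)) \<partial>lborel)"
      by (rule nn_integral_cmult) measurable
    also have "(\<integral>\<^sup>+z. H (z + (u, u)) \<partial>lborel) = Ealpha \<alpha> f"
    proof -
      \<comment> \<open>The shift is a translation of the product space by a diagonal vector; that
        space is itself Euclidean, so \<open>nn_integral_translate\<close> applies to it.\<close>
      have "z + (u, u) = z - (- u, - u)" for z :: "'a \<times> 'a" by (cases z) simp
      then show ?thesis using nn_integral_translate[of H "(- u, - u)"] by (simp only: E) simp
    qed
    finally show "(\<integral>\<^sup>+z. ennreal (mollifier r u) * H (z + (u, u)) \<partial>lborel) = ennreal (mollifier r u) * Ealpha \<alpha> f" .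
  qed
  also have "\<dots> = Ealpha \<alpha> f"
    by (simp add: nn_integral_multc nn_integral_mollifier[OF r])
  finally show ?thesis .
qed

text \<open>Minkowski's integral inequality in L^1: the error is at most a weighted average of the
  errors of translation, and the weight lives on shifts of norm at most \<open>r\<close>.\<close>

lemma mollify_L1_le:
  assumes "\<And>u. norm u \<le> r \<Longrightarrow> (\<integral>\<^sup>+x. ennreal \<bar>f (x + u) - f x\<bar> \<partial>lborel) \<le> e"
  shows "(\<integral>\<^sup>+x. ennreal \<bar>mollify r f x - f x\<bar> \<partial>lborel) \<le> e"
proof -
  have "(\<integral>\<^sup>+x. ennreal \<bar>mollify r f x - f x\<bar> \<partial>lborel) \<le> (\<integral>\<^sup>+x. \<integral>\<^sup>+u. ennreal (\<bar>f (x + u) - f x\<bar> * mollifier r u) \<partial>lborel \<partial>lborel)"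
    by (intro nn_integral_mono mollify_diff_abs_le)
  also have "\<dots> = (\<integral>\<^sup>+u. \<integral>\<^sup>+x. ennreal (\<bar>f (x + u) - f x\<bar> * mollifier r u) \<partial>lborel \<partial>lborel)"
    by (rule lborel_pair.Fubini'[symmetric]) measurable
  also have "\<dots> \<le> (\<integral>\<^sup>+u. e * ennreal (mollifier r (u::'a)) \<partial>lborel)"
  proof (rule nn_integral_mono)
    fix u :: 'a
    have "(\<integral>\<^sup>+x. ennreal (\<bar>f (x + u) - f x\<bar> * mollifier r u) \<partial>lborel) = (\<integral>\<^sup>+x. ennreal \<bar>f (x + u) - f x\<bar> \<partial>lborel) * ennreal (mollifier r u)"
      by (simp add: ennreal_mult mollifier_nonneg[OF r] nn_integral_multc)
    also have "\<dots> \<le> e * ennreal (mollifier r u)"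
    proof (cases "norm u \<le> r")
      case True then show ?thesis by (intro mult_right_mono assms) auto
    next
      case False then show ?thesis using mollifier_eq_0[OF r, of u] by simp
    qed
    finally show "(\<integral>\<^sup>+x. ennreal (\<bar>f (x + u) - f x\<bar> * mollifier r u) \<partial>lborel) \<le> e * ennreal (mollifier r u)" .
  qed
  also have "\<dots> = e" by (simp add: nn_integral_cmult nn_integral_mollifier[OF r])
  finally show ?thesis .
qed

end

lemma mollify_support:
  fixes f :: "'a::euclidean_space \<Rightarrow> real"
  assumes "0 < r" "r \<le> 1" "\<And>x. norm x > R \<Longrightarrow> f x = 0" "norm x > R + 1"
  shows "mollify r f x = 0"
proof -
  have "f (x + u) * mollifier r u = 0" for u
  proof (cases "norm u < r")
    case True
    then have "norm (x + u) > R" using assms norm_diff_ineq[of x u] by linarith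
    then show ?thesis using assms(3) by simp
  qed (simp add: mollifier_eq_0 assms)
  then show ?thesis unfolding mollify_eq by (intro integral_eq_zero_AE AE_I2)
qed

text \<open>L^1 convergence of the mollifications serves to extract an almost everywhere convergent
  subsequence. Its energy converges because mollifying does not increase \<open>Ealpha\<close>, and
  its squares converge by domination on a fixed ball.\<close>

lemma bounded_support_approx:
  fixes f :: "'a::euclidean_space \<Rightarrow> real"
  assumes f [measurable]: "f \<in> borel_measurable borel" and M: "\<And>x. \<bar>f x\<bar> \<le> M" and R: "\<And>x. norm x > R \<Longrightarrow> f x = 0"
    and E: "Ealpha \<alpha> f < \<infinity>"
  obtains g where "\<And>m. C1c (g m)" "(\<lambda>m::nat. Ealpha \<alpha> (\<lambda>x. g m x - f x)) \<longlonglongrightarrow> 0"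
    "(\<lambda>m. \<integral>\<^sup>+x. ennreal ((g m x - f x)\<^sup>2) \<partial>lborel) \<longlonglongrightarrow> 0"
proof -
  define r where "r m = 1 / real (Suc m)" for m
  have r: "0 < r m" "r m \<le> 1" for m by (auto simp: r_def divide_le_eq)
  have r0: "r \<longlonglongrightarrow> 0" unfolding r_def[abs_def] by (rule LIMSEQ_Suc[OF lim_1_over_n])
  define h where "h m = mollify (r m) f" for m
  have hC: "C1c (h m)" for m unfolding h_def by (rule C1c_mollify[OF f M R r])
  have [measurable]: "h m \<in> borel_measurable borel" for m by (rule C1c_measurable[OF hC])
  have hM: "\<bar>h m x\<bar> \<le> M" for m x unfolding h_def by (rule mollify_bound[OF f M r])
  have hR: "h m x = 0" if "norm x > R + 1" for m x unfolding h_def by (rule mollify_support[OF r R that])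
  have int: "integrable lborel (\<lambda>x. h m x - f x)" for m
  proof (rule integrable_bounded_support)
    show "\<bar>h m x - f x\<bar> \<le> 2 * M" for x using hM[of m x] M[of x] by linarith
    show "h m x - f x = 0" if "norm x > R + 1" for x using hR[OF that] R[of x] that by simp
  qed measurable
  have "(\<lambda>m. \<integral>\<^sup>+x. ennreal \<bar>h m x - f x\<bar> \<partial>lborel) \<longlonglongrightarrow> 0"
  proof (rule order_tendstoI)
    fix a :: ennreal assume "0 < a"
    then obtain e where e0: "0 < e" and e: "ennreal e < a"
    proof (cases a)
      case (real r)
      then show ?thesis using \<open>0 < a\<close> by (intro that[of "r / 2"]) (auto simp: ennreal_less_iff)
    qed (auto intro: that[of 1])
    obtain d where d: "d > 0" "\<And>u. norm u \<le> d \<Longrightarrow> (\<integral>\<^sup>+x. ennreal \<bar>f (x + u) - f x\<bar> \<partial>lborel) \<le> ennreal e"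
      using L1_translation_continuous[OF f M R e0] by blast
    have "\<forall>\<^sub>F m in sequentially. r m < d" by (rule order_tendstoD(2)[OF r0 d(1)])
    then show "\<forall>\<^sub>F m in sequentially. (\<integral>\<^sup>+x. ennreal \<bar>h m x - f x\<bar> \<partial>lborel) < a"
    proof eventually_elim
      case (elim m)
      have "(\<integral>\<^sup>+x. ennreal \<bar>h m x - f x\<bar> \<partial>lborel) \<le> ennreal e"
        unfolding h_def by (rule mollify_L1_le[OF f M r]) (use elim d(2) in auto)
      then show ?case using e by simp
    qed
  qed simp
  moreover have "(\<integral>\<^sup>+x. ennreal \<bar>h m x - f x\<bar> \<partial>lborel) = ennreal (\<integral>x. norm (h m x - f x) \<partial>lborel)" for m
    using int by (subst nn_integral_eq_integral) auto
  ultimately have "(\<lambda>m. \<integral>x. norm (h m x - f x) \<partial>lborel) \<longlonglongrightarrow> 0"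
    by (simp add: ennreal_tendsto_0_iff)
  from tendsto_L1_AE_subseq[of lborel "\<lambda>m x. h m x - f x", OF int this]
  obtain s where s: "strict_mono s" "AE x in lborel. (\<lambda>n. h (s n) x - f x) \<longlonglongrightarrow> 0" by blast
  have AE: "AE x in lborel. (\<lambda>n. h (s n) x) \<longlonglongrightarrow> f x"
    using s(2) by eventually_elim (rule LIM_zero_cancel)
  have "(\<lambda>n. Ealpha \<alpha> (\<lambda>x. h (s n) x - f x)) \<longlonglongrightarrow> 0"
  proof -
    have "(\<lambda>n. \<integral>\<^sup>+z. ennreal ((h (s n) (snd z) - h (s n) (fst z) - (f (snd z) - f (fst z)))\<^sup>2 * riesz_kernel \<alpha> (fst z - snd z)) \<partial>(lborel \<Otimes>\<^sub>M lborel)) \<longlonglongrightarrow> 0"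
    \<comment> \<open>The lemma is used on the product space, with increments as functions and the
      Riesz kernel as weight.\<close>
    proof (rule square_diff_tendsto_0)
      show "AE z in lborel \<Otimes>\<^sub>M lborel. (\<lambda>n. h (s n) (snd z) - h (s n) (fst z)) \<longlonglongrightarrow> f (snd z) - f (fst z)"
        using AE_lborel_pair[OF AE] by eventually_elim (auto intro: tendsto_diff)
      show "(\<integral>\<^sup>+z. ennreal ((h (s n) (snd z) - h (s n) (fst z))\<^sup>2 * riesz_kernel \<alpha> (fst z - snd z)) \<partial>(lborel \<Otimes>\<^sub>M lborel))
        \<le> (\<integral>\<^sup>+z. ennreal ((f (snd z) - f (fst z))\<^sup>2 * riesz_kernel \<alpha> (fst z - snd z)) \<partial>(lborel \<Otimes>\<^sub>M lborel))" for n
        using Ealpha_mollify_le[OF f M r, of \<alpha> "s n"] unfolding h_def Ealpha_eq .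
      show "(\<integral>\<^sup>+z. ennreal ((f (snd z) - f (fst z))\<^sup>2 * riesz_kernel \<alpha> (fst z - snd z)) \<partial>(lborel \<Otimes>\<^sub>M lborel)) < \<infinity>"
        using E unfolding Ealpha_eq .
      show "(\<lambda>z. h (s n) (snd z) - h (s n) (fst z)) \<in> borel_measurable (lborel \<Otimes>\<^sub>M lborel)" for n
        by measurable
      show "(\<lambda>z. f (snd z) - f (fst z)) \<in> borel_measurable (lborel \<Otimes>\<^sub>M lborel)"
        by measurable
      show "(\<lambda>z. riesz_kernel \<alpha> (fst z - snd z :: 'a)) \<in> borel_measurable (lborel \<Otimes>\<^sub>M lborel)"
        by measurable
    qed simp
    then show ?thesis unfolding Ealpha_eq by (simp add: algebra_simps)
  qed
  moreover have "(\<lambda>n. \<integral>\<^sup>+x. ennreal ((h (s n) x - f x)\<^sup>2) \<partial>lborel) \<longlonglongrightarrow> (\<integral>\<^sup>+x. 0 \<partial>(lborel :: 'a measure))"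
  proof (rule nn_integral_dominated_convergence[where w="\<lambda>x. ennreal (4 * M\<^sup>2) * indicator (cball 0 (R + 1)) x"])
    show "AE x in lborel. ennreal ((h (s n) x - f x)\<^sup>2) \<le> ennreal (4 * M\<^sup>2) * indicator (cball 0 (R + 1)) x" for n
    proof (rule AE_I2)
      fix x :: 'a
      have "\<bar>h (s n) x - f x\<bar> \<le> 2 * M" using hM[of "s n" x] M[of x] by linarith
      from power_mono[OF this, of 2] have "(h (s n) x - f x)\<^sup>2 \<le> 4 * M\<^sup>2" by (simp add: power_mult_distrib)
      then show "ennreal ((h (s n) x - f x)\<^sup>2) \<le> ennreal (4 * M\<^sup>2) * indicator (cball 0 (R + 1)) x"
        using hR[of x "s n"] R[of x] by (cases "norm x \<le> R + 1") (auto intro!: ennreal_leI)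
    qed
    show "AE x in lborel. (\<lambda>n. ennreal ((h (s n) x - f x)\<^sup>2)) \<longlonglongrightarrow> 0"
      using AE
    proof eventually_elim
      case (elim x)
      have "(\<lambda>n. (h (s n) x - f x)\<^sup>2) \<longlonglongrightarrow> (f x - f x)\<^sup>2" by (intro tendsto_intros elim)
      from tendsto_ennrealI[OF this] show ?case by simp
    qed
    show "(\<integral>\<^sup>+x. ennreal (4 * M\<^sup>2) * indicator (cball (0::'a) (R + 1)) x \<partial>lborel) < \<infinity>"
      by (rule nn_integral_indicator_cball_finite)
  qed (auto intro!: borel_measurable_times_ennreal borel_measurable_indicator)
  ultimately show thesis using that[of "\<lambda>n. h (s n)"] hC by simp
qed


section \<open>The domain\<close>

text \<open>A quasi-triangle inequality for squared seminorms, at the price of a factor 2. The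
  weight is left general so that \<open>Ealpha\<close> and \<open>Eform\<close> are both
  instances.\<close>

lemma energy_add_le:
  fixes f g :: "'a::euclidean_space \<Rightarrow> real"
  assumes [measurable]: "f \<in> borel_measurable borel" "g \<in> borel_measurable borel" "W \<in> borel_measurable (lborel \<Otimes>\<^sub>M lborel)"
    and W: "\<And>z. 0 \<le> W z"
  shows "(\<integral>\<^sup>+z. ennreal (((f (snd z) + g (snd z)) - (f (fst z) + g (fst z)))\<^sup>2 * W z) \<partial>(lborel \<Otimes>\<^sub>M lborel))
    \<le> 2 * (\<integral>\<^sup>+z. ennreal ((f (snd z) - f (fst z))\<^sup>2 * W z) \<partial>(lborel \<Otimes>\<^sub>M lborel))
     + 2 * (\<integral>\<^sup>+z. ennreal ((g (snd z) - g (fst z))\<^sup>2 * W z) \<partial>(lborel \<Otimes>\<^sub>M lborel))"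
proof -
  have "(\<integral>\<^sup>+z. ennreal (((f (snd z) + g (snd z)) - (f (fst z) + g (fst z)))\<^sup>2 * W z) \<partial>(lborel \<Otimes>\<^sub>M lborel))
    \<le> (\<integral>\<^sup>+z. 2 * ennreal ((f (snd z) - f (fst z))\<^sup>2 * W z) + 2 * ennreal ((g (snd z) - g (fst z))\<^sup>2 * W z) \<partial>(lborel \<Otimes>\<^sub>M lborel))"
  proof (rule nn_integral_mono)
    fix z :: "'a \<times> 'a"
    define a where "a = f (snd z) - f (fst z)"
    define b where "b = g (snd z) - g (fst z)"
    have "(a + b)\<^sup>2 * W z \<le> (2 * a\<^sup>2 + 2 * b\<^sup>2) * W z"
      by (intro mult_right_mono square_diff_bounds W)
    then have "ennreal ((a + b)\<^sup>2 * W z) \<le> ennreal (2 * (a\<^sup>2 * W z) + 2 * (b\<^sup>2 * W z))"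
      by (intro ennreal_leI) (simp add: algebra_simps)
    also have "\<dots> = 2 * ennreal (a\<^sup>2 * W z) + 2 * ennreal (b\<^sup>2 * W z)"
      using W[of z] by (simp add: ennreal_plus ennreal_mult')
    finally show "ennreal (((f (snd z) + g (snd z)) - (f (fst z) + g (fst z)))\<^sup>2 * W z)
      \<le> 2 * ennreal ((f (snd z) - f (fst z))\<^sup>2 * W z) + 2 * ennreal ((g (snd z) - g (fst z))\<^sup>2 * W z)"
      by (simp add: a_def b_def algebra_simps)
  qed
  also have "\<dots> = 2 * (\<integral>\<^sup>+z. ennreal ((f (snd z) - f (fst z))\<^sup>2 * W z) \<partial>(lborel \<Otimes>\<^sub>M lborel))
     + 2 * (\<integral>\<^sup>+z. ennreal ((g (snd z) - g (fst z))\<^sup>2 * W z) \<partial>(lborel \<Otimes>\<^sub>M lborel))"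
    by (subst nn_integral_add) (auto simp: nn_integral_cmult)
  finally show ?thesis .
qed

lemma Ealpha_add_le:
  fixes f g :: "'a::euclidean_space \<Rightarrow> real"
  assumes "f \<in> borel_measurable borel" "g \<in> borel_measurable borel"
  shows "Ealpha \<alpha> (\<lambda>x. f x + g x) \<le> 2 * Ealpha \<alpha> f + 2 * Ealpha \<alpha> g"
  unfolding Ealpha_eq by (rule energy_add_le[OF assms]) auto

lemma Eform_add_le:
  fixes f g :: "'a::euclidean_space \<Rightarrow> real"
  assumes "f \<in> borel_measurable borel" "g \<in> borel_measurable borel"
    and [measurable]: "(\<lambda>z. k (fst z) (snd z)) \<in> borel_measurable (lborel \<Otimes>\<^sub>M lborel)" and k: "\<And>x y. k x y \<ge> 0"
  shows "Eform k (\<lambda>x. f x + g x) \<le> 2 * Eform k f + 2 * Eform k g"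
proof -
  define W where "W z = indicator {z. fst z \<noteq> snd z} z * k (fst z) (snd z)" for z :: "'a \<times> 'a"
  have E: "Eform k f = ennreal (1/2) * (\<integral>\<^sup>+z. ennreal ((f (snd z) - f (fst z))\<^sup>2 * W z) \<partial>(lborel \<Otimes>\<^sub>M lborel))" for f
    unfolding Eform_def W_def by (intro arg_cong2[where f="(*)"] nn_integral_cong) (auto simp: indicator_def)
  have "{z::'a \<times> 'a. fst z \<noteq> snd z} \<in> sets borel"
    by (intro borel_open open_Collect_neq continuous_intros)
  then have [measurable]: "{z::'a \<times> 'a. fst z \<noteq> snd z} \<in> sets (lborel \<Otimes>\<^sub>M lborel)"
    unfolding lborel_prod sets_lborel .
  have "W \<in> borel_measurable (lborel \<Otimes>\<^sub>M lborel)" unfolding W_def by measurable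
  from energy_add_le[OF assms(1,2) this] show ?thesis
    using k unfolding E mult.left_commute[of 2] distrib_left[symmetric]
    by (intro mult_left_mono) (auto simp: W_def)
qed

lemma Ealpha_minus_commute: "Ealpha \<alpha> (\<lambda>x. f x - g x) = Ealpha \<alpha> (\<lambda>x. g x - f x)"
proof -
  have "((f y - g y) - (f x - g x))\<^sup>2 = ((g y - f y) - (g x - f x))\<^sup>2" for x y
    by (simp add: power2_eq_square algebra_simps)
  then show ?thesis by (simp add: Ealpha_def)
qed

lemma Eform_minus_commute: "Eform k (\<lambda>x. f x - g x) = Eform k (\<lambda>x. g x - f x)"
proof -
  have "((f y - g y) - (f x - g x))\<^sup>2 = ((g y - f y) - (g x - f x))\<^sup>2" for x y
    by (simp add: power2_eq_square algebra_simps)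
  then show ?thesis by (simp add: Eform_def)
qed

lemma nn_integral_square_add_le:
  fixes f g :: "'a \<Rightarrow> real"
  assumes [measurable]: "f \<in> borel_measurable M" "g \<in> borel_measurable M"
  shows "(\<integral>\<^sup>+x. ennreal ((f x + g x)\<^sup>2) \<partial>M) \<le> 2 * (\<integral>\<^sup>+x. ennreal ((f x)\<^sup>2) \<partial>M) + 2 * (\<integral>\<^sup>+x. ennreal ((g x)\<^sup>2) \<partial>M)"
proof -
  have "(\<integral>\<^sup>+x. ennreal ((f x + g x)\<^sup>2) \<partial>M) \<le> (\<integral>\<^sup>+x. 2 * ennreal ((f x)\<^sup>2) + 2 * ennreal ((g x)\<^sup>2) \<partial>M)"
  proof (rule nn_integral_mono)
    fix x
    have "ennreal ((f x + g x)\<^sup>2) \<le> ennreal (2 * (f x)\<^sup>2 + 2 * (g x)\<^sup>2)"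
      by (intro ennreal_leI square_diff_bounds)
    then show "ennreal ((f x + g x)\<^sup>2) \<le> 2 * ennreal ((f x)\<^sup>2) + 2 * ennreal ((g x)\<^sup>2)"
      by (simp add: ennreal_plus ennreal_mult')
  qed
  then show ?thesis by (simp add: nn_integral_add nn_integral_cmult)
qed

text \<open>Stated for measurable \<open>f\<close>, because it is also applied to f - g with f
  merely in the Sobolev space.\<close>

lemma Eform_le_Ealpha:
  fixes f :: "'a::euclidean_space \<Rightarrow> real"
  assumes [measurable]: "f \<in> borel_measurable borel" and \<Lambda>: "\<Lambda>1 > 0"
    and up: "AE z in lborel \<Otimes>\<^sub>M lborel. fst z \<noteq> snd z \<longrightarrow>
           k (fst z) (snd z) \<le> \<Lambda>1 * riesz_kernel \<alpha> (fst z - snd z)"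
  shows "Eform k f \<le> ennreal (\<Lambda>1 / 2) * Ealpha \<alpha> f"
proof -
  have "(\<integral>\<^sup>+ z. indicator {z. fst z \<noteq> snd z} z * ennreal ((f (snd z) - f (fst z))\<^sup>2 * k (fst z) (snd z)) \<partial>(lborel \<Otimes>\<^sub>M lborel))
    \<le> (\<integral>\<^sup>+ z. ennreal \<Lambda>1 * ennreal ((f (snd z) - f (fst z))\<^sup>2 * riesz_kernel \<alpha> (fst z - snd z)) \<partial>(lborel \<Otimes>\<^sub>M lborel))"
  proof (intro nn_integral_mono_AE, use up in eventually_elim)
    case (elim z)
    show ?case
    proof (cases "fst z = snd z")
      case False
      then have "(f (snd z) - f (fst z))\<^sup>2 * k (fst z) (snd z) \<le> (f (snd z) - f (fst z))\<^sup>2 * (\<Lambda>1 * riesz_kernel \<alpha> (fst z - snd z))"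
        using elim by (intro mult_left_mono) auto
      then show ?thesis
        using \<Lambda> by (simp add: False ennreal_mult'[symmetric] ennreal_leI mult.left_commute)
    qed simp
  qed
  also have "\<dots> = ennreal \<Lambda>1 * Ealpha \<alpha> f"
    unfolding Ealpha_eq by (rule nn_integral_cmult) measurable
  finally have "Eform k f \<le> ennreal (1 / 2) * (ennreal \<Lambda>1 * Ealpha \<alpha> f)"
    unfolding Eform_def by (rule mult_left_mono) simp
  also have "\<dots> = ennreal (\<Lambda>1 / 2) * Ealpha \<alpha> f"
    using \<Lambda> ennreal_mult[of "1/2" \<Lambda>1] by (simp add: mult.assoc[symmetric])
  finally show ?thesis .
qed

section \<open>Truncation of values and support\<close>

definition truncation :: "nat \<Rightarrow> ('a::euclidean_space \<Rightarrow> real) \<Rightarrow> 'a \<Rightarrow> real" where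
  "truncation m f x = clamp_abs (real m) (f x) * cutoff (real m) x"

lemma truncation_eq: "\<bar>f x\<bar> \<le> real m \<Longrightarrow> norm x \<le> real m \<Longrightarrow> truncation m f x = f x"
  by (simp add: truncation_def clamp_abs_id cutoff_eq_1)

lemma truncation_bound: "\<bar>truncation m f x\<bar> \<le> real m"
proof -
  have "\<bar>clamp_abs (real m) (f x)\<bar> * \<bar>cutoff (real m) x\<bar> \<le> real m * 1"
    by (intro mult_mono) (simp_all add: clamp_abs_bound cutoff_bounds)
  then show ?thesis by (simp add: truncation_def abs_mult)
qed

lemma truncation_abs_le: "\<bar>truncation m f x\<bar> \<le> \<bar>f x\<bar>"
proof -
  have "\<bar>clamp_abs (real m) (f x)\<bar> * \<bar>cutoff (real m) x\<bar> \<le> \<bar>f x\<bar> * 1"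
    by (intro mult_mono) (simp_all add: clamp_abs_le cutoff_bounds)
  then show ?thesis by (simp add: truncation_def abs_mult)
qed

lemma truncation_eventually_eq: "\<forall>\<^sub>F m in sequentially. truncation m f x = f x"
proof -
  obtain n :: nat where n: "max \<bar>f x\<bar> (norm x) \<le> real n" using real_arch_simple by blast
  have "truncation m f x = f x" if "n \<le> m" for m
  proof (rule truncation_eq)
    have "real n \<le> real m" using that by simp
    then show "\<bar>f x\<bar> \<le> real m" "norm x \<le> real m" using n by auto
  qed
  then show ?thesis by (auto simp: eventually_sequentially)
qed

text \<open>The discrete product rule: clamping is 1-Lipschitz and the cutoff lies in [0, 1], which
  gives the first term; the second is the increment of the cutoff times the clamped value.\<close>

lemma truncation_diff_le:
  "\<bar>truncation m f y - truncation m f x\<bar> \<le> \<bar>f y - f x\<bar> + \<bar>f y\<bar> * min 1 (norm (x - y))"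
proof -
  define c where "c = clamp_abs (real m)"
  have "truncation m f y - truncation m f x = (c (f y) - c (f x)) * cutoff (real m) x + c (f y) * (cutoff (real m) y - cutoff (real m) x)"
    by (simp add: truncation_def c_def algebra_simps)
  then have "\<bar>truncation m f y - truncation m f x\<bar> \<le> \<bar>c (f y) - c (f x)\<bar> * \<bar>cutoff (real m) x\<bar> + \<bar>c (f y)\<bar> * \<bar>cutoff (real m) y - cutoff (real m) x\<bar>"
    by (metis abs_mult abs_triangle_ineq)
  also have "\<dots> \<le> \<bar>f y - f x\<bar> * 1 + \<bar>f y\<bar> * min 1 (norm (x - y))"
    using cutoff_bounds[of "real m" x] cutoff_lipschitz[of "real m" y x]
    by (intro add_mono mult_mono) (auto simp: c_def clamp_abs_lipschitz clamp_abs_le norm_minus_commute)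
  finally show ?thesis by simp
qed

lemma measurable_truncation [measurable]:
  assumes "f \<in> borel_measurable borel"
  shows "truncation m f \<in> borel_measurable borel"
proof -
  have [measurable]: "clamp_abs c \<in> borel_measurable borel" "cutoff c \<in> borel_measurable borel" for c
    by (intro borel_measurable_continuous_onI continuous_clamp_abs continuous_cutoff)+
  show ?thesis unfolding truncation_def[abs_def] using assms by measurable
qed

text \<open>The bound is free of \<open>m\<close>, so it provides a majorant. The truncation and
  \<open>f\<close> each contribute one increment of \<open>f\<close>, and 8 is 2 times the square of
  this 2. The last term, times the kernel, is integrable for square-integrable
  \<open>f\<close>.\<close>

lemma truncation_energy_bound:
  fixes f :: "'a::euclidean_space \<Rightarrow> real"
  shows "((truncation m f y - f y) - (truncation m f x - f x))\<^sup>2 \<le> 8 * (f y - f x)\<^sup>2 + 2 * (f y)\<^sup>2 * min 1 ((norm (x - y))\<^sup>2)"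
proof -
  have "\<bar>(truncation m f y - f y) - (truncation m f x - f x)\<bar> \<le> 2 * \<bar>f y - f x\<bar> + \<bar>f y\<bar> * min 1 (norm (x - y))"
  proof -
    have "\<bar>(truncation m f y - f y) - (truncation m f x - f x)\<bar> = \<bar>(truncation m f y - truncation m f x) - (f y - f x)\<bar>"
      by (simp add: algebra_simps)
    also have "\<dots> \<le> \<bar>truncation m f y - truncation m f x\<bar> + \<bar>f y - f x\<bar>"
      by (rule abs_triangle_ineq4)
    finally show ?thesis using truncation_diff_le[of m f y x] by simp
  qed
  from power_mono[OF this, of 2] have "((truncation m f y - f y) - (truncation m f x - f x))\<^sup>2 \<le> (2 * \<bar>f y - f x\<bar> + \<bar>f y\<bar> * min 1 (norm (x - y)))\<^sup>2"
    by simp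
  also have "\<dots> \<le> 2 * (2 * \<bar>f y - f x\<bar>)\<^sup>2 + 2 * (\<bar>f y\<bar> * min 1 (norm (x - y)))\<^sup>2"
    by (rule square_diff_bounds)
  also have "(min 1 (norm (x - y)))\<^sup>2 = min 1 ((norm (x - y))\<^sup>2)"
  proof (cases "norm (x - y) \<le> 1")
    case True
    then show ?thesis using power_le_one[of "norm (x - y)" 2] by (simp add: min.absorb2)
  next
    case False
    then show ?thesis using one_le_power[of "norm (x - y)" 2] by (simp add: min.absorb1)
  qed
  then have "2 * (2 * \<bar>f y - f x\<bar>)\<^sup>2 + 2 * (\<bar>f y\<bar> * min 1 (norm (x - y)))\<^sup>2 = 8 * (f y - f x)\<^sup>2 + 2 * (f y)\<^sup>2 * min 1 ((norm (x - y))\<^sup>2)"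
    by (simp add: power_mult_distrib)
  finally show ?thesis .
qed

text \<open>Dominated convergence; pointwise the truncations are eventually equal to
  \<open>f\<close>, because one index governs both cuts.\<close>

lemma truncation_tendsto:
  fixes f :: "'a::euclidean_space \<Rightarrow> real"
  assumes \<alpha>: "0 < \<alpha>" "\<alpha> < 2" and f [measurable]: "f \<in> borel_measurable borel"
    and L2: "(\<integral>\<^sup>+x. ennreal ((f x)\<^sup>2) \<partial>lborel) < \<infinity>" and E: "Ealpha \<alpha> f < \<infinity>"
  shows "(\<lambda>m. Ealpha \<alpha> (\<lambda>x. truncation m f x - f x)) \<longlonglongrightarrow> 0"
    and "(\<lambda>m. \<integral>\<^sup>+x. ennreal ((truncation m f x - f x)\<^sup>2) \<partial>lborel) \<longlonglongrightarrow> 0"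
proof -
  \<comment> \<open>Here the localising weight is the square of \<open>f\<close> rather than the
    indicator of a ball.\<close>
  define g where "g x = ennreal (2 * (f x)\<^sup>2)" for x
  have [measurable]: "g \<in> borel_measurable borel" unfolding g_def by measurable
  have g: "(\<integral>\<^sup>+x. g x \<partial>lborel) < \<infinity>"
    using L2 unfolding g_def by (simp add: ennreal_mult' nn_integral_cmult ennreal_mult_less_top)
  have "(\<lambda>m. Ealpha \<alpha> (\<lambda>x. truncation m f x - f x)) \<longlonglongrightarrow> (\<integral>\<^sup>+z. 0 \<partial>((lborel :: 'a measure) \<Otimes>\<^sub>M (lborel :: 'a measure)))"
    unfolding Ealpha_eq
  proof (rule nn_integral_dominated_convergence[where w = "\<lambda>z. 8 * ennreal ((f (snd z) - f (fst z))\<^sup>2 * riesz_kernel \<alpha> (fst z - snd z))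
      + (g (fst z) + g (snd z)) * ennreal (levy_kernel \<alpha> (fst z - snd z))"])
    fix m
    show "AE z in lborel \<Otimes>\<^sub>M lborel. ennreal ((truncation m f (snd z) - f (snd z) - (truncation m f (fst z) - f (fst z)))\<^sup>2 * riesz_kernel \<alpha> (fst z - snd z))
      \<le> 8 * ennreal ((f (snd z) - f (fst z))\<^sup>2 * riesz_kernel \<alpha> (fst z - snd z))
      + (g (fst z) + g (snd z)) * ennreal (levy_kernel \<alpha> (fst z - snd z))"
    proof (rule AE_I2)
      fix z :: "'a \<times> 'a"
      obtain x y where z: "z = (x, y)" by (cases z)
      have "(truncation m f y - f y - (truncation m f x - f x))\<^sup>2 * riesz_kernel \<alpha> (x - y)
        \<le> (8 * (f y - f x)\<^sup>2 + 2 * (f y)\<^sup>2 * min 1 ((norm (x - y))\<^sup>2)) * riesz_kernel \<alpha> (x - y)"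
        by (intro mult_right_mono truncation_energy_bound) auto
      also have "\<dots> = 8 * ((f y - f x)\<^sup>2 * riesz_kernel \<alpha> (x - y)) + 2 * (f y)\<^sup>2 * levy_kernel \<alpha> (x - y)"
        by (simp add: levy_kernel_def algebra_simps)
      finally have "ennreal ((truncation m f y - f y - (truncation m f x - f x))\<^sup>2 * riesz_kernel \<alpha> (x - y))
        \<le> ennreal (8 * ((f y - f x)\<^sup>2 * riesz_kernel \<alpha> (x - y)) + 2 * (f y)\<^sup>2 * levy_kernel \<alpha> (x - y))"
        by (rule ennreal_leI)
      also have "\<dots> = 8 * ennreal ((f y - f x)\<^sup>2 * riesz_kernel \<alpha> (x - y)) + g y * ennreal (levy_kernel \<alpha> (x - y))"
        by (subst ennreal_plus) (auto simp: g_def ennreal_mult')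
      also have "\<dots> \<le> 8 * ennreal ((f y - f x)\<^sup>2 * riesz_kernel \<alpha> (x - y)) + (g x + g y) * ennreal (levy_kernel \<alpha> (x - y))"
        by (intro add_left_mono mult_right_mono) (auto simp: add_increasing)
      finally show "ennreal ((truncation m f (snd z) - f (snd z) - (truncation m f (fst z) - f (fst z)))\<^sup>2 * riesz_kernel \<alpha> (fst z - snd z))
        \<le> 8 * ennreal ((f (snd z) - f (fst z))\<^sup>2 * riesz_kernel \<alpha> (fst z - snd z))
        + (g (fst z) + g (snd z)) * ennreal (levy_kernel \<alpha> (fst z - snd z))" by (simp add: z)
    qed
  next
    show "(\<integral>\<^sup>+z. 8 * ennreal ((f (snd z) - f (fst z))\<^sup>2 * riesz_kernel \<alpha> (fst z - snd z))
      + (g (fst z) + g (snd z)) * ennreal (levy_kernel \<alpha> (fst z - snd z)) \<partial>(lborel \<Otimes>\<^sub>M lborel)) < \<infinity>"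
      using E nn_integral_levy_localised_finite[OF \<alpha> _ g]
      by (subst nn_integral_add) (auto simp: nn_integral_cmult Ealpha_eq ennreal_mult_less_top)
  next
    show "AE z in lborel \<Otimes>\<^sub>M lborel. (\<lambda>m. ennreal ((truncation m f (snd z) - f (snd z) - (truncation m f (fst z) - f (fst z)))\<^sup>2 * riesz_kernel \<alpha> (fst z - snd z))) \<longlonglongrightarrow> 0"
    proof (rule AE_I2)
      fix z :: "'a \<times> 'a"
      show "(\<lambda>m. ennreal ((truncation m f (snd z) - f (snd z) - (truncation m f (fst z) - f (fst z)))\<^sup>2 * riesz_kernel \<alpha> (fst z - snd z))) \<longlonglongrightarrow> 0"
        by (rule tendsto_eventually)
          (use truncation_eventually_eq[of f "fst z"] truncation_eventually_eq[of f "snd z"] in eventually_elim, simp)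
    qed
  qed measurable
  then show "(\<lambda>m. Ealpha \<alpha> (\<lambda>x. truncation m f x - f x)) \<longlonglongrightarrow> 0" by simp
  have "(\<lambda>m. \<integral>\<^sup>+x. ennreal ((truncation m f x - f x)\<^sup>2) \<partial>lborel) \<longlonglongrightarrow> (\<integral>\<^sup>+x. 0 \<partial>(lborel :: 'a measure))"
  proof (rule nn_integral_dominated_convergence[where w="\<lambda>x. 4 * ennreal ((f x)\<^sup>2)"])
    fix m
    show "AE x in lborel. ennreal ((truncation m f x - f x)\<^sup>2) \<le> 4 * ennreal ((f x)\<^sup>2)"
    proof (rule AE_I2)
      fix x
      have "\<bar>truncation m f x - f x\<bar> \<le> 2 * \<bar>f x\<bar>" using truncation_abs_le[of m f x] by linarith
      from power_mono[OF this, of 2] have "(truncation m f x - f x)\<^sup>2 \<le> 4 * (f x)\<^sup>2" by (simp add: power_mult_distrib)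
      from ennreal_leI[OF this] show "ennreal ((truncation m f x - f x)\<^sup>2) \<le> 4 * ennreal ((f x)\<^sup>2)"
        by (simp add: ennreal_mult')
    qed
  next
    show "(\<integral>\<^sup>+x. 4 * ennreal ((f x)\<^sup>2) \<partial>lborel) < \<infinity>"
      using L2 by (simp add: nn_integral_cmult ennreal_mult_less_top)
    show "AE x in lborel. (\<lambda>m. ennreal ((truncation m f x - f x)\<^sup>2)) \<longlonglongrightarrow> 0"
    proof (rule AE_I2)
      fix x
      show "(\<lambda>m. ennreal ((truncation m f x - f x)\<^sup>2)) \<longlonglongrightarrow> 0"
        by (rule tendsto_eventually) (use truncation_eventually_eq[of f x] in eventually_elim, simp)
    qed
  qed measurable
  then show "(\<lambda>m. \<integral>\<^sup>+x. ennreal ((truncation m f x - f x)\<^sup>2) \<partial>lborel) \<longlonglongrightarrow> 0" by simp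
qed

text \<open>Truncation reduces to a bounded function of bounded support, which is then
  mollified.\<close>

lemma C1c_dense:
  fixes f :: "'a::euclidean_space \<Rightarrow> real"
  assumes \<alpha>: "0 < \<alpha>" "\<alpha> < 2" and f [measurable]: "f \<in> borel_measurable borel"
    and L2: "(\<integral>\<^sup>+x. ennreal ((f x)\<^sup>2) \<partial>lborel) < \<infinity>" and E: "Ealpha \<alpha> f < \<infinity>" and e: "e > 0"
  obtains g where "C1c g" "Ealpha \<alpha> (\<lambda>x. f x - g x) \<le> ennreal e" "(\<integral>\<^sup>+x. ennreal ((f x - g x)\<^sup>2) \<partial>lborel) \<le> ennreal e"
proof -
  \<comment> \<open>Each of the two errors is doubled by the quasi-triangle inequality, hence the
    quarter.\<close>
  have e4: "ennreal (e / 4) > 0" using e by simp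
  have sum: "2 * ennreal (e / 4) + 2 * ennreal (e / 4) = ennreal e"
  proof -
    have "2 * ennreal (e / 4) = ennreal (2 * (e / 4))" using e by (subst ennreal_mult) auto
    also have "\<dots> + \<dots> = ennreal (2 * (e / 4) + 2 * (e / 4))" using e by (subst ennreal_plus) auto
    finally show ?thesis by simp
  qed
  have "\<forall>\<^sub>F m in sequentially. Ealpha \<alpha> (\<lambda>x. truncation m f x - f x) < ennreal (e / 4) \<and>
     (\<integral>\<^sup>+x. ennreal ((truncation m f x - f x)\<^sup>2) \<partial>lborel) < ennreal (e / 4)"
    by (intro eventually_conj order_tendstoD(2)[OF truncation_tendsto(1)[OF \<alpha> f L2 E] e4]
      order_tendstoD(2)[OF truncation_tendsto(2)[OF \<alpha> f L2 E] e4])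
  then obtain m where m: "Ealpha \<alpha> (\<lambda>x. truncation m f x - f x) < ennreal (e / 4)"
     "(\<integral>\<^sup>+x. ennreal ((truncation m f x - f x)\<^sup>2) \<partial>lborel) < ennreal (e / 4)"
    by (auto simp: eventually_sequentially)
  define t where "t = truncation m f"
  have [measurable]: "t \<in> borel_measurable borel" unfolding t_def by measurable
  \<comment> \<open>The truncation has finite energy since it differs from \<open>f\<close> by a
    function of small energy; \<open>bounded_support_approx\<close> requires this.\<close>
  have "Ealpha \<alpha> (\<lambda>x. f x + (t x - f x)) \<le> 2 * Ealpha \<alpha> f + 2 * Ealpha \<alpha> (\<lambda>x. t x - f x)"
    by (rule Ealpha_add_le) measurable
  also have "\<dots> < \<infinity>"
    using E m(1) by (auto simp: t_def ennreal_mult_less_top intro: less_trans[OF _ ennreal_less_top])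
  finally have tE: "Ealpha \<alpha> t < \<infinity>" by simp
  have t0: "t x = 0" if "norm x > real m + 1" for x
    using that by (simp add: t_def truncation_def cutoff_eq_0)
  obtain g where g: "\<And>i. C1c (g i)" "(\<lambda>i::nat. Ealpha \<alpha> (\<lambda>x. g i x - t x)) \<longlonglongrightarrow> 0"
    "(\<lambda>i. \<integral>\<^sup>+x. ennreal ((g i x - t x)\<^sup>2) \<partial>lborel) \<longlonglongrightarrow> 0"
  proof (rule bounded_support_approx[OF _ _ t0 tE, where M="real m"])
    show "\<bar>t x\<bar> \<le> real m" for x unfolding t_def by (rule truncation_bound)
  qed (auto intro: that)
  have "\<forall>\<^sub>F i in sequentially. Ealpha \<alpha> (\<lambda>x. g i x - t x) < ennreal (e / 4) \<and>
     (\<integral>\<^sup>+x. ennreal ((g i x - t x)\<^sup>2) \<partial>lborel) < ennreal (e / 4)"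
    by (intro eventually_conj order_tendstoD(2)[OF g(2) e4] order_tendstoD(2)[OF g(3) e4])
  then obtain i where i: "Ealpha \<alpha> (\<lambda>x. g i x - t x) < ennreal (e / 4)"
     "(\<integral>\<^sup>+x. ennreal ((g i x - t x)\<^sup>2) \<partial>lborel) < ennreal (e / 4)"
    by (auto simp: eventually_sequentially)
  have [measurable]: "g i \<in> borel_measurable borel" by (rule C1c_measurable[OF g(1)])
  have "Ealpha \<alpha> (\<lambda>x. f x - g i x) = Ealpha \<alpha> (\<lambda>x. (t x - f x) + (g i x - t x))"
    by (subst Ealpha_minus_commute) (simp add: algebra_simps)
  also have "\<dots> \<le> 2 * Ealpha \<alpha> (\<lambda>x. t x - f x) + 2 * Ealpha \<alpha> (\<lambda>x. g i x - t x)"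
    by (rule Ealpha_add_le) measurable
  also have "\<dots> \<le> 2 * ennreal (e / 4) + 2 * ennreal (e / 4)"
    using m(1) i(1) by (intro add_mono mult_left_mono) (auto simp: t_def)
  finally have 1: "Ealpha \<alpha> (\<lambda>x. f x - g i x) \<le> ennreal e" by (simp only: sum)
  have "(\<integral>\<^sup>+x. ennreal ((f x - g i x)\<^sup>2) \<partial>lborel) = (\<integral>\<^sup>+x. ennreal (((t x - f x) + (g i x - t x))\<^sup>2) \<partial>lborel)"
    by (intro nn_integral_cong) (simp add: power2_commute)
  also have "\<dots> \<le> 2 * (\<integral>\<^sup>+x. ennreal ((t x - f x)\<^sup>2) \<partial>lborel) + 2 * (\<integral>\<^sup>+x. ennreal ((g i x - t x)\<^sup>2) \<partial>lborel)"
    by (rule nn_integral_square_add_le) measurable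
  also have "\<dots> \<le> 2 * ennreal (e / 4) + 2 * ennreal (e / 4)"
    using m(2) i(2) by (intro add_mono mult_left_mono) (auto simp: t_def)
  finally have 2: "(\<integral>\<^sup>+x. ennreal ((f x - g i x)\<^sup>2) \<partial>lborel) \<le> ennreal e" by (simp only: sum)
  from that[OF g(1) 1 2] show thesis .
qed

text \<open>The upper bound on \<open>k\<close> turns approximation in \<open>Ealpha\<close> into
  approximation in \<open>Eform\<close>.\<close>

lemma Hsob_subset_DomE:
  fixes k :: "'a::euclidean_space \<Rightarrow> 'a \<Rightarrow> real"
  assumes \<alpha>: "0 < \<alpha>" "\<alpha> < 2" and \<Lambda>: "\<Lambda>1 > 0"
    and up: "AE z in lborel \<Otimes>\<^sub>M lborel. fst z \<noteq> snd z \<longrightarrow>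
           k (fst z) (snd z) \<le> \<Lambda>1 * riesz_kernel \<alpha> (fst z - snd z)"
  shows "Hsob \<alpha> \<subseteq> DomE k"
proof
  fix f :: "'a \<Rightarrow> real" assume "f \<in> Hsob \<alpha>"
  then have f [measurable]: "f \<in> borel_measurable borel" and int: "integrable lborel (\<lambda>x. (f x)\<^sup>2)" and E: "Ealpha \<alpha> f < \<infinity>"
    by (auto simp: Hsob_def)
  have L2: "(\<integral>\<^sup>+x. ennreal ((f x)\<^sup>2) \<partial>lborel) < \<infinity>"
    using integrableD(2)[OF int] by (simp add: less_top)
  have "\<exists>g. C1c g \<and> Ealpha \<alpha> (\<lambda>x. f x - g x) \<le> ennreal (1 / real (Suc m)) \<and> (\<integral>\<^sup>+x. ennreal ((f x - g x)\<^sup>2) \<partial>lborel) \<le> ennreal (1 / real (Suc m))" for m :: nat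
  proof -
    have "1 / real (Suc m) > 0" by simp
    from C1c_dense[OF \<alpha> f L2 E this] show ?thesis by metis
  qed
  then obtain g where g: "\<And>m::nat. C1c (g m)" "\<And>m. Ealpha \<alpha> (\<lambda>x. f x - g m x) \<le> ennreal (1 / real (Suc m))"
    "\<And>m. (\<integral>\<^sup>+x. ennreal ((f x - g m x)\<^sup>2) \<partial>lborel) \<le> ennreal (1 / real (Suc m))"
    by metis
  have "(\<lambda>m. Eform k (\<lambda>x. f x - g m x) + (\<integral>\<^sup>+ x. ennreal ((f x - g m x)\<^sup>2) \<partial>lborel)) \<longlonglongrightarrow> 0"
  proof (rule tendsto_sandwich[OF _ _ tendsto_const])
    have lim: "(\<lambda>m. ennreal (1 / real (Suc m))) \<longlonglongrightarrow> ennreal 0"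
      by (intro tendsto_ennrealI LIMSEQ_Suc[OF lim_1_over_n])
    have "(\<lambda>m. ennreal (\<Lambda>1 / 2) * ennreal (1 / real (Suc m)) + ennreal (1 / real (Suc m))) \<longlonglongrightarrow> ennreal (\<Lambda>1 / 2) * ennreal 0 + ennreal 0"
      by (intro tendsto_add ennreal_tendsto_cmult lim) auto
    then show "(\<lambda>m. ennreal (\<Lambda>1 / 2) * ennreal (1 / real (Suc m)) + ennreal (1 / real (Suc m))) \<longlonglongrightarrow> 0" by simp
    show "\<forall>\<^sub>F m in sequentially. Eform k (\<lambda>x. f x - g m x) + (\<integral>\<^sup>+ x. ennreal ((f x - g m x)\<^sup>2) \<partial>lborel)
      \<le> ennreal (\<Lambda>1 / 2) * ennreal (1 / real (Suc m)) + ennreal (1 / real (Suc m))"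
    proof (intro always_eventually allI add_mono g)
      fix m
      have [measurable]: "g m \<in> borel_measurable borel" by (rule C1c_measurable[OF g(1)])
      have "Eform k (\<lambda>x. f x - g m x) \<le> ennreal (\<Lambda>1 / 2) * Ealpha \<alpha> (\<lambda>x. f x - g m x)"
        by (rule Eform_le_Ealpha[OF _ \<Lambda> up]) measurable
      also have "\<dots> \<le> ennreal (\<Lambda>1 / 2) * ennreal (1 / real (Suc m))" by (intro mult_left_mono g) auto
      finally show "Eform k (\<lambda>x. f x - g m x) \<le> \<dots>" .
    qed
  qed simp
  then show "f \<in> DomE k" using f int g(1) unfolding DomE_def by auto
qed

text \<open>Differences of approximants are coercive and have uniformly bounded
  \<open>Eform\<close>. Fatou's lemma along an almost everywhere convergent subsequence carries the
  resulting bound on \<open>Ealpha\<close> to f minus one fixed approximant.\<close>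

lemma DomE_subset_Hsob:
  fixes k :: "'a::euclidean_space \<Rightarrow> 'a \<Rightarrow> real"
  assumes \<alpha>: "0 < \<alpha>" "\<alpha> < 2"
    and k [measurable]: "(\<lambda>z. k (fst z) (snd z)) \<in> borel_measurable (lborel \<Otimes>\<^sub>M lborel)" and k0: "\<And>x y. k x y \<ge> 0"
    and c0: "c0 > 0" and coer: "\<And>f. C1c f \<Longrightarrow> ennreal c0 * Ealpha \<alpha> f \<le> Eform k f"
  shows "DomE k \<subseteq> Hsob \<alpha>"
proof
  fix f :: "'a \<Rightarrow> real" assume "f \<in> DomE k"
  then obtain g where f [measurable]: "f \<in> borel_measurable borel" and int: "integrable lborel (\<lambda>x. (f x)\<^sup>2)"
    and g: "\<And>m. C1c (g m)"
    and lim: "(\<lambda>m::nat. Eform k (\<lambda>x. f x - g m x) + (\<integral>\<^sup>+ x. ennreal ((f x - g m x)\<^sup>2) \<partial>lborel)) \<longlonglongrightarrow> 0"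
    unfolding DomE_def by auto
  have [measurable]: "g m \<in> borel_measurable borel" for m by (rule C1c_measurable[OF g])
  have limE: "(\<lambda>m. Eform k (\<lambda>x. f x - g m x)) \<longlonglongrightarrow> 0"
    by (rule tendsto_sandwich[OF _ _ tendsto_const lim]) (auto intro!: always_eventually simp: add_increasing2)
  have lim2: "(\<lambda>m. \<integral>\<^sup>+ x. ennreal ((f x - g m x)\<^sup>2) \<partial>lborel) \<longlonglongrightarrow> 0"
    by (rule tendsto_sandwich[OF _ _ tendsto_const lim]) (auto intro!: always_eventually simp: add_increasing)
  have "\<forall>\<^sub>F m in sequentially. Eform k (\<lambda>x. f x - g m x) < 1 \<and> (\<integral>\<^sup>+ x. ennreal ((f x - g m x)\<^sup>2) \<partial>lborel) < 1"
    by (intro eventually_conj order_tendstoD(2)[OF limE] order_tendstoD(2)[OF lim2]) auto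
  then obtain N where N: "\<And>m. m \<ge> N \<Longrightarrow> Eform k (\<lambda>x. f x - g m x) < 1"
    "\<And>m. m \<ge> N \<Longrightarrow> (\<integral>\<^sup>+ x. ennreal ((f x - g m x)\<^sup>2) \<partial>lborel) < 1"
    unfolding eventually_sequentially by blast
  \<comment> \<open>The shift by \<open>N\<close> puts every term of the sequence within 1 of
    \<open>f\<close>; boundedness is all that Fatou's lemma will ask for.\<close>
  define u where "u m = g (m + N)" for m
  have [measurable]: "u m \<in> borel_measurable borel" for m unfolding u_def by simp
  have ui: "integrable lborel (\<lambda>x. (f x - u m x)\<^sup>2)" for m
  proof (rule integrableI_nonneg)
    show "(\<integral>\<^sup>+ x. ennreal ((f x - u m x)\<^sup>2) \<partial>lborel) < \<infinity>"
      unfolding u_def using N(2)[of "m + N"] by (auto intro: less_trans)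
  qed auto
  have "(\<lambda>m. \<integral>x. norm ((f x - u m x)\<^sup>2) \<partial>lborel) \<longlonglongrightarrow> 0"
  proof -
    have "(\<integral>\<^sup>+ x. ennreal ((f x - u m x)\<^sup>2) \<partial>lborel) = ennreal (\<integral>x. norm ((f x - u m x)\<^sup>2) \<partial>lborel)" for m
      using ui by (subst nn_integral_eq_integral) auto
    moreover have "(\<lambda>m. \<integral>\<^sup>+ x. ennreal ((f x - u m x)\<^sup>2) \<partial>lborel) \<longlonglongrightarrow> 0"
      unfolding u_def by (rule LIMSEQ_ignore_initial_segment[OF lim2])
    ultimately show ?thesis by (simp add: ennreal_tendsto_0_iff)
  qed
  from tendsto_L1_AE_subseq[OF ui this]
  obtain s where s: "strict_mono s" "AE x in lborel. (\<lambda>n. (f x - u (s n) x)\<^sup>2) \<longlonglongrightarrow> 0" by blast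
  have AE: "AE x in lborel. (\<lambda>n. u (s n) x) \<longlonglongrightarrow> f x"
    using s(2)
  proof eventually_elim
    case (elim x)
    from tendsto_real_sqrt[OF elim] have "(\<lambda>n. \<bar>f x - u (s n) x\<bar>) \<longlonglongrightarrow> 0" by simp
    then have "(\<lambda>n. f x - u (s n) x) \<longlonglongrightarrow> 0" by (rule tendsto_rabs_zero_cancel)
    from tendsto_diff[OF tendsto_const[of "f x"] this] show ?case by simp
  qed
  \<comment> \<open>Going through \<open>f\<close>, both legs have \<open>Eform\<close> less than 1
    and are doubled, which gives 4.\<close>
  have bound: "Ealpha \<alpha> (\<lambda>x. u m x - g N x) \<le> ennreal (4 / c0)" for m
  proof -
    have "ennreal c0 * Ealpha \<alpha> (\<lambda>x. u m x - g N x) \<le> Eform k (\<lambda>x. u m x - g N x)"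
      unfolding u_def by (intro coer C1c_diff g)
    also have "(\<lambda>x. u m x - g N x) = (\<lambda>x. (u m x - f x) + (f x - g N x))" by simp
    also have "Eform k \<dots> \<le> 2 * Eform k (\<lambda>x. u m x - f x) + 2 * Eform k (\<lambda>x. f x - g N x)"
      by (rule Eform_add_le[OF _ _ k k0]) measurable
    also have "\<dots> \<le> 2 * 1 + 2 * 1"
      using N(1)[of "m + N"] N(1)[of N]
      by (intro add_mono mult_left_mono) (auto simp: u_def Eform_minus_commute[of k "g (m + N)"])
    finally have *: "ennreal c0 * Ealpha \<alpha> (\<lambda>x. u m x - g N x) \<le> ennreal 4" by simp
    have "Ealpha \<alpha> (\<lambda>x. u m x - g N x) = ennreal (1 / c0) * (ennreal c0 * Ealpha \<alpha> (\<lambda>x. u m x - g N x))"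
      using c0 by (simp add: mult.assoc[symmetric] ennreal_mult[symmetric])
    also have "\<dots> \<le> ennreal (1 / c0) * ennreal 4" by (intro mult_left_mono *) auto
    also have "\<dots> = ennreal (4 / c0)" using c0 by (subst ennreal_mult[symmetric]) auto
    finally show ?thesis .
  qed
  have "Ealpha \<alpha> (\<lambda>x. f x - g N x) \<le> ennreal (4 / c0)"
    unfolding Ealpha_eq
  proof (rule nn_integral_le_tendsto)
    show "AE z in lborel \<Otimes>\<^sub>M lborel. (\<lambda>n. ennreal ((u (s n) (snd z) - g N (snd z) - (u (s n) (fst z) - g N (fst z)))\<^sup>2 * riesz_kernel \<alpha> (fst z - snd z)))
      \<longlonglongrightarrow> ennreal ((f (snd z) - g N (snd z) - (f (fst z) - g N (fst z)))\<^sup>2 * riesz_kernel \<alpha> (fst z - snd z))"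
      using AE_lborel_pair[OF AE] by eventually_elim (intro tendsto_ennrealI tendsto_intros, auto)
    show "\<forall>\<^sub>F n in sequentially. (\<integral>\<^sup>+z. ennreal ((u (s n) (snd z) - g N (snd z) - (u (s n) (fst z) - g N (fst z)))\<^sup>2 * riesz_kernel \<alpha> (fst z - snd z)) \<partial>(lborel \<Otimes>\<^sub>M lborel)) \<le> ennreal (4 / c0)"
      using bound unfolding Ealpha_eq by (intro always_eventually allI)
  qed measurable
  then have fin: "Ealpha \<alpha> (\<lambda>x. f x - g N x) < \<infinity>" by (rule le_less_trans) simp
  \<comment> \<open>The fixed approximant is added back; it has finite \<open>Ealpha\<close> as a
    C^1 function of compact support.\<close>
  have "Ealpha \<alpha> (\<lambda>x. (f x - g N x) + g N x) \<le> 2 * Ealpha \<alpha> (\<lambda>x. f x - g N x) + 2 * Ealpha \<alpha> (g N)"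
    by (rule Ealpha_add_le) measurable
  also have "\<dots> < \<infinity>"
    using fin Ealpha_C1c_finite[OF \<alpha> g[of N]] by (auto simp: ennreal_mult_less_top)
  finally show "f \<in> Hsob \<alpha>" using f int by (simp add: Hsob_def)
qed

theorem theorem2p9:
  fixes k :: "'a::euclidean_space \<Rightarrow> 'a \<Rightarrow> real" and \<alpha> \<Lambda>1 :: real
  assumes "0 < \<alpha>" "\<alpha> < 2"
    and "(\<lambda>z. k (fst z) (snd z)) \<in> borel_measurable (lborel \<Otimes>\<^sub>M lborel)"
    and "\<And>x y. k x y \<ge> 0"
    and "\<And>x y. k x y = k y x"
    and "\<Lambda>1 > 0"
    and "AE z in lborel \<Otimes>\<^sub>M lborel. fst z \<noteq> snd z \<longrightarrow>
           k (fst z) (snd z) \<le> \<Lambda>1 * norm (fst z - snd z) powr (- real DIM('a) - \<alpha>)"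
    and "condB \<alpha> k"
  shows "(\<exists>c0>0. \<exists>c1>0. \<forall>f. C1c f \<longrightarrow>
            ennreal c0 * Ealpha \<alpha> f \<le> Eform k f \<and> Eform k f \<le> ennreal c1 * Ealpha \<alpha> f)
         \<and> DomE k = Hsob \<alpha>"
proof -
  note up = assms(7)[folded riesz_kernel_def]
  obtain c0 where c0: "c0 > 0" "\<And>f. C1c f \<Longrightarrow> ennreal c0 * Ealpha \<alpha> f \<le> Eform k f"
    using condB_coercive[OF assms(1-4,6) up assms(8)] by blast
  have "Eform k f \<le> ennreal (\<Lambda>1 / 2) * Ealpha \<alpha> f" if "C1c f" for f
    by (rule Eform_le_Ealpha[OF C1c_measurable[OF that] assms(6) up])
  moreover have "\<Lambda>1 / 2 > 0" using assms(6) by simp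
  moreover have "DomE k = Hsob \<alpha>"
    using DomE_subset_Hsob[OF assms(1-4) c0] Hsob_subset_DomE[OF assms(1,2,6) up] by (rule equalityI)
  ultimately show ?thesis using c0 by blast
qed

end
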